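(* Let $k\ge 1$, $r\ge 2$ be integers such that $k+1$ and $r-1$ are relatively prime, and let $t,q\in\mathbb{C}$ be primitive roots of unity of orders $k+1$ and $r-1$, respectively. Then the character $\chi_{k,r}(z,v)=\sum_{n,m\ge 0}\dim\big(F^{(k,r)}_{n}\big)_m z^nv^m$ is given by $$\chi_{k,r}(z,v)=\sum_{n=0}^\infty\left(b_n^{(k)}(v^{r-1})\prod_{s=1}^n\frac{1-v^{s(r-1)}}{1-v^s}\right)z^n,$$ where $$b_n^{(k)}(v)=\sum_{\substack{a,b\ge 0\\ (k+1)a+b=n}}\frac{(-1)^a v^{(k+1)a(a-1)/2}}{\prod_{i=1}^a(1-v^{(k+1)i})\prod_{j=1}^b(1-v^j)}.$$
   Context: $F_n^{(k,r)}$ is the space of all symmetric polynomials $f\in\mathbb{C}[x_1,\dots,x_n]^{\mathfrak{S}_n}$ that vanish whenever $x_i=t^{i-1}q^{s_i}x_1$ for $1<i\le k+1$, for every choice of $s_2,\dots,s_{k+1}\in\{0,1,\dots,r-2\}$ (no condition if $n\le k$; for $n=0$ the space is $\mathbb{C}$). It is graded by the usual degree with $\deg x_i=1$, and $\big(F_n^{(k,r)}\big)_m$ denotes the subspace of homogeneous polynomials of degree $m$. Identities are between formal power series in $z$ and $v$; rational functions of $v$ are expanded as power series in $v$. *)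

theory Defs
  imports
    Complex_Main
    "HOL-Library.Poly_Mapping"
    "HOL-Combinatorics.Permutations"
    "HOL-Computational_Algebra.Formal_Power_Series"
begin

text \<open>
  Polynomials over the complex numbers in variables \<open>x\<^sub>i\<close> indexed by naturals are the
  monoid algebra of exponent vectors. A polynomial in \<open>x\<^sub>1, \<dots>, x\<^sub>n\<close> is one whose monomials
  only involve indices in \<open>{1..n}\<close>.
\<close>

type_synonym monom = "nat \<Rightarrow>\<^sub>0 nat"
type_synonym cpoly = "monom \<Rightarrow>\<^sub>0 complex"

definition polys_in :: "nat \<Rightarrow> cpoly set" where
  "polys_in n = {f. \<forall>u\<in>Poly_Mapping.keys f. Poly_Mapping.keys u \<subseteq> {1..n}}"

definition eval_poly :: "(nat \<Rightarrow> complex) \<Rightarrow> cpoly \<Rightarrow> complex" where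
  "eval_poly x f =
     (\<Sum>u\<in>Poly_Mapping.keys f. Poly_Mapping.lookup f u *
        (\<Prod>i\<in>Poly_Mapping.keys u. x i ^ Poly_Mapping.lookup u i))"

text \<open>
  The substitution \<open>x\<^sub>i \<mapsto> x\<^bsub>\<sigma> i\<^esub>\<close> (for a bijection \<open>\<sigma>\<close>): the coefficient of a monomial
  \<open>u\<close> in the result is the coefficient in \<open>f\<close> of the monomial with exponents \<open>u \<circ> \<sigma>\<close>;
  see \<open>eval_permute_vars\<close> below.
\<close>

definition permute_vars :: "(nat \<Rightarrow> nat) \<Rightarrow> cpoly \<Rightarrow> cpoly" where
  "permute_vars \<sigma> f = Poly_Mapping.map_key (Poly_Mapping.map_key \<sigma>) f"

definition symmetric_polys :: "nat \<Rightarrow> cpoly set" where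
  "symmetric_polys n = {f \<in> polys_in n. \<forall>\<sigma>. \<sigma> permutes {1..n} \<longrightarrow> permute_vars \<sigma> f = f}"

definition homogeneous_polys :: "nat \<Rightarrow> cpoly set" where
  "homogeneous_polys m =
     {f. \<forall>u\<in>Poly_Mapping.keys f. (\<Sum>i\<in>Poly_Mapping.keys u. Poly_Mapping.lookup u i) = m}"

definition primitive_root_of_unity :: "nat \<Rightarrow> complex \<Rightarrow> bool" where
  "primitive_root_of_unity N w \<longleftrightarrow> N > 0 \<and> w ^ N = 1 \<and> (\<forall>j. 0 < j \<and> j < N \<longrightarrow> w ^ j \<noteq> 1)"

definition F_space :: "nat \<Rightarrow> nat \<Rightarrow> complex \<Rightarrow> complex \<Rightarrow> nat \<Rightarrow> cpoly set" where
  "F_space k r t q n =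
     {f \<in> symmetric_polys n.
        k + 1 \<le> n \<longrightarrow>
        (\<forall>s. (\<forall>i\<in>{2..k + 1}. s i \<in> {0..r - 2}) \<longrightarrow>
          (\<forall>x. (\<forall>i\<in>{2..k + 1}. x i = t ^ (i - 1) * q ^ s i * x 1) \<longrightarrow> eval_poly x f = 0))}"

definition F_graded :: "nat \<Rightarrow> nat \<Rightarrow> complex \<Rightarrow> complex \<Rightarrow> nat \<Rightarrow> nat \<Rightarrow> cpoly set" where
  "F_graded k r t q n m = F_space k r t q n \<inter> homogeneous_polys m"

definition scale_poly :: "complex \<Rightarrow> cpoly \<Rightarrow> cpoly" where
  "scale_poly c f = Poly_Mapping.map ((*) c) f"

lemma lookup_scale_poly [simp]:
  "Poly_Mapping.lookup (scale_poly c f) u = c * Poly_Mapping.lookup f u"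
  by (simp add: scale_poly_def Poly_Mapping.map.rep_eq when_def)

interpretation cpoly: vector_space scale_poly
  by unfold_locales (auto intro!: poly_mapping_eqI simp: lookup_add algebra_simps)

text \<open>
  The character as a formal power series in \<open>z\<close> (outer) with coefficients that are formal power
  series in \<open>v\<close> (inner). \<open>cpoly.dim\<close> is the dimension over the complex numbers; it is the genuine
  one because the graded pieces are finite-dimensional (\<open>F_graded_finite_dim\<close> below).
\<close>

definition character :: "nat \<Rightarrow> nat \<Rightarrow> complex \<Rightarrow> complex \<Rightarrow> rat fps fps" where
  "character k r t q =
     Abs_fps (\<lambda>n. Abs_fps (\<lambda>m. of_nat (cpoly.dim (F_graded k r t q n m))))"

text \<open>
  The indeterminate \<open>v\<close> is \<open>fps_X\<close>. All denominators have constant coefficient 1, so the divisions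
  are expansions as power series.
\<close>

definition b_series :: "nat \<Rightarrow> nat \<Rightarrow> rat fps" where
  "b_series k n =
     (\<Sum>(a, b)\<in>{(a, b). (k + 1) * a + b = n}.
        ((-1) ^ a * fps_X ^ ((k + 1) * a * (a - 1) div 2)) /
        ((\<Prod>i=1..a. 1 - fps_X ^ ((k + 1) * i)) * (\<Prod>j=1..b. 1 - fps_X ^ j)))"

lemma eval_poly_superset:
  assumes "finite A" "Poly_Mapping.keys f \<subseteq> A"
  shows "eval_poly x f = (\<Sum>u\<in>A. Poly_Mapping.lookup f u *
        (\<Prod>i\<in>Poly_Mapping.keys u. x i ^ Poly_Mapping.lookup u i))"
  unfolding eval_poly_def
  by (rule sum.mono_neutral_left) (use assms in \<open>auto simp: in_keys_iff\<close>)

lemma eval_poly_add: "eval_poly x (f + g) = eval_poly x f + eval_poly x g"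
proof -
  let ?A = "Poly_Mapping.keys f \<union> Poly_Mapping.keys g"
  have "Poly_Mapping.keys (f + g) \<subseteq> ?A" by (rule Poly_Mapping.keys_add)
  then show ?thesis
    by (simp add: eval_poly_superset[of ?A] lookup_add algebra_simps sum.distrib)
qed

lemma eval_poly_scale: "eval_poly x (scale_poly c f) = c * eval_poly x f"
proof -
  have "Poly_Mapping.keys (scale_poly c f) \<subseteq> Poly_Mapping.keys f"
    by (auto simp: in_keys_iff)
  then show ?thesis
    by (simp add: eval_poly_superset[of "Poly_Mapping.keys f"] sum_distrib_left mult.assoc)
qed

lemma bij_map_key:
  assumes "bij \<sigma>"
  shows "bij (Poly_Mapping.map_key \<sigma> :: monom \<Rightarrow> monom)"
proof (rule o_bij)
  have i: "inj \<sigma>" "inj (inv \<sigma>)"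
    using assms bij_imp_bij_inv bij_is_inj by blast+
  show "Poly_Mapping.map_key (inv \<sigma>) \<circ> (Poly_Mapping.map_key \<sigma> :: monom \<Rightarrow> monom) = id"
    using i assms
    by (auto simp: fun_eq_iff map_key.rep_eq bij_is_surj surj_f_inv_f intro!: poly_mapping_eqI)
  show "(Poly_Mapping.map_key \<sigma> :: monom \<Rightarrow> monom) \<circ> Poly_Mapping.map_key (inv \<sigma>) = id"
    using i
    by (auto simp: fun_eq_iff map_key.rep_eq intro!: poly_mapping_eqI)
qed

lemma lookup_permute_vars:
  assumes "bij \<sigma>"
  shows "Poly_Mapping.lookup (permute_vars \<sigma> f) u =
         Poly_Mapping.lookup f (Poly_Mapping.map_key \<sigma> u)"
  unfolding permute_vars_def
  using bij_is_inj[OF bij_map_key[OF assms]] by (simp add: map_key.rep_eq)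

lemma eval_permute_vars:
  assumes "bij \<sigma>"
  shows "eval_poly x (permute_vars \<sigma> f) = eval_poly (\<lambda>i. x (\<sigma> i)) f"
proof -
  let ?K = "Poly_Mapping.map_key \<sigma> :: monom \<Rightarrow> monom"
  have bK: "bij ?K" by (rule bij_map_key[OF assms])
  have i: "inj \<sigma>" using assms by (rule bij_is_inj)
  have *: "(\<Prod>i\<in>Poly_Mapping.keys (?K u). x (\<sigma> i) ^ Poly_Mapping.lookup (?K u) i) =
        (\<Prod>i\<in>Poly_Mapping.keys u. x i ^ Poly_Mapping.lookup u i)" for u
  proof -
    have "bij_betw \<sigma> (\<sigma> -` Poly_Mapping.keys u) (Poly_Mapping.keys u)"
      using assms by (auto simp: bij_betw_def inj_on_def surj_image_vimage_eq)
    from prod.reindex_bij_betw[OF this, of "\<lambda>i. x i ^ Poly_Mapping.lookup u i"]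
    show ?thesis using i by (simp add: keys_map_key map_key.rep_eq)
  qed
  have ks: "Poly_Mapping.keys (permute_vars \<sigma> f) = ?K -` Poly_Mapping.keys f"
    by (auto simp: in_keys_iff lookup_permute_vars[OF assms])
  have "bij_betw ?K (?K -` Poly_Mapping.keys f) (Poly_Mapping.keys f)"
    using bK by (auto simp: bij_betw_def inj_on_def surj_image_vimage_eq)
  from sum.reindex_bij_betw[OF this, of "\<lambda>u. Poly_Mapping.lookup f u *
        (\<Prod>i\<in>Poly_Mapping.keys u. x (\<sigma> i) ^ Poly_Mapping.lookup u i)"]
  show ?thesis
    unfolding eval_poly_def ks by (simp add: * lookup_permute_vars[OF assms])
qed

lemma subspace_F_graded: "cpoly.subspace (F_graded k r t q n m)"
proof -
  have perm: "permute_vars \<sigma> (f + g) = permute_vars \<sigma> f + permute_vars \<sigma> g"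
    "permute_vars \<sigma> (scale_poly c f) = scale_poly c (permute_vars \<sigma> f)"
    if "\<sigma> permutes {1..n}" for \<sigma> f g c
    using permutes_bij[OF that]
    by (auto intro!: poly_mapping_eqI simp: lookup_permute_vars lookup_add)
  have perm0: "permute_vars \<sigma> 0 = 0" if "\<sigma> permutes {1..n}" for \<sigma>
    using permutes_bij[OF that] by (auto intro!: poly_mapping_eqI simp: lookup_permute_vars)
  have ev0: "eval_poly x 0 = 0" for x by (simp add: eval_poly_def)
  have ka: "u \<in> Poly_Mapping.keys f \<or> u \<in> Poly_Mapping.keys g"
    if "u \<in> Poly_Mapping.keys (f + g)" for u and f g :: cpoly
    using that Poly_Mapping.keys_add[of f g] by blast
  have ks: "u \<in> Poly_Mapping.keys f"
    if "u \<in> Poly_Mapping.keys (scale_poly c f)" for u c f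
    using that by (auto simp: in_keys_iff)
  show ?thesis
    unfolding cpoly.subspace_def F_graded_def F_space_def symmetric_polys_def polys_in_def
      homogeneous_polys_def
    apply (intro conjI ballI allI)
    subgoal by (simp add: perm0 ev0)
    subgoal by (auto simp: perm eval_poly_add dest!: ka)
    subgoal by (auto simp: perm eval_poly_scale dest!: ks)
    done
qed

lemma F_graded_finite_dim:
  "\<exists>B. finite B \<and> F_graded k r t q n m \<subseteq> cpoly.span B"
proof -
  define U where "U = {u :: monom. Poly_Mapping.keys u \<subseteq> {1..n} \<and>
    (\<Sum>i\<in>Poly_Mapping.keys u. Poly_Mapping.lookup u i) = m}"
  have "finite {g :: nat \<Rightarrow> nat. \<forall>i. (i \<in> {1..n} \<longrightarrow> g i \<in> {0..m}) \<and> (i \<notin> {1..n} \<longrightarrow> g i = 0)}"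
    by (rule finite_set_of_finite_funs) auto
  moreover have "Poly_Mapping.lookup ` U \<subseteq>
      {g. \<forall>i. (i \<in> {1..n} \<longrightarrow> g i \<in> {0..m}) \<and> (i \<notin> {1..n} \<longrightarrow> g i = 0)}"
  proof clarify
    fix u i assume u: "u \<in> U"
    have "Poly_Mapping.lookup u i \<le> m"
    proof (cases "i \<in> Poly_Mapping.keys u")
      case True
      then show ?thesis using u member_le_sum[of i "Poly_Mapping.keys u" "Poly_Mapping.lookup u"]
        by (simp add: U_def)
    qed (simp add: in_keys_iff)
    moreover have "i \<notin> {1..n} \<longrightarrow> Poly_Mapping.lookup u i = 0"
      using u unfolding U_def in_keys_iff[symmetric] subset_iff by (metis (lifting) in_keys_iff mem_Collect_eq)
    ultimately show "(i \<in> {1..n} \<longrightarrow> Poly_Mapping.lookup u i \<in> {0..m}) \<and>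
        (i \<notin> {1..n} \<longrightarrow> Poly_Mapping.lookup u i = 0)" by simp
  qed
  ultimately have "finite (Poly_Mapping.lookup ` U)" by (rule finite_subset[rotated])
  then have fU: "finite U"
    by (rule finite_imageD) (auto simp: inj_on_def poly_mapping.lookup_inject)
  let ?B = "(\<lambda>u. Poly_Mapping.single u (1 :: complex)) ` U"
  have "f \<in> cpoly.span ?B" if f: "f \<in> F_graded k r t q n m" for f
  proof -
    have kf: "Poly_Mapping.keys f \<subseteq> U"
      using f by (auto simp: F_graded_def F_space_def symmetric_polys_def polys_in_def
          homogeneous_polys_def U_def)
    have "f = (\<Sum>u\<in>Poly_Mapping.keys f.
        scale_poly (Poly_Mapping.lookup f u) (Poly_Mapping.single u 1))"
    proof (rule poly_mapping_eqI)
      fix w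
      show "Poly_Mapping.lookup f w = Poly_Mapping.lookup (\<Sum>u\<in>Poly_Mapping.keys f.
        scale_poly (Poly_Mapping.lookup f u) (Poly_Mapping.single u 1)) w"
        by (simp add: lookup_sum lookup_single when_def in_keys_iff if_distrib[of "(*) _"]
            sum.delta cong: if_cong)
    qed
    moreover have "\<dots> \<in> cpoly.span ?B"
      using kf by (intro cpoly.span_sum cpoly.span_scale cpoly.span_base) auto
    ultimately show ?thesis by simp
  qed
  then show ?thesis using fU by blast
qed

end

theory Submission
  imports Defs "HOL-Computational_Algebra.Formal_Laurent_Series"
begin

text \<open>
  Put \<open>p = r - 1\<close> and \<open>\<tau> = t^p\<close>, again a primitive root of unity of order \<open>k + 1\<close>. Since \<open>q\<close> has
  order \<open>p\<close>, the vanishing condition only depends on \<open>y\<^sub>i = x\<^sub>i^p\<close>: it says that \<open>f\<close> vanishes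
  whenever \<open>y\<^sub>i = \<tau>^(i - 1) y\<^sub>1\<close> for \<open>i \<le> k + 1\<close>.

  Symmetric polynomials in \<open>x\<close> form a free module over symmetric polynomials in \<open>y\<close>: the monomial
  symmetric functions of the partitions whose successive differences are less than \<open>p\<close> are a basis,
  because lowest terms in the lexicographic order are distinct. Restricted to the \<open>p^n\<close> points of the
  fibre over a generic \<open>y\<close>, these \<open>p^n\<close> functions span all functions, so they are independent there;
  hence \<open>f\<close> satisfies the condition iff all its coefficients, as polynomials in \<open>y\<close>, vanish on
  the locus in \<open>y\<close>. This accounts for the product factor in the character.

  In the variables \<open>y\<close>, a symmetric polynomial is a linear functional on polynomials in variables
  \<open>e\<^sub>0, e\<^sub>1, \<dots>\<close>, and the condition says that it kills the ideal generated by the coefficients of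
  \<open>e(z) e(\<tau>z) \<dots> e(\<tau>^k z)\<close>, where \<open>e(z) = \<Sum> e\<^sub>i z^i\<close>. Only powers of \<open>z^(k + 1)\<close> occur, and the
  coefficient of \<open>z^((k + 1) i)\<close> has lowest term \<open>e\<^sub>i^(k + 1)\<close>, so the quotient has the monomials with
  all exponents at most \<open>k\<close> as a basis. The generating function of these monomials and \<open>b\<^sub>n\<close> satisfy
  the same recursion in \<open>n\<close>.
\<close>

text \<open>Coprimality of \<open>k + 1\<close> and \<open>r - 1\<close> guarantees the exact order
  of \<tau>. Hence the wheel locus contains points with pairwise distinct nonzero coordinates. Over
  such a point the fibre is as large as possible and no two of its points are permutations of each
  other, so symmetric polynomials can separate them; over other points both properties may fail, and
  these are reached by continuity. Lowest monomials are compared instead of leading ones because the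
  pure power of \<open>e\<^sub>i\<close> is the smallest monomial of its coefficient. The signed
  formula for \<open>b\<^sub>n\<close> comes from a product: monomials with all exponents at most k
  are counted by the product over i of 1 + v^i z + ... + v^(k i) z^k, which is (1 - v^((k + 1) i)
  z^(k + 1)) / (1 - v^i z). Euler's two identities expand the numerators into the sum over a and the
  reciprocals into the sum over b.\<close>

abbreviation lookup :: "('a \<Rightarrow>\<^sub>0 'b::zero) \<Rightarrow> 'a \<Rightarrow> 'b" where "lookup \<equiv> Poly_Mapping.lookup"
abbreviation keys :: "('a \<Rightarrow>\<^sub>0 'b::zero) \<Rightarrow> 'a set" where "keys \<equiv> Poly_Mapping.keys"
abbreviation single :: "'a \<Rightarrow> 'b::zero \<Rightarrow> 'a \<Rightarrow>\<^sub>0 'b" where "single \<equiv> Poly_Mapping.single"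

section \<open>Lowest terms\<close>

text \<open>The order on monomials is lexicographic, decided at the smallest index where two
  exponent vectors differ. It is total and compatible with addition, so \<open>low\<close> behaves
  like a valuation; at 0 it is an unspecified \<open>Min {}\<close>.\<close>

definition low :: "cpoly \<Rightarrow> monom" where
  "low f = Min (keys f)"

lemma low_in_keys: "f \<noteq> 0 \<Longrightarrow> low f \<in> keys f"
  by (simp add: low_def)

lemma lookup_low: "f \<noteq> 0 \<Longrightarrow> lookup f (low f) \<noteq> 0"
  using low_in_keys by (simp add: in_keys_iff)

lemma low_le: "u \<in> keys f \<Longrightarrow> low f \<le> u"
  by (simp add: low_def)

lemma lookup_below_low: "u < low f \<Longrightarrow> lookup f u = 0"
  using low_le[of u f] by (metis in_keys_iff leD)

lemma low_eqI:
  assumes "lookup f u \<noteq> 0" "\<And>w. w \<in> keys f \<Longrightarrow> u \<le> w"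
  shows "low f = u"
  unfolding low_def using assms by (intro Min_eqI) (auto simp: in_keys_iff)

lemma cpoly_eq_sum_single: "f = (\<Sum>u\<in>keys f. single u (lookup f u))" for f :: "'a \<Rightarrow>\<^sub>0 'b::comm_monoid_add"
  by (rule poly_mapping_eqI)
    (simp add: lookup_sum lookup_single when_def in_keys_iff sum.delta)

lemma mult_eq_sum:
  "f * g = (\<Sum>u\<in>keys f. \<Sum>w\<in>keys g. single (u + w) (lookup f u * lookup g w))" for f g :: cpoly
proof -
  have "f * g = (\<Sum>u\<in>keys f. single u (lookup f u)) * (\<Sum>w\<in>keys g. single w (lookup g w))"
    by (simp flip: cpoly_eq_sum_single)
  then show ?thesis by (simp add: sum_product mult_single)
qed

lemma lookup_mult_eq_sum:
  "lookup (f * g) x = (\<Sum>u\<in>keys f. \<Sum>w\<in>keys g. if u + w = x then lookup f u * lookup g w else 0)"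
  for f g :: cpoly
  by (simp add: mult_eq_sum[of f g] lookup_sum lookup_single when_def)

text \<open>Only the two lowest monomials add up to \<open>low f + low g\<close>, so nothing can
  cancel at that monomial.\<close>

lemma lookup_mult_low:
  assumes "f \<noteq> 0" "g \<noteq> 0"
  shows "lookup (f * g) (low f + low g) = lookup f (low f) * lookup g (low g)"
proof -
  have *: "u + w = low f + low g \<longleftrightarrow> u = low f \<and> w = low g" if "u \<in> keys f" "w \<in> keys g" for u w
    using low_le[OF that(1)] low_le[OF that(2)]
    by (metis add_le_cancel_right add_left_cancel add_right_mono antisym add_left_mono)
  have "lookup (f * g) (low f + low g) =
    (\<Sum>u\<in>keys f. \<Sum>w\<in>keys g. if u = low f then (if w = low g then lookup f u * lookup g w else 0) else 0)"
    unfolding lookup_mult_eq_sum by (intro sum.cong refl) (auto simp: *)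
  also have "\<dots> = (\<Sum>u\<in>keys f. if u = low f then (\<Sum>w\<in>keys g. if w = low g then lookup f u * lookup g w else 0) else 0)"
    by (intro sum.cong refl) auto
  also have "\<dots> = lookup f (low f) * lookup g (low g)"
    using low_in_keys[OF assms(1)] low_in_keys[OF assms(2)] by (simp add: sum.delta)
  finally show ?thesis .
qed

lemma low_mult:
  assumes "f \<noteq> 0" "g \<noteq> 0"
  shows "low (f * g) = low f + low g"
proof (rule low_eqI)
  show "lookup (f * g) (low f + low g) \<noteq> 0"
    using lookup_mult_low[OF assms] lookup_low assms by simp
  fix w assume "w \<in> keys (f * g)"
  then obtain a b where "a \<in> keys f" "b \<in> keys g" "w = a + b"
    using Poly_Mapping.keys_mult[of f g] by blast
  then show "low f + low g \<le> w"
    using low_le by (simp add: add_mono)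
qed

lemma low_single [simp]: "c \<noteq> 0 \<Longrightarrow> low (single u c) = u"
  by (simp add: low_def)

lemma low_one [simp]: "low 1 = 0"
  by (simp add: low_def)

lemma single_ne_0 [simp]: "single u (c::'b::zero) = 0 \<longleftrightarrow> c = 0"
  by (metis lookup_single_eq lookup_zero single_zero)

lemma low_prod:
  assumes "finite A" "\<And>a. a \<in> A \<Longrightarrow> f a \<noteq> 0"
  shows "low (\<Prod>a\<in>A. f a) = (\<Sum>a\<in>A. low (f a))"
  using assms by (induction A rule: finite_induct) (auto simp: low_mult)

lemma low_power:
  assumes "f \<noteq> 0"
  shows "low (f ^ j) = (\<Sum>_<j. low f)"
  using assms by (induction j) (simp_all add: low_mult add.commute del: sum_constant)

text \<open>At the smallest of the lowest monomials exactly one summand has a nonzero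
  coefficient.\<close>

lemma sum_distinct_low_ne_0:
  assumes A: "finite A" "A \<noteq> {}" and nz: "\<And>a. a \<in> A \<Longrightarrow> f a \<noteq> 0" and inj: "inj_on (\<lambda>a. low (f a)) A"
  shows "(\<Sum>a\<in>A. f a) \<noteq> 0"
proof -
  define m where "m = Min ((\<lambda>a. low (f a)) ` A)"
  have "m \<in> (\<lambda>a. low (f a)) ` A" unfolding m_def using A by (intro Min_in) auto
  then obtain a where a: "a \<in> A" "m = low (f a)" by auto
  have "lookup (f b) m = 0" if "b \<in> A" "b \<noteq> a" for b
  proof -
    have "low (f b) \<noteq> m" using inj that a by (auto simp: inj_on_def)
    moreover have "m \<le> low (f b)" unfolding m_def using A that by (intro Min_le) auto
    ultimately show ?thesis by (intro lookup_below_low) auto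
  qed
  then have "lookup (\<Sum>a\<in>A. f a) m = lookup (f a) m"
    unfolding lookup_sum using A a by (subst sum.remove[of A a]) auto
  also have "\<dots> \<noteq> 0" using a nz lookup_low by simp
  finally show ?thesis by auto
qed

section \<open>Independence and spanning from lowest terms\<close>

lemma scale_poly_eq_0_iff [simp]: "scale_poly c f = 0 \<longleftrightarrow> c = 0 \<or> f = 0"
  by (rule cpoly.scale_eq_0_iff)

lemma low_scale: "c \<noteq> 0 \<Longrightarrow> low (scale_poly c f) = low f"
proof -
  assume "c \<noteq> 0"
  then have "keys (scale_poly c f) = keys f" by (auto simp: in_keys_iff)
  then show ?thesis by (simp add: low_def)
qed

lemma scale_poly_eq_mult: "scale_poly c f = single 0 c * f"
  by (simp add: scale_poly_def mult_map_scale_conv_mult)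

lemma mult_scale_poly: "f * scale_poly c g = scale_poly c (f * g)"
  by (simp add: scale_poly_eq_mult mult.left_commute)

text \<open>Passes from an indexed family to its image as a set; injectivity belongs to the
  conclusion so that dimensions can be counted on the index set.\<close>

lemma independent_family:
  assumes fin: "finite J"
    and *: "\<And>c. (\<Sum>j\<in>J. scale_poly (c j) (b j)) = 0 \<Longrightarrow> \<forall>j\<in>J. c j = 0"
  shows "cpoly.independent (b ` J)" "inj_on b J"
proof -
  show inj: "inj_on b J"
  proof (rule inj_onI, rule ccontr)
    fix i j assume ij: "i \<in> J" "j \<in> J" "b i = b j" "i \<noteq> j"
    let ?c = "\<lambda>l. if l = i then 1 else if l = j then - 1 else (0::complex)"
    have "(\<Sum>l\<in>J. scale_poly (?c l) (b l)) = (\<Sum>l\<in>{i,j}. scale_poly (?c l) (b l))"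
      using ij fin by (intro sum.mono_neutral_right) auto
    also have "\<dots> = 0" using ij by simp
    finally have "\<forall>l\<in>J. ?c l = 0" by (rule *)
    then show False using ij(1) by auto
  qed
  show "cpoly.independent (b ` J)"
  proof (rule cpoly.independent_if_scalars_zero)
    show "finite (b ` J)" using fin by simp
    fix f x assume "(\<Sum>x\<in>b ` J. scale_poly (f x) x) = 0" "x \<in> b ` J"
    then show "f x = 0" using *[of "f \<circ> b"] by (auto simp: sum.reindex[OF inj])
  qed
qed

lemma distinct_low_coeffs_0:
  assumes "finite J" "\<And>j. j \<in> J \<Longrightarrow> b j \<noteq> 0" "inj_on (\<lambda>j. low (b j)) J"
    and "(\<Sum>j\<in>J. scale_poly (c j) (b j)) = 0"
  shows "\<forall>j\<in>J. c j = 0"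
proof (rule ccontr)
  define A where "A = {j\<in>J. c j \<noteq> 0}"
  assume "\<not> (\<forall>j\<in>J. c j = 0)"
  then have "A \<noteq> {}" by (auto simp: A_def)
  have "(\<Sum>j\<in>A. scale_poly (c j) (b j)) \<noteq> 0"
    using assms \<open>A \<noteq> {}\<close>
    by (intro sum_distinct_low_ne_0) (auto simp: A_def inj_on_def low_scale)
  also have "(\<Sum>j\<in>A. scale_poly (c j) (b j)) = (\<Sum>j\<in>J. scale_poly (c j) (b j))"
    using assms by (intro sum.mono_neutral_left) (auto simp: A_def)
  finally show False using assms by simp
qed

text \<open>Elimination from below: subtracting a multiple of a member of \<open>B\<close> with the
  same lowest monomial raises the lowest monomial of \<open>f\<close>. This stops because all
  monomials involved lie in the finite set \<open>U\<close>.\<close>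

lemma span_by_low:
  assumes U: "finite U" and V: "cpoly.subspace V" "\<And>f. f \<in> V \<Longrightarrow> keys f \<subseteq> U" and "B \<subseteq> V"
    and *: "\<And>f. f \<in> V \<Longrightarrow> f \<noteq> 0 \<Longrightarrow> \<exists>b\<in>B. b \<noteq> 0 \<and> low b = low f"
  shows "V \<subseteq> cpoly.span B"
proof
  fix f assume "f \<in> V"
  then show "f \<in> cpoly.span B"
  proof (induction "card {u\<in>U. low f \<le> u}" arbitrary: f rule: less_induct)
    case less
    show ?case
    proof (cases "f = 0")
      case False
      then obtain b where b: "b \<in> B" "b \<noteq> 0" "low b = low f" using * less.prems by blast
      define c where "c = lookup f (low f) / lookup b (low f)"
      define g where "g = f - scale_poly c b"
      have gV: "g \<in> V" unfolding g_def
        using V(1) less.prems b assms(4) by (intro cpoly.subspace_diff cpoly.subspace_scale) auto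
      have "g \<in> cpoly.span B"
      proof (cases "g = 0")
        case True
        then show ?thesis by (simp add: cpoly.span_zero)
      next
        case gne: False
        have bl: "lookup b (low f) \<noteq> 0" using lookup_low[OF b(2)] b(3) by simp
        have g0: "lookup g u = 0" if "u \<le> low f" for u
        proof (cases "u = low f")
          case True
          then show ?thesis using bl by (simp add: g_def c_def lookup_minus)
        next
          case False
          then have "u < low f" using that by simp
          then show ?thesis using b(3) lookup_below_low[of u] by (simp add: g_def lookup_minus)
        qed
        have lt: "low f < low g"
          using lookup_low[OF gne] g0 by (meson not_le)
        have "{u\<in>U. low g \<le> u} \<subset> {u\<in>U. low f \<le> u}"
        proof
          show "{u\<in>U. low g \<le> u} \<subseteq> {u\<in>U. low f \<le> u}" using lt by auto
          have "low f \<in> U" using V(2)[OF less.prems] low_in_keys[OF False] by auto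
          then have "low f \<in> {u\<in>U. low f \<le> u}" "low f \<notin> {u\<in>U. low g \<le> u}" using lt by auto
          then show "{u\<in>U. low g \<le> u} \<noteq> {u\<in>U. low f \<le> u}" by blast
        qed
        then have "card {u\<in>U. low g \<le> u} < card {u\<in>U. low f \<le> u}"
          using U by (intro psubset_card_mono) auto
        then show ?thesis using less.hyps gV by blast
      qed
      then have "g + scale_poly c b \<in> cpoly.span B"
        by (intro cpoly.span_add cpoly.span_scale cpoly.span_base[OF b(1)])
      then show ?thesis by (simp add: g_def)
    qed (simp add: cpoly.span_zero)
  qed
qed

section \<open>Evaluation\<close>

definition eval_mon :: "(nat \<Rightarrow> complex) \<Rightarrow> monom \<Rightarrow> complex" where
  "eval_mon x u = (\<Prod>i\<in>keys u. x i ^ lookup u i)"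

lemma eval_mon_superset:
  assumes "finite A" "keys u \<subseteq> A"
  shows "eval_mon x u = (\<Prod>i\<in>A. x i ^ lookup u i)"
  unfolding eval_mon_def
  by (rule prod.mono_neutral_left) (use assms in \<open>auto simp: in_keys_iff\<close>)

lemma eval_mon_add: "eval_mon x (u + w) = eval_mon x u * eval_mon x w"
proof -
  have "keys (u + w) \<subseteq> keys u \<union> keys w" by (rule Poly_Mapping.keys_add)
  then show ?thesis
    by (simp add: eval_mon_superset[of "keys u \<union> keys w"] lookup_add power_add prod.distrib)
qed

lemma eval_mon_0 [simp]: "eval_mon x 0 = 1"
  by (simp add: eval_mon_def)

lemma eval_poly_eq: "eval_poly x f = (\<Sum>u\<in>keys f. lookup f u * eval_mon x u)"
  by (simp add: eval_poly_def eval_mon_def)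

lemma eval_poly_sup:
  assumes "finite A" "keys f \<subseteq> A"
  shows "eval_poly x f = (\<Sum>u\<in>A. lookup f u * eval_mon x u)"
  using eval_poly_superset[OF assms] by (simp add: eval_mon_def)

lemma eval_poly_0 [simp]: "eval_poly x 0 = 0"
  by (simp add: eval_poly_def)

lemma eval_poly_single [simp]: "eval_poly x (single u c) = c * eval_mon x u"
  by (cases "c = 0") (simp_all add: eval_poly_eq)

lemma eval_poly_sum: "eval_poly x (\<Sum>a\<in>A. f a) = (\<Sum>a\<in>A. eval_poly x (f a))"
  by (induction A rule: infinite_finite_induct) (simp_all add: eval_poly_add)

lemma eval_poly_mult: "eval_poly x (f * g) = eval_poly x f * eval_poly x g"
  by (simp add: mult_eq_sum[of f g] eval_poly_sum eval_poly_eq[of x f] eval_poly_eq[of x g] sum_product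
      eval_mon_add mult_ac)

lemma eval_poly_1 [simp]: "eval_poly x 1 = 1"
  by (simp flip: single_one)

lemma eval_poly_prod: "eval_poly x (\<Prod>a\<in>A. f a) = (\<Prod>a\<in>A. eval_poly x (f a))"
  by (induction A rule: infinite_finite_induct) (simp_all add: eval_poly_mult)

lemma eval_poly_minus: "eval_poly x (f - g) = eval_poly x f - eval_poly x g"
  by (metis add_diff_cancel diff_add_cancel eval_poly_add)

lemma eval_mon_cong: "(\<And>i. i \<in> keys u \<Longrightarrow> x i = y i) \<Longrightarrow> eval_mon x u = eval_mon y u"
  by (simp add: eval_mon_def)

lemma eval_poly_cong:
  assumes "f \<in> polys_in n" "\<And>i. i \<in> {1..n} \<Longrightarrow> x i = y i"
  shows "eval_poly x f = eval_poly y f"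
  unfolding eval_poly_eq using assms
  by (intro sum.cong refl arg_cong2[of _ _ _ _ "(*)"] eval_mon_cong) (fastforce simp: polys_in_def)

lemma power_sum_zero_coeffs:
  fixes c :: "nat \<Rightarrow> complex"
  assumes "\<And>z. (\<Sum>d\<le>D. c d * z ^ d) = 0" "d \<le> D"
  shows "c d = 0"
  using assms polyfun_eq_0[of c D] by blast

text \<open>Induction on the number of variables: \<open>f\<close> is read as a polynomial in the
  last variable with coefficients \<open>g d\<close> in the others, and a univariate polynomial that
  vanishes everywhere has zero coefficients.\<close>

lemma eval_poly_zero_aux:
  assumes "\<And>u. u \<in> keys f \<Longrightarrow> keys u \<subseteq> {..<N}" "\<And>x. eval_poly x f = 0"
  shows "f = 0"
  using assms
proof (induction N arbitrary: f)
  case 0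
  then have "keys f \<subseteq> {0}" by auto
  then have "eval_poly (\<lambda>_. 0) f = lookup f 0"
    by (subst eval_poly_sup[of "{0}"]) auto
  then have "lookup f 0 = 0" using 0(2) by simp
  then have "0 \<notin> keys f" by (simp add: in_keys_iff)
  then have "keys f = {}" using \<open>keys f \<subseteq> {0}\<close> by blast
  then show ?case by (metis all_not_in_conv in_keys_iff lookup_zero poly_mapping_eqI)
next
  case (Suc N)
  define D where "D = Max (insert 0 ((\<lambda>u. lookup u N) ` keys f))"
  have D: "lookup u N \<le> D" if "u \<in> keys f" for u
    unfolding D_def using that by (intro Max_ge) auto
  define S where "S d = {u\<in>keys f. lookup u N = d}" for d
  define g where "g d = (\<Sum>u\<in>S d. single (u - single N d) (lookup f u))" for d
  have kN: "keys (u - single N (lookup u N)) \<subseteq> {..<N}" if "u \<in> keys f" for u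
  proof
    fix i assume "i \<in> keys (u - single N (lookup u N))"
    then have "lookup u i - (lookup u N when N = i) \<noteq> 0"
      by (simp add: in_keys_iff lookup_minus lookup_single)
    then have "i \<noteq> N" "i \<in> keys u" by (auto simp: in_keys_iff when_def split: if_splits)
    then show "i \<in> {..<N}" using Suc.prems(1)[OF that] by auto
  qed
  have spl: "u = (u - single N (lookup u N)) + single N (lookup u N)" for u :: monom
    by (rule poly_mapping_eqI) (auto simp: lookup_add lookup_minus lookup_single when_def)
  have fin: "finite (S d)" for d by (simp add: S_def)
  have ev: "eval_poly x f = (\<Sum>d\<le>D. eval_poly x (g d) * x N ^ d)" for x
  proof -
    have "eval_poly x f = (\<Sum>d\<le>D. \<Sum>u\<in>S d. lookup f u * eval_mon x u)"
      unfolding eval_poly_eq S_def by (rule sum.group[symmetric]) (use D in auto)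
    also have "\<dots> = (\<Sum>d\<le>D. eval_poly x (g d) * x N ^ d)"
    proof (intro sum.cong refl)
      fix d
      have "lookup f u * eval_mon x u = lookup f u * eval_mon x (u - single N d) * x N ^ d" if "u \<in> S d" for u
      proof -
        have "eval_mon x u = eval_mon x ((u - single N d) + single N d)"
          using spl[of u] that by (simp add: S_def)
        also have "\<dots> = eval_mon x (u - single N d) * x N ^ d"
          unfolding eval_mon_add by (cases "d = 0") (simp_all add: eval_mon_def[of x "single N d"])
        finally show ?thesis by simp
      qed
      then have "(\<Sum>u\<in>S d. lookup f u * eval_mon x u) =
          (\<Sum>u\<in>S d. lookup f u * eval_mon x (u - single N d) * x N ^ d)"
        by (rule sum.cong[OF refl])
      then show "(\<Sum>u\<in>S d. lookup f u * eval_mon x u) = eval_poly x (g d) * x N ^ d"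
        by (simp add: g_def eval_poly_sum sum_distrib_right)
    qed
    finally show ?thesis .
  qed
  have kg: "keys u \<subseteq> {..<N}" if "u \<in> keys (g d)" for u d
  proof -
    have "u \<in> (\<Union>w\<in>S d. keys (single (w - single N d) (lookup f w)))"
      using that Poly_Mapping.keys_sum[of "\<lambda>u. single (u - single N d) (lookup f u)" "S d"] by (auto simp: g_def)
    then show ?thesis using kN by (auto simp: S_def split: if_splits)
  qed
  have "g d = 0" if "d \<le> D" for d
  proof (rule Suc.IH)
    show "\<And>u. u \<in> keys (g d) \<Longrightarrow> keys u \<subseteq> {..<N}" by (rule kg)
    fix x
    \<comment> \<open>\<open>g d\<close> does not involve variable \<open>N\<close>, so that
      variable can run through all values while the coefficients stay fixed.\<close>
    have "eval_poly (x(N := z)) (g d) = eval_poly x (g d)" for z d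
      unfolding eval_poly_eq using kg
      by (intro sum.cong refl arg_cong2[of _ _ _ _ "(*)"] eval_mon_cong) fastforce
    then have "(\<Sum>d\<le>D. eval_poly x (g d) * z ^ d) = 0" for z
      using ev[of "x(N := z)"] Suc.prems(2) by simp
    then show "eval_poly x (g d) = 0" using power_sum_zero_coeffs[of "\<lambda>d. eval_poly x (g d)" D d] that by blast
  qed
  have "lookup f u = 0" for u
  proof (rule ccontr)
    assume "lookup f u \<noteq> 0"
    then have u: "u \<in> keys f" by (simp add: in_keys_iff)
    define d where "d = lookup u N"
    have inj: "w = u" if "w \<in> S d" "w - single N d = u - single N d" for w
      using that spl[of u] spl[of w] by (auto simp: S_def d_def)
    have "lookup (g d) (u - single N d) = (\<Sum>w\<in>S d. if w = u then lookup f w else 0)"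
      unfolding g_def lookup_sum lookup_single when_def using inj by (intro sum.cong) auto
    also have "\<dots> = lookup f u" using fin u by (simp add: S_def d_def)
    finally show False using \<open>lookup f u \<noteq> 0\<close> \<open>\<And>d. d \<le> D \<Longrightarrow> g d = 0\<close> D[OF u] by (simp add: d_def)
  qed
  then show ?case by (intro poly_mapping_eqI) simp
qed

lemma eval_poly_zero_imp:
  assumes "\<And>x. eval_poly x f = 0"
  shows "f = 0"
proof -
  have "finite (\<Union>u\<in>keys f. keys u)" by simp
  then obtain N where "(\<Union>u\<in>keys f. keys u) \<subseteq> {..<N}"
    using finite_nat_iff_bounded by blast
  then show ?thesis using assms by (intro eval_poly_zero_aux[of f N]) auto
qed

text \<open>Allows identities about substitutions and permutations to be checked on values instead
  of coefficients.\<close>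

lemma eval_poly_inject: "(\<And>x. eval_poly x f = eval_poly x g) \<Longrightarrow> f = g"
  using eval_poly_zero_imp[of "f - g"] by (simp add: eval_poly_minus)

section \<open>Symmetric polynomials\<close>

definition deg :: "monom \<Rightarrow> nat" where
  "deg u = (\<Sum>i\<in>keys u. lookup u i)"

lemma deg_superset:
  assumes "finite A" "keys u \<subseteq> A"
  shows "deg u = (\<Sum>i\<in>A. lookup u i)"
  unfolding deg_def by (rule sum.mono_neutral_left) (use assms in \<open>auto simp: in_keys_iff\<close>)

lemma deg_add [simp]: "deg (u + w) = deg u + deg w"
proof -
  have "keys (u + w) \<subseteq> keys u \<union> keys w" by (rule Poly_Mapping.keys_add)
  then show ?thesis
    by (simp add: deg_superset[of "keys u \<union> keys w"] lookup_add sum.distrib)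
qed

lemma deg_0 [simp]: "deg 0 = 0"
  by (simp add: deg_def)

lemma deg_single [simp]: "deg (single i c) = c"
  by (cases "c = 0") (simp_all add: deg_def)

lemma deg_sum: "deg (\<Sum>a\<in>A. f a) = (\<Sum>a\<in>A. deg (f a))"
  by (induction A rule: infinite_finite_induct) simp_all

lemma keys_plus_monom: "keys (u + w) = keys u \<union> keys w" for u w :: monom
  by (auto simp: in_keys_iff lookup_add)

definition mons :: "nat set \<Rightarrow> nat \<Rightarrow> monom set" where
  "mons A d = {u. keys u \<subseteq> A \<and> deg u = d}"

lemma lookup_le_deg: "lookup u i \<le> deg u"
proof (cases "i \<in> keys u")
  case True
  then show ?thesis using member_le_sum[of i "keys u" "lookup u"] by (simp add: deg_def)
qed (simp add: in_keys_iff)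

lemma finite_bounded_monoms:
  assumes "finite A"
  shows "finite {u :: monom. keys u \<subseteq> A \<and> (\<forall>i. lookup u i \<le> d)}" (is "finite ?U")
proof -
  have "finite {g :: nat \<Rightarrow> nat. \<forall>i. (i \<in> A \<longrightarrow> g i \<in> {0..d}) \<and> (i \<notin> A \<longrightarrow> g i = 0)}"
    using assms by (intro finite_set_of_finite_funs) auto
  moreover have "lookup ` ?U \<subseteq> {g. \<forall>i. (i \<in> A \<longrightarrow> g i \<in> {0..d}) \<and> (i \<notin> A \<longrightarrow> g i = 0)}"
    by (auto simp: subset_iff in_keys_iff)
  ultimately have "finite (lookup ` ?U)" by (rule finite_subset[rotated])
  then show ?thesis
    by (rule finite_imageD) (auto simp: inj_on_def poly_mapping.lookup_inject)
qed

lemma finite_mons: "finite A \<Longrightarrow> finite (mons A d)"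
  by (rule finite_subset[OF _ finite_bounded_monoms[of A d]]) (auto simp: mons_def lookup_le_deg)

lemma homogeneous_polys_iff: "f \<in> homogeneous_polys m \<longleftrightarrow> (\<forall>u\<in>keys f. deg u = m)"
  by (simp add: homogeneous_polys_def deg_def)

lemma homogeneous_mult:
  assumes "f \<in> homogeneous_polys a" "g \<in> homogeneous_polys b"
  shows "f * g \<in> homogeneous_polys (a + b)"
  unfolding homogeneous_polys_iff
proof
  fix u assume "u \<in> keys (f * g)"
  then obtain v w where "v \<in> keys f" "w \<in> keys g" "u = v + w"
    using Poly_Mapping.keys_mult[of f g] by blast
  then show "deg u = a + b" using assms by (auto simp: homogeneous_polys_iff)
qed

lemma polys_in_0 [simp]: "0 \<in> polys_in n"
  by (simp add: polys_in_def)

lemma polys_in_add: "f \<in> polys_in n \<Longrightarrow> g \<in> polys_in n \<Longrightarrow> f + g \<in> polys_in n"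
  using Poly_Mapping.keys_add[of f g] unfolding polys_in_def by blast

lemma polys_in_mult:
  assumes "f \<in> polys_in n" "g \<in> polys_in n"
  shows "f * g \<in> polys_in n"
  unfolding polys_in_def
proof clarify
  fix u i assume "u \<in> keys (f * g)" "i \<in> keys u"
  then obtain v w where "v \<in> keys f" "w \<in> keys g" "u = v + w"
    using Poly_Mapping.keys_mult[of f g] by blast
  then show "i \<in> {1..n}" using assms \<open>i \<in> keys u\<close> by (fastforce simp: polys_in_def keys_plus_monom)
qed

lemma polys_in_sum: "(\<And>a. a \<in> A \<Longrightarrow> f a \<in> polys_in n) \<Longrightarrow> (\<Sum>a\<in>A. f a) \<in> polys_in n"
  by (induction A rule: infinite_finite_induct) (auto intro: polys_in_add)

lemma polys_in_single: "keys u \<subseteq> {1..n} \<Longrightarrow> single u c \<in> polys_in n"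
  by (cases "c = 0") (auto simp: polys_in_def)

lemma polys_in_1 [simp]: "1 \<in> polys_in n"
  using polys_in_single[of 0 n 1] by simp

lemma polys_in_prod: "(\<And>a. a \<in> A \<Longrightarrow> f a \<in> polys_in n) \<Longrightarrow> (\<Prod>a\<in>A. f a) \<in> polys_in n"
  by (induction A rule: infinite_finite_induct) (auto intro: polys_in_mult)

section \<open>Permutations acting on monomials\<close>

definition perm_mon :: "(nat \<Rightarrow> nat) \<Rightarrow> monom \<Rightarrow> monom" where
  "perm_mon \<sigma> u = Poly_Mapping.map_key \<sigma> u"

lemma lookup_perm_mon: "\<sigma> permutes A \<Longrightarrow> lookup (perm_mon \<sigma> u) i = lookup u (\<sigma> i)"
  by (simp add: perm_mon_def map_key.rep_eq permutes_inj)

lemma perm_mon_comp: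
  "\<sigma> permutes A \<Longrightarrow> \<tau> permutes A \<Longrightarrow> perm_mon \<sigma> (perm_mon \<tau> u) = perm_mon (\<tau> \<circ> \<sigma>) u"
  by (rule poly_mapping_eqI) (simp add: lookup_perm_mon lookup_perm_mon[OF permutes_compose])

lemma perm_mon_id [simp]: "perm_mon id u = u"
  by (rule poly_mapping_eqI) (simp add: lookup_perm_mon[of id UNIV] permutes_id)

lemma keys_perm_mon:
  assumes "\<sigma> permutes A" "keys u \<subseteq> A"
  shows "keys (perm_mon \<sigma> u) \<subseteq> A"
proof
  fix i assume "i \<in> keys (perm_mon \<sigma> u)"
  then have "\<sigma> i \<in> A" using assms by (auto simp: in_keys_iff lookup_perm_mon)
  then show "i \<in> A" using permutes_in_image[OF assms(1)] by blast
qed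

lemma deg_perm_mon:
  assumes "\<sigma> permutes A" "keys u \<subseteq> A" "finite A"
  shows "deg (perm_mon \<sigma> u) = deg u"
proof -
  have "deg (perm_mon \<sigma> u) = (\<Sum>i\<in>A. lookup u (\<sigma> i))"
    using deg_superset[OF assms(3) keys_perm_mon[OF assms(1,2)]] by (simp add: lookup_perm_mon[OF assms(1)])
  also have "\<dots> = (\<Sum>i\<in>A. lookup u i)"
    using sum.permute[OF assms(1), of "lookup u"] by simp
  finally show ?thesis using deg_superset[OF assms(3,2)] by simp
qed

lemma symmetric_polys_iff:
  "f \<in> symmetric_polys n \<longleftrightarrow> f \<in> polys_in n \<and>
    (\<forall>\<sigma> u. \<sigma> permutes {1..n} \<longrightarrow> lookup f (perm_mon \<sigma> u) = lookup f u)"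
  unfolding symmetric_polys_def perm_mon_def
  by (auto simp: poly_mapping_eq_iff fun_eq_iff lookup_permute_vars[OF permutes_bij])

lemma symmetric_polysI_eval:
  assumes "f \<in> polys_in n"
    and "\<And>\<sigma> x. \<sigma> permutes {1..n} \<Longrightarrow> eval_poly (\<lambda>i. x (\<sigma> i)) f = eval_poly x f"
  shows "f \<in> symmetric_polys n"
  unfolding symmetric_polys_def using assms
  by (auto intro!: eval_poly_inject simp: eval_permute_vars[OF permutes_bij])

lemma symmetric_eval:
  assumes "f \<in> symmetric_polys n" "\<sigma> permutes {1..n}"
  shows "eval_poly (\<lambda>i. x (\<sigma> i)) f = eval_poly x f"
  using assms eval_permute_vars[OF permutes_bij[OF assms(2)], of x f] by (simp add: symmetric_polys_def)

lemma symmetric_mult: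
  assumes "f \<in> symmetric_polys n" "g \<in> symmetric_polys n"
  shows "f * g \<in> symmetric_polys n"
  using assms
  by (intro symmetric_polysI_eval polys_in_mult) (auto simp: eval_poly_mult symmetric_eval symmetric_polys_iff)

definition Symg :: "nat \<Rightarrow> nat \<Rightarrow> cpoly set" where
  "Symg n m = symmetric_polys n \<inter> homogeneous_polys m"

lemma subspace_Symg: "cpoly.subspace (Symg n m)"
  \<comment> \<open>With \<open>n\<close> in the role of \<open>k\<close> the guard
    \<open>k + 1 \<le> n\<close> is false, so the vanishing condition is void.\<close>
  using subspace_F_graded[of n 2 1 1 n m] by (simp add: F_graded_def F_space_def Symg_def)

lemma keys_Symg: "f \<in> Symg n m \<Longrightarrow> keys f \<subseteq> mons {1..n} m"
  by (auto simp: Symg_def symmetric_polys_iff polys_in_def homogeneous_polys_iff mons_def)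

section \<open>Lowest monomials and orbit sums of symmetric polynomials\<close>

definition asc :: "nat \<Rightarrow> monom \<Rightarrow> bool" where
  "asc n u \<longleftrightarrow> keys u \<subseteq> {1..n} \<and> (\<forall>i\<in>{1..<n}. lookup u i \<le> lookup u (Suc i))"

text \<open>Swapping two neighbouring exponents at a descent would give a smaller monomial with the
  same coefficient.\<close>

lemma asc_low:
  assumes f: "f \<in> symmetric_polys n" "f \<noteq> 0"
  shows "asc n (low f)"
  unfolding asc_def
proof
  have *: "low f \<in> keys f" using f low_in_keys by blast
  then show "keys (low f) \<subseteq> {1..n}" using f by (auto simp: symmetric_polys_iff polys_in_def)
  show "\<forall>i\<in>{1..<n}. lookup (low f) i \<le> lookup (low f) (Suc i)"
  proof (rule ccontr)
    assume "\<not> ?thesis"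
    then obtain i where i: "i \<in> {1..<n}" "lookup (low f) (Suc i) < lookup (low f) i" by auto
    define \<sigma> where "\<sigma> = transpose i (Suc i)"
    have \<sigma>: "\<sigma> permutes {1..n}" unfolding \<sigma>_def using i by (intro permutes_swap_id) auto
    have "perm_mon \<sigma> (low f) \<in> keys f"
      using f * \<sigma> by (auto simp: symmetric_polys_iff in_keys_iff)
    then have "low f \<le> perm_mon \<sigma> (low f)" by (rule low_le)
    moreover have "perm_mon \<sigma> (low f) < low f"
      unfolding less_poly_mapping.rep_eq less_fun_def
      by (rule exI[of _ i]) (use i(2) in \<open>auto simp: lookup_perm_mon[OF \<sigma>]\<close>, auto simp: \<sigma>_def transpose_def)
    ultimately show False by simp
  qed
qed

text \<open>A multiset of exponents has only one sorted arrangement.\<close>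

lemma asc_unique:
  assumes "asc n u" "asc n (perm_mon \<sigma> u)" and \<sigma>: "\<sigma> permutes {1..n}"
  shows "perm_mon \<sigma> u = u"
proof -
  define L where "L w = map (lookup w) [1..<Suc n]" for w :: monom
  have s: "sorted (L w)" if "asc n w" for w
    unfolding sorted_iff_nth_Suc L_def using that by (auto simp: asc_def simp del: upt_Suc)
  have "lookup (perm_mon \<sigma> u) = lookup u \<circ> \<sigma>"
    using lookup_perm_mon[OF \<sigma>] by auto
  then have "mset (L (perm_mon \<sigma> u)) = image_mset (lookup u) (image_mset \<sigma> (mset_set {1..n}))"
    by (simp add: L_def mset_upt atLeastLessThanSuc_atLeastAtMost multiset.map_comp del: upt_Suc)
  also have "\<dots> = mset (L u)"
    unfolding permutes_image_mset[OF \<sigma>] by (simp add: L_def mset_upt atLeastLessThanSuc_atLeastAtMost del: upt_Suc)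
  finally have "L (perm_mon \<sigma> u) = L u"
    using s[OF assms(1)] s[OF assms(2)] by (metis properties_for_sort)
  then have eq: "lookup (perm_mon \<sigma> u) i = lookup u i" if "i \<in> {1..n}" for i
    using that unfolding L_def by (auto simp: map_eq_conv simp del: upt_Suc)
  show ?thesis
  proof (rule poly_mapping_eqI)
    fix i
    show "lookup (perm_mon \<sigma> u) i = lookup u i"
    proof (cases "i \<in> {1..n}")
      case False
      then have "i \<notin> keys u" "i \<notin> keys (perm_mon \<sigma> u)" using assms(1,2) by (auto simp: asc_def)
      then show ?thesis by (simp add: in_keys_iff)
    qed (rule eq)
  qed
qed

definition orbit :: "nat \<Rightarrow> monom \<Rightarrow> monom set" where
  "orbit n u = (\<lambda>\<sigma>. perm_mon \<sigma> u) ` {\<sigma>. \<sigma> permutes {1..n}}"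

text \<open>The monomial symmetric function. Summing over the orbit as a set, not over permutations,
  keeps every coefficient equal to 1.\<close>

definition msym :: "nat \<Rightarrow> monom \<Rightarrow> cpoly" where
  "msym n u = (\<Sum>w\<in>orbit n u. single w 1)"

lemma finite_orbit: "finite (orbit n u)"
  by (simp add: orbit_def finite_permutations)

lemma lookup_msym: "lookup (msym n u) w = (if w \<in> orbit n u then 1 else 0)"
  by (simp add: msym_def lookup_sum lookup_single when_def finite_orbit)

lemma keys_msym: "keys (msym n u) = orbit n u"
  by (auto simp: in_keys_iff lookup_msym split: if_splits)

lemma perm_orbit: "\<sigma> permutes {1..n} \<Longrightarrow> w \<in> orbit n u \<Longrightarrow> perm_mon \<sigma> w \<in> orbit n u"
  unfolding orbit_def by (auto simp: perm_mon_comp permutes_compose)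

lemma self_in_orbit: "u \<in> orbit n u"
  unfolding orbit_def by (rule image_eqI[of _ _ id]) (simp_all add: permutes_id)

lemma msym_in_Symg:
  assumes "keys u \<subseteq> {1..n}"
  shows "msym n u \<in> Symg n (deg u)"
  unfolding Symg_def symmetric_polys_iff Int_iff
proof (intro conjI allI impI)
  show "msym n u \<in> polys_in n" using keys_perm_mon[OF _ assms]
    by (auto simp: polys_in_def keys_msym orbit_def)
  show "msym n u \<in> homogeneous_polys (deg u)" using deg_perm_mon[OF _ assms]
    by (auto simp: homogeneous_polys_iff keys_msym orbit_def)
  fix \<sigma> w assume \<sigma>: "\<sigma> permutes {1..n}"
  have "w \<in> orbit n u" if "perm_mon \<sigma> w \<in> orbit n u"
  proof -
    have "perm_mon (inv \<sigma>) (perm_mon \<sigma> w) = w"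
      using perm_mon_comp[OF permutes_inv[OF \<sigma>] \<sigma>, of w] permutes_inv_o(1)[OF \<sigma>] by simp
    then show ?thesis using perm_orbit[OF permutes_inv[OF \<sigma>] that] by simp
  qed
  then show "lookup (msym n u) (perm_mon \<sigma> w) = lookup (msym n u) w"
    using perm_orbit[OF \<sigma>] by (auto simp: lookup_msym)
qed

lemma msym_ne_0 [simp]: "msym n u \<noteq> 0"
  using self_in_orbit[of u n] by (metis lookup_msym lookup_zero zero_neq_one)

lemma low_msym:
  assumes "asc n u"
  shows "low (msym n u) = u"
proof -
  have "msym n u \<in> symmetric_polys n" using msym_in_Symg assms by (auto simp: Symg_def asc_def)
  then have a: "asc n (low (msym n u))" by (rule asc_low) simp
  have "low (msym n u) \<in> orbit n u" using low_in_keys[OF msym_ne_0] by (simp add: keys_msym)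
  then show ?thesis using asc_unique[OF assms] a by (auto simp: orbit_def)
qed

section \<open>The substitution raising every variable to a power\<close>

definition pw :: "nat \<Rightarrow> monom \<Rightarrow> monom" where
  "pw p u = Poly_Mapping.map ((*) p) u"

lemma lookup_pw [simp]: "lookup (pw p u) i = p * lookup u i"
  by (simp add: pw_def Poly_Mapping.map.rep_eq when_def)

lemma keys_pw: "keys (pw p u) \<subseteq> keys u"
  by (auto simp: in_keys_iff)

lemma pw_inj: "p > 0 \<Longrightarrow> pw p u = pw p w \<longleftrightarrow> u = w"
  by (auto simp: poly_mapping_eq_iff fun_eq_iff)

lemma pw_mono: "p > 0 \<Longrightarrow> u \<le> w \<Longrightarrow> pw p u \<le> pw p w"
  by (auto simp: order_le_less less_poly_mapping.rep_eq less_fun_def)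

lemma deg_pw: "deg (pw p u) = p * deg u"
  using deg_superset[OF finite_keys keys_pw[of p u]] by (simp add: deg_def sum_distrib_left)

lemma eval_mon_pw: "eval_mon x (pw p u) = eval_mon (\<lambda>i. x i ^ p) u"
  using eval_mon_superset[OF finite_keys keys_pw[of p u]] by (simp add: eval_mon_def power_mult)

definition subst_pow :: "nat \<Rightarrow> cpoly \<Rightarrow> cpoly" where
  "subst_pow p f = (\<Sum>u\<in>keys f. single (pw p u) (lookup f u))"

lemma eval_subst_pow: "eval_poly x (subst_pow p f) = eval_poly (\<lambda>i. x i ^ p) f"
  by (simp add: subst_pow_def eval_poly_sum eval_mon_pw eval_poly_eq[of _ f])

lemma subst_pow_add: "subst_pow p (f + g) = subst_pow p f + subst_pow p g"
  by (rule eval_poly_inject) (simp add: eval_subst_pow eval_poly_add)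

lemma subst_pow_scale: "subst_pow p (scale_poly c f) = scale_poly c (subst_pow p f)"
  by (rule eval_poly_inject) (simp add: eval_subst_pow eval_poly_scale)

lemma subst_pow_0 [simp]: "subst_pow p 0 = 0"
  by (simp add: subst_pow_def)

lemma subst_pow_sum: "subst_pow p (\<Sum>a\<in>A. f a) = (\<Sum>a\<in>A. subst_pow p (f a))"
  by (induction A rule: infinite_finite_induct) (simp_all add: subst_pow_add)

lemma lookup_subst_pow: "p > 0 \<Longrightarrow> lookup (subst_pow p f) (pw p u) = lookup f u"
  by (simp add: subst_pow_def lookup_sum lookup_single when_def pw_inj in_keys_iff)

lemma keys_subst_pow: "keys (subst_pow p f) \<subseteq> pw p ` keys f"
  using Poly_Mapping.keys_sum[of "\<lambda>u. single (pw p u) (lookup f u)" "keys f"]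
  by (auto simp: subst_pow_def split: if_splits)

lemma subst_pow_eq_0_iff: "p > 0 \<Longrightarrow> subst_pow p f = 0 \<longleftrightarrow> f = 0"
  by (metis lookup_subst_pow lookup_zero poly_mapping_eqI subst_pow_0)

lemma low_subst_pow:
  assumes "p > 0" "f \<noteq> 0"
  shows "low (subst_pow p f) = pw p (low f)"
proof (rule low_eqI)
  show "lookup (subst_pow p f) (pw p (low f)) \<noteq> 0"
    using assms lookup_low by (simp add: lookup_subst_pow)
  fix w assume "w \<in> keys (subst_pow p f)"
  then obtain u where "u \<in> keys f" "w = pw p u" using keys_subst_pow[of p f] by blast
  then show "pw p (low f) \<le> w" using assms low_le pw_mono by blast
qed

lemma polys_in_subst_pow: "f \<in> polys_in n \<Longrightarrow> subst_pow p f \<in> polys_in n"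
  using keys_subst_pow[of p f] keys_pw[of p] unfolding polys_in_def by blast

lemma symmetric_subst_pow: "f \<in> symmetric_polys n \<Longrightarrow> subst_pow p f \<in> symmetric_polys n"
  by (intro symmetric_polysI_eval)
    (auto simp: eval_subst_pow polys_in_subst_pow symmetric_eval[where x = "\<lambda>i. _ i ^ p"] symmetric_polys_iff[of f])

lemma homogeneous_subst_pow: "f \<in> homogeneous_polys m \<Longrightarrow> subst_pow p f \<in> homogeneous_polys (p * m)"
  using keys_subst_pow[of p f] by (auto simp: homogeneous_polys_iff deg_pw)

section \<open>Freeness over the power subring\<close>

text \<open>The lowest monomial of a symmetric polynomial has nondecreasing exponents. It is encoded by its
  differences: \<open>c s\<close> is the jump before the last \<open>s\<close> variables, and \<open>c n\<close> is the smallest exponent.\<close>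

definition rho :: "nat \<Rightarrow> (nat \<Rightarrow> nat) \<Rightarrow> monom" where
  "rho n c = (\<Sum>s\<in>{1..n}. \<Sum>i\<in>{Suc n - s..n}. single i (c s))"

definition wt :: "nat \<Rightarrow> (nat \<Rightarrow> nat) \<Rightarrow> nat" where
  "wt n c = (\<Sum>s\<in>{1..n}. s * c s)"

lemma deg_rho: "deg (rho n c) = wt n c"
  unfolding rho_def wt_def deg_sum by (intro sum.cong) auto

lemma lookup_rho: "lookup (rho n c) i = (\<Sum>s\<in>{1..n}. if i \<in> {Suc n - s..n} then c s else 0)"
  by (simp add: rho_def lookup_sum lookup_single when_def)

lemma keys_rho: "keys (rho n c) \<subseteq> {1..n}"
proof
  fix i assume "i \<in> keys (rho n c)"
  then have "(\<Sum>s\<in>{1..n}. if i \<in> {Suc n - s..n} then c s else 0) \<noteq> 0"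
    by (simp only: in_keys_iff lookup_rho not_False_eq_True)
  then obtain s where "s \<in> {1..n}" "(if i \<in> {Suc n - s..n} then c s else 0) \<noteq> 0"
    by (elim sum.not_neutral_contains_not_neutral)
  then show "i \<in> {1..n}" by (auto split: if_splits)
qed

text \<open>The block of the last \<open>s\<close> variables starts at \<open>Suc n - s\<close>, so
  the step from \<open>i\<close> to \<open>Suc i\<close> enters only the block with
  \<open>s = n - i\<close>.\<close>

lemma lookup_rho_Suc:
  assumes "i < n"
  shows "lookup (rho n c) (Suc i) = lookup (rho n c) i + c (n - i)"
proof -
  have "lookup (rho n c) (Suc i) =
    (\<Sum>s\<in>{1..n}. (if i \<in> {Suc n - s..n} then c s else 0) + (if s = n - i then c s else 0))"
    unfolding lookup_rho using assms by (intro sum.cong) auto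
  also have "\<dots> = lookup (rho n c) i + (\<Sum>s\<in>{1..n}. if s = n - i then c s else 0)"
    by (simp add: sum.distrib lookup_rho)
  also have "(\<Sum>s\<in>{1..n}. if s = n - i then c s else 0) = c (n - i)"
    using assms by (subst sum.delta) auto
  finally show ?thesis .
qed

lemma asc_rho: "asc n (rho n c)"
  unfolding asc_def using keys_rho lookup_rho_Suc[of _ n c] by auto

lemma rho_inject:
  assumes "rho n c = rho n c'" "s \<in> {1..n}"
  shows "c s = c' s"
proof -
  have "lookup (rho n c) (Suc (n - s)) = lookup (rho n c) (n - s) + c s"
       "lookup (rho n c') (Suc (n - s)) = lookup (rho n c') (n - s) + c' s"
    using lookup_rho_Suc[of "n - s" n] assms(2) by auto
  then show ?thesis using assms(1) by simp
qed

text \<open>For \<open>s = n\<close> the subtracted exponent sits at index 0 and is 0, so the same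
  formula also yields the smallest exponent.\<close>

lemma asc_eq_rho:
  assumes "asc n u"
  shows "u = rho n (\<lambda>s. lookup u (Suc n - s) - lookup u (n - s))" (is "u = rho n ?c")
proof (rule poly_mapping_eqI)
  have out: "lookup w i = 0" if "keys w \<subseteq> {1..n}" "i \<notin> {1..n}" for w :: monom and i
    using that by (auto simp: in_keys_iff subset_iff)
  have ku: "keys u \<subseteq> {1..n}" using assms by (simp add: asc_def)
  have *: "lookup (rho n ?c) i = lookup u i" if "i \<le> n" for i
    using that
  proof (induction i)
    case 0
    show ?case using out[OF ku, of 0] out[OF keys_rho, of 0] by simp
  next
    case (Suc i)
    have "lookup u i \<le> lookup u (Suc i)"
    proof (cases "i = 0")
      case True
      then show ?thesis using out[OF ku, of 0] by simp
    next
      case False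
      then show ?thesis using assms Suc.prems by (auto simp: asc_def)
    qed
    moreover have "n - (n - i) = i" "Suc n - (n - i) = Suc i" using Suc.prems by auto
    ultimately show ?case using Suc lookup_rho_Suc[of i n ?c] by simp
  qed
  fix i
  show "lookup u i = lookup (rho n ?c) i"
    using * out[OF ku, of i] out[OF keys_rho, of i] by (cases "i \<le> n") auto
qed

text \<open>Turns division of the differences by \<open>p\<close> with remainder into a splitting of
  a lowest monomial into a reduced part and a \<open>p\<close>-th power.\<close>

lemma rho_add: "rho n (\<lambda>s. a s + p * b s) = rho n a + pw p (rho n b)"
proof (rule poly_mapping_eqI)
  fix i
  show "lookup (rho n (\<lambda>s. a s + p * b s)) i = lookup (rho n a + pw p (rho n b)) i"
    unfolding lookup_add lookup_pw lookup_rho sum_distrib_left sum.distrib[symmetric]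
    by (rule sum.cong) auto
qed

lemma rho_cong: "(\<And>s. s \<in> {1..n} \<Longrightarrow> a s = b s) \<Longrightarrow> rho n a = rho n b"
  by (simp add: rho_def)

text \<open>Extensional functions, so that a tuple is determined by its entries on
  \<open>{1..n}\<close> and the set has \<open>p ^ n\<close> elements.\<close>

definition digits :: "nat \<Rightarrow> nat \<Rightarrow> (nat \<Rightarrow> nat) set" where
  "digits n p = {1..n} \<rightarrow>\<^sub>E {0..<p}"

lemma finite_digits: "finite (digits n p)"
  by (simp add: digits_def finite_PiE)

lemma card_digits: "card (digits n p) = p ^ n"
  by (simp add: digits_def card_PiE)

definition basis_poly :: "nat \<Rightarrow> (nat \<Rightarrow> nat) \<Rightarrow> cpoly" where
  "basis_poly n a = msym n (rho n a)"

lemma basis_poly_in_Symg: "basis_poly n a \<in> Symg n (wt n a)"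
  unfolding basis_poly_def using msym_in_Symg[OF keys_rho] by (simp add: deg_rho)

lemma basis_poly_symmetric: "basis_poly n a \<in> symmetric_polys n"
  using basis_poly_in_Symg by (simp add: Symg_def)

lemma low_basis_poly [simp]: "low (basis_poly n a) = rho n a"
  by (simp add: basis_poly_def low_msym asc_rho)

lemma basis_poly_ne_0 [simp]: "basis_poly n a \<noteq> 0"
  by (simp add: basis_poly_def)

lemma low_product:
  assumes "p > 0" "g \<noteq> 0"
  shows "low (basis_poly n a * subst_pow p g) = rho n a + pw p (low g)"
  using assms by (simp add: low_mult subst_pow_eq_0_iff low_subst_pow)

text \<open>The lowest monomial of the summand for \<open>a\<close> has differences
  \<open>a s + p * c s\<close>, and reduction modulo \<open>p\<close> recovers \<open>a\<close>.
  Nonzero summands therefore have distinct lowest monomials.\<close>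

lemma freeness:
  assumes p: "p > 0" and G: "\<And>a. a \<in> digits n p \<Longrightarrow> G a \<in> symmetric_polys n"
    and 0: "(\<Sum>a\<in>digits n p. basis_poly n a * subst_pow p (G a)) = 0"
    and a: "a \<in> digits n p"
  shows "G a = 0"
proof (rule ccontr)
  assume "G a \<noteq> 0"
  define D where "D = {a\<in>digits n p. G a \<noteq> 0}"
  have "(\<Sum>a\<in>D. basis_poly n a * subst_pow p (G a)) \<noteq> 0"
  proof (rule sum_distinct_low_ne_0)
    show "finite D" "D \<noteq> {}" using finite_digits a \<open>G a \<noteq> 0\<close> by (auto simp: D_def)
    show "basis_poly n a * subst_pow p (G a) \<noteq> 0" if "a \<in> D" for a
      using that p by (simp add: D_def subst_pow_eq_0_iff)
    show "inj_on (\<lambda>a. low (basis_poly n a * subst_pow p (G a))) D"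
    proof (rule inj_onI)
      fix a b assume ab: "a \<in> D" "b \<in> D"
        "low (basis_poly n a * subst_pow p (G a)) = low (basis_poly n b * subst_pow p (G b))"
      have "\<exists>c. low (G a) = rho n c" if "a \<in> D" for a
        using that asc_eq_rho[OF asc_low[OF G]] by (auto simp: D_def)
      then obtain c d where cd: "low (G a) = rho n c" "low (G b) = rho n d"
        using ab by blast
      have "rho n (\<lambda>s. a s + p * c s) = rho n (\<lambda>s. b s + p * d s)"
        using ab cd p by (simp add: D_def low_product rho_add)
      then have *: "a s + p * c s = b s + p * d s" if "s \<in> {1..n}" for s
        using rho_inject that by blast
      have ab': "a \<in> digits n p" "b \<in> digits n p" using ab by (auto simp: D_def)
      show "a = b"
      proof (rule PiE_ext)
        show "a \<in> {1..n} \<rightarrow>\<^sub>E {0..<p}" "b \<in> {1..n} \<rightarrow>\<^sub>E {0..<p}" using ab' by (auto simp: digits_def)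
        fix s assume s: "s \<in> {1..n}"
        then have "a s < p" "b s < p" using ab' by (auto simp: digits_def PiE_iff)
        then show "a s = b s" using arg_cong[OF *[OF s], of "\<lambda>x. x mod p"] by simp
      qed
    qed
  qed
  also have "(\<Sum>a\<in>D. basis_poly n a * subst_pow p (G a)) =
      (\<Sum>a\<in>digits n p. basis_poly n a * subst_pow p (G a))"
    using finite_digits by (intro sum.mono_neutral_left) (auto simp: D_def)
  finally show False using 0 by simp
qed

text \<open>The products in \<open>B\<close> realise every lowest monomial that a symmetric
  polynomial can have, since its differences can be divided by \<open>p\<close> with
  remainder.\<close>

lemma decomposition:
  assumes p: "p > 0" and f: "f \<in> Symg n m"
  obtains G where
    "\<And>a. a \<in> digits n p \<Longrightarrow> wt n a \<le> m \<Longrightarrow> p dvd m - wt n a \<Longrightarrow> G a \<in> Symg n ((m - wt n a) div p)"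
    "\<And>a. a \<in> digits n p \<Longrightarrow> \<not> (wt n a \<le> m \<and> p dvd m - wt n a) \<Longrightarrow> G a = 0"
    "f = (\<Sum>a\<in>digits n p. basis_poly n a * subst_pow p (G a))"
proof -
  \<comment> \<open>Where the degrees cannot match, truncated subtraction and rounding division
    would admit spurious coefficients; there only zero is allowed.\<close>
  define R where "R a = (if wt n a \<le> m \<and> p dvd m - wt n a then Symg n ((m - wt n a) div p) else {0})" for a
  have subR: "cpoly.subspace (R a)" for a
    by (simp add: R_def subspace_Symg cpoly.subspace_single_0)
  define V where "V = {\<Sum>a\<in>digits n p. basis_poly n a * subst_pow p (G a) |G. \<forall>a. G a \<in> R a}"
  have subV: "cpoly.subspace V"
    unfolding cpoly.subspace_def
  proof (intro conjI ballI allI)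
    have "\<forall>a. 0 \<in> R a" "0 = (\<Sum>a\<in>digits n p. basis_poly n a * subst_pow p 0)"
      using subR[THEN cpoly.subspace_0] by simp_all
    then show "0 \<in> V" unfolding V_def by (intro CollectI exI[of _ "\<lambda>_. 0"] conjI)
  next
    fix x y assume "x \<in> V" "y \<in> V"
    then obtain G H where "\<forall>a. G a \<in> R a" "x = (\<Sum>a\<in>digits n p. basis_poly n a * subst_pow p (G a))"
      "\<forall>a. H a \<in> R a" "y = (\<Sum>a\<in>digits n p. basis_poly n a * subst_pow p (H a))"
      by (auto simp: V_def)
    then have "\<forall>a. G a + H a \<in> R a"
      "x + y = (\<Sum>a\<in>digits n p. basis_poly n a * subst_pow p (G a + H a))"
      using subR[THEN cpoly.subspace_add] by (simp_all add: subst_pow_add sum.distrib distrib_left)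
    then show "x + y \<in> V" unfolding V_def by (intro CollectI exI[of _ "\<lambda>a. G a + H a"] conjI)
  next
    fix c x assume "x \<in> V"
    then obtain G where "\<forall>a. G a \<in> R a" "x = (\<Sum>a\<in>digits n p. basis_poly n a * subst_pow p (G a))"
      by (auto simp: V_def)
    then have "\<forall>a. scale_poly c (G a) \<in> R a"
      "scale_poly c x = (\<Sum>a\<in>digits n p. basis_poly n a * subst_pow p (scale_poly c (G a)))"
      using subR[THEN cpoly.subspace_scale]
      by (simp_all add: subst_pow_scale mult_scale_poly cpoly.scale_sum_right)
    then show "scale_poly c x \<in> V" unfolding V_def
      by (intro CollectI exI[of _ "\<lambda>a. scale_poly c (G a)"] conjI)
  qed
  define B where "B = {basis_poly n a * subst_pow p (basis_poly n b) |a b. a \<in> digits n p \<and> wt n a + p * wt n b = m}"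
  have BV: "B \<subseteq> V"
  proof
    fix x assume "x \<in> B"
    then obtain a b where ab: "a \<in> digits n p" "wt n a + p * wt n b = m"
      "x = basis_poly n a * subst_pow p (basis_poly n b)" by (auto simp: B_def)
    have "(m - wt n a) div p = wt n b" using ab(2) p by auto
    then have "basis_poly n b \<in> R a" using basis_poly_in_Symg[of n b] ab(2) by (auto simp: R_def)
    moreover have "x = (\<Sum>a'\<in>digits n p. basis_poly n a' * subst_pow p (if a' = a then basis_poly n b else 0))"
      using ab finite_digits by (simp add: if_distrib[of "subst_pow p"] if_distrib[of "(*) _"] cong: if_cong)
    moreover have "\<forall>a'. (if a' = a then basis_poly n b else 0) \<in> R a'"
      using calculation(1) subR[THEN cpoly.subspace_0] by simp
    ultimately show "x \<in> V" unfolding V_def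
      by (intro CollectI exI[of _ "\<lambda>a'. if a' = a then basis_poly n b else 0"] conjI)
  qed
  have "Symg n m \<subseteq> cpoly.span B"
  proof (rule span_by_low)
    show "finite (mons {1..n} m)" by (simp add: finite_mons)
    show "cpoly.subspace (Symg n m)" by (rule subspace_Symg)
    show "keys f \<subseteq> mons {1..n} m" if "f \<in> Symg n m" for f by (rule keys_Symg[OF that])
    show "B \<subseteq> Symg n m"
    proof
      fix x assume "x \<in> B"
      then obtain a b where ab: "wt n a + p * wt n b = m"
        "x = basis_poly n a * subst_pow p (basis_poly n b)" by (auto simp: B_def)
      then show "x \<in> Symg n m"
        using basis_poly_in_Symg[of n a] basis_poly_in_Symg[of n b]
          homogeneous_mult[of "basis_poly n a" "wt n a" "subst_pow p (basis_poly n b)" "p * wt n b"]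
        by (auto simp: Symg_def intro!: symmetric_mult symmetric_subst_pow homogeneous_subst_pow)
    qed
    fix f assume f: "f \<in> Symg n m" "f \<noteq> 0"
    then have "asc n (low f)" by (intro asc_low) (auto simp: Symg_def)
    then obtain c where c: "low f = rho n c" using asc_eq_rho by blast
    define a where "a = restrict (\<lambda>s. c s mod p) {1..n}"
    define b where "b = (\<lambda>s. c s div p)"
    have a: "a \<in> digits n p" using p by (auto simp: a_def digits_def)
    have eq: "rho n c = rho n a + pw p (rho n b)"
      unfolding rho_add[symmetric] by (rule rho_cong) (auto simp: a_def b_def)
    have "low f \<in> mons {1..n} m" using keys_Symg[OF f(1)] low_in_keys[OF f(2)] by blast
    then have "deg (rho n a + pw p (rho n b)) = m" using c eq by (simp add: mons_def)
    then have "wt n a + p * wt n b = m" by (simp add: deg_rho deg_pw)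
    then have "basis_poly n a * subst_pow p (basis_poly n b) \<in> B" using a by (auto simp: B_def)
    moreover have "low (basis_poly n a * subst_pow p (basis_poly n b)) = low f"
      using p by (simp add: low_product c eq)
    moreover have "basis_poly n a * subst_pow p (basis_poly n b) \<noteq> 0"
      using p by (simp add: subst_pow_eq_0_iff)
    ultimately show "\<exists>b\<in>B. b \<noteq> 0 \<and> low b = low f" by blast
  qed
  also have "cpoly.span B \<subseteq> V" by (rule cpoly.span_minimal[OF BV subV])
  finally obtain G where "\<forall>a. G a \<in> R a" "f = (\<Sum>a\<in>digits n p. basis_poly n a * subst_pow p (G a))"
    using f by (auto simp: V_def)
  note G = this
  show ?thesis
  proof (rule that[of G])
    fix a
    show "G a \<in> Symg n ((m - wt n a) div p)" if "wt n a \<le> m" "p dvd m - wt n a"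
      using G(1)[rule_format, of a] that by (simp add: R_def)
    show "G a = 0" if "\<not> (wt n a \<le> m \<and> p dvd m - wt n a)"
      using G(1)[rule_format, of a] that by (simp only: R_def if_False singleton_iff)
  qed (rule G(2))
qed

section \<open>Reduction to the wheel condition in the powers of the variables\<close>

definition wheel :: "nat \<Rightarrow> complex \<Rightarrow> (nat \<Rightarrow> complex) \<Rightarrow> bool" where
  "wheel k \<tau> x \<longleftrightarrow> (\<forall>i\<in>{2..k + 1}. x i = \<tau> ^ (i - 1) * x 1)"

definition Wheel :: "nat \<Rightarrow> complex \<Rightarrow> nat \<Rightarrow> cpoly set" where
  "Wheel k \<tau> n = {f \<in> symmetric_polys n. k + 1 \<le> n \<longrightarrow> (\<forall>x. wheel k \<tau> x \<longrightarrow> eval_poly x f = 0)}"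

section \<open>Roots of unity\<close>

lemma primitive_power_eq_1_iff:
  assumes "primitive_root_of_unity N w"
  shows "w ^ j = 1 \<longleftrightarrow> N dvd j"
proof -
  have N: "N > 0" "w ^ N = 1" using assms by (auto simp: primitive_root_of_unity_def)
  have "w ^ j = w ^ (N * (j div N) + j mod N)" by simp
  also have "\<dots> = w ^ (j mod N)" using N by (simp only: power_add power_mult power_one mult_1)
  finally have *: "w ^ j = w ^ (j mod N)" .
  show ?thesis
  proof
    assume "w ^ j = 1"
    then have "\<not> (0 < j mod N \<and> j mod N < N)" using assms * by (auto simp: primitive_root_of_unity_def)
    then show "N dvd j" using N by auto
  next
    assume "N dvd j"
    then show "w ^ j = 1" using * by (simp add: mod_eq_0_iff_dvd)
  qed
qed

lemma primitive_inj_on: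
  assumes "primitive_root_of_unity N w"
  shows "inj_on (\<lambda>j. w ^ j) {..<N}"
proof (rule linorder_inj_onI')
  fix i j assume ij: "i \<in> {..<N}" "j \<in> {..<N}" "i < j"
  have "w \<noteq> 0" using assms by (auto simp: primitive_root_of_unity_def zero_power)
  show "w ^ i \<noteq> w ^ j"
  proof
    assume "w ^ i = w ^ j"
    moreover have "w ^ j = w ^ i * w ^ (j - i)" using ij by (simp flip: power_add)
    ultimately have "w ^ (j - i) = 1" using \<open>w \<noteq> 0\<close> by simp
    then have "N dvd j - i" using primitive_power_eq_1_iff[OF assms] by simp
    then show False using ij by (auto dest: dvd_imp_le)
  qed
qed

text \<open>The \<open>p\<close> distinct powers of \<open>w\<close> already exhaust the
  \<open>p\<close> solutions.\<close>

lemma primitive_root_generates: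
  assumes "primitive_root_of_unity p w" "z ^ p = 1"
  obtains j where "j < p" "z = w ^ j"
proof -
  have p: "p > 0" "w ^ p = 1" using assms by (auto simp: primitive_root_of_unity_def)
  have "(\<lambda>j. w ^ j) ` {..<p} = {z. z ^ p = 1}"
  proof (rule card_subset_eq)
    show "finite {z::complex. z ^ p = 1}" using finite_nth_roots[OF p(1)] .
    show "(\<lambda>j. w ^ j) ` {..<p} \<subseteq> {z. z ^ p = 1}"
      by (auto simp flip: power_mult simp: primitive_power_eq_1_iff[OF assms(1)])
    show "card ((\<lambda>j. w ^ j) ` {..<p}) = card {z::complex. z ^ p = 1}"
      using card_image[OF primitive_inj_on[OF assms(1)]] card_roots_unity_eq[OF p(1)] by simp
  qed
  then have "z \<in> (\<lambda>j. w ^ j) ` {..<p}" using assms(2) by auto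
  then show ?thesis using that by auto
qed

lemma primitive_root_power_coprime:
  assumes "primitive_root_of_unity N w" "coprime N p"
  shows "primitive_root_of_unity N (w ^ p)"
proof -
  have "\<not> N dvd p * j" if "0 < j" "j < N" for j
    using assms(2) that by (auto simp: coprime_dvd_mult_right_iff dest: dvd_imp_le)
  then show ?thesis using assms(1)
    unfolding primitive_root_of_unity_def power_mult[symmetric]
    by (auto simp: primitive_power_eq_1_iff[OF assms(1)])
qed

lemma norm_primitive_root:
  assumes "primitive_root_of_unity N w"
  shows "norm w = 1"
proof -
  have "w ^ N = 1" "N \<noteq> 0" using assms by (auto simp: primitive_root_of_unity_def)
  then show ?thesis using power_eq_1_iff by blast
qed

text \<open>The vectors \<open>N\<close> are the columns of a right inverse of the square matrix
  \<open>M\<close>. If \<open>c b\<close> were nonzero, column \<open>b\<close> of \<open>M\<close>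
  would depend on the others, and fewer than \<open>card J\<close> columns would span
  \<open>card J\<close> independent vectors.\<close>

lemma right_inverse_imp_injective:
  fixes M :: "'j \<Rightarrow> 'i \<Rightarrow> complex"
  assumes fin: "finite I" "finite J" "card I = card J"
    and N: "\<And>\<eta>. \<eta> \<in> J \<Longrightarrow> \<exists>N. \<forall>\<xi>\<in>J. (\<Sum>a\<in>I. M \<xi> a * N a) = (if \<xi> = \<eta> then 1 else 0)"
    and c: "\<And>\<xi>. \<xi> \<in> J \<Longrightarrow> (\<Sum>a\<in>I. M \<xi> a * c a) = 0" and b: "b \<in> I"
  shows "c b = 0"
proof (rule ccontr)
  assume cb: "c b \<noteq> 0"
  obtain h :: "'j \<Rightarrow> nat" where h: "inj_on h J"
    using finite_imp_inj_to_nat_seg[OF fin(2)] by blast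
  \<comment> \<open>The polynomials themselves serve as the ambient vector space: the standard basis
    vectors are powers of the variable with index 0, with distinct exponents.\<close>
  define g :: "'j \<Rightarrow> monom" where "g \<xi> = single 0 (h \<xi>)" for \<xi>
  have g: "inj_on g J" using h
    by (auto simp: g_def inj_on_def dest: injD[OF inj_single])
  define e :: "'j \<Rightarrow> cpoly" where "e \<xi> = single (g \<xi>) 1" for \<xi>
  define w where "w a = (\<Sum>\<xi>\<in>J. scale_poly (M \<xi> a) (e \<xi>))" for a
  have *: "\<forall>\<xi>\<in>J. d \<xi> = 0" if "(\<Sum>\<xi>\<in>J. scale_poly (d \<xi>) (e \<xi>)) = 0" for d
    using distinct_low_coeffs_0[of J e d] that fin g by (simp add: e_def)
  have ind: "cpoly.independent (e ` J)" "inj_on e J"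
    using independent_family[OF fin(2), of e] * by blast+
  have comb: "(\<Sum>a\<in>I. scale_poly (d a) (w a)) = (\<Sum>\<xi>\<in>J. scale_poly (\<Sum>a\<in>I. M \<xi> a * d a) (e \<xi>))" for d
  proof -
    have "(\<Sum>a\<in>I. scale_poly (d a) (w a)) = (\<Sum>a\<in>I. \<Sum>\<xi>\<in>J. scale_poly (M \<xi> a * d a) (e \<xi>))"
      by (simp add: w_def cpoly.scale_sum_right mult.commute)
    also have "\<dots> = (\<Sum>\<xi>\<in>J. scale_poly (\<Sum>a\<in>I. M \<xi> a * d a) (e \<xi>))"
      by (subst sum.swap) (simp add: cpoly.scale_sum_left)
    finally show ?thesis .
  qed
  have "e ` J \<subseteq> cpoly.span (w ` (I - {b}))"
  proof clarify
    fix \<eta> assume \<eta>: "\<eta> \<in> J"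
    obtain N where N: "\<forall>\<xi>\<in>J. (\<Sum>a\<in>I. M \<xi> a * N a) = (if \<xi> = \<eta> then 1 else 0)" using N[OF \<eta>] by blast
    \<comment> \<open>Adding a multiple of the kernel vector \<open>c\<close> changes no product
      with \<open>M\<close> and makes the entry at \<open>b\<close> zero.\<close>
    define d where "d a = N a - N b / c b * c a" for a
    have "(\<Sum>a\<in>I. M \<xi> a * d a) = (if \<xi> = \<eta> then 1 else 0)" if "\<xi> \<in> J" for \<xi>
    proof -
      have "(\<Sum>a\<in>I. M \<xi> a * d a) = (\<Sum>a\<in>I. M \<xi> a * N a) - N b / c b * (\<Sum>a\<in>I. M \<xi> a * c a)"
        by (simp add: d_def right_diff_distrib sum_subtractf sum_distrib_left mult_ac)
      then show ?thesis using N c that by simp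
    qed
    then have "(\<Sum>a\<in>I. scale_poly (d a) (w a)) = (\<Sum>\<xi>\<in>J. if \<xi> = \<eta> then e \<xi> else 0)"
      unfolding comb by (intro sum.cong) auto
    also have "\<dots> = e \<eta>" using fin \<eta> by simp
    also have "(\<Sum>a\<in>I. scale_poly (d a) (w a)) = (\<Sum>a\<in>I-{b}. scale_poly (d a) (w a))"
      using fin b cb by (subst sum.remove[of I b]) (auto simp: d_def)
    finally have "e \<eta> = (\<Sum>a\<in>I-{b}. scale_poly (d a) (w a))" by simp
    also have "\<dots> \<in> cpoly.span (w ` (I - {b}))"
      by (intro cpoly.span_sum cpoly.span_scale cpoly.span_base) auto
    finally show "e \<eta> \<in> cpoly.span (w ` (I - {b}))" .
  qed
  then have "card (e ` J) \<le> card (w ` (I - {b}))"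
    using cpoly.independent_span_bound[OF _ ind(1)] fin by simp
  also have "\<dots> \<le> card (I - {b})" using fin by (intro card_image_le) auto
  also have "\<dots> < card I" using fin b by (intro psubset_card_mono) auto
  finally show False using card_image[OF ind(2)] fin by simp
qed

text \<open>The ungraded form, for interpolating polynomials, which need not be homogeneous. It
  follows by splitting \<open>f\<close> into its homogeneous components.\<close>

lemma decomposition_symmetric:
  assumes p: "p > 0" and f: "f \<in> symmetric_polys n"
  obtains G where "\<And>a. a \<in> digits n p \<Longrightarrow> G a \<in> symmetric_polys n"
    "f = (\<Sum>a\<in>digits n p. basis_poly n a * subst_pow p (G a))"
proof -
  define c where "c m = (\<Sum>u\<in>{u\<in>keys f. deg u = m}. single u (lookup f u))" for m
  have lc: "lookup (c m) w = (if deg w = m then lookup f w else 0)" for m w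
    by (auto simp: c_def lookup_sum lookup_single when_def in_keys_iff)
  have kw: "keys w \<subseteq> {1..n}" if "lookup f w \<noteq> 0" for w
    using that f by (auto simp: symmetric_polys_iff polys_in_def in_keys_iff)
  have cS: "c m \<in> Symg n m" for m
    unfolding Symg_def symmetric_polys_iff Int_iff
  proof (intro conjI allI impI)
    show "c m \<in> polys_in n" "c m \<in> homogeneous_polys m"
      using f by (auto simp: symmetric_polys_iff polys_in_def homogeneous_polys_iff in_keys_iff lc split: if_splits)
    fix \<sigma> u assume \<sigma>: "\<sigma> permutes {1..n}"
    have eq: "lookup f (perm_mon \<sigma> u) = lookup f u" using f \<sigma> by (auto simp: symmetric_polys_iff)
    show "lookup (c m) (perm_mon \<sigma> u) = lookup (c m) u"
    proof (cases "lookup f u = 0")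
      case False
      then show ?thesis using deg_perm_mon[OF \<sigma> kw] eq by (simp add: lc)
    qed (simp add: lc eq)
  qed
  define D where "D = deg ` keys f"
  have fs: "f = (\<Sum>m\<in>D. c m)"
    by (rule poly_mapping_eqI) (auto simp: lookup_sum lc D_def in_keys_iff sum.delta)
  have "\<exists>G. (\<forall>a\<in>digits n p. G a \<in> symmetric_polys n) \<and>
      c m = (\<Sum>a\<in>digits n p. basis_poly n a * subst_pow p (G a))" for m
  proof -
    obtain G where G:
      "\<And>a. a \<in> digits n p \<Longrightarrow> wt n a \<le> m \<Longrightarrow> p dvd m - wt n a \<Longrightarrow> G a \<in> Symg n ((m - wt n a) div p)"
      "\<And>a. a \<in> digits n p \<Longrightarrow> \<not> (wt n a \<le> m \<and> p dvd m - wt n a) \<Longrightarrow> G a = 0"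
      "c m = (\<Sum>a\<in>digits n p. basis_poly n a * subst_pow p (G a))"
      using decomposition[OF p cS[of m]] by blast
    have "G a \<in> symmetric_polys n" if "a \<in> digits n p" for a
    proof (cases "wt n a \<le> m \<and> p dvd m - wt n a")
      case True
      then show ?thesis using G(1)[OF that] by (simp add: Symg_def)
    next
      case False
      then show ?thesis using G(2)[OF that] by (simp add: symmetric_polys_iff)
    qed
    then show ?thesis using G(3) by blast
  qed
  then obtain G where G: "\<And>m a. a \<in> digits n p \<Longrightarrow> G m a \<in> symmetric_polys n"
      "\<And>m. c m = (\<Sum>a\<in>digits n p. basis_poly n a * subst_pow p (G m a))" by metis
  define H where "H a = (\<Sum>m\<in>D. G m a)" for a
  have "f = (\<Sum>a\<in>digits n p. basis_poly n a * subst_pow p (H a))"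
    unfolding H_def subst_pow_sum sum_distrib_left
    by (subst sum.swap) (simp add: fs G(2)[symmetric])
  moreover have "H a \<in> symmetric_polys n" if "a \<in> digits n p" for a
    unfolding H_def
  proof (intro symmetric_polysI_eval polys_in_sum)
    show "G m a \<in> polys_in n" for m using G(1)[OF that] by (simp add: symmetric_polys_iff)
  qed (simp add: eval_poly_sum symmetric_eval[OF G(1)[OF that]])
  ultimately show ?thesis using that by blast
qed

section \<open>Interpolation on fibres of the power map\<close>

lemma fibre_interpolation:
  assumes p: "p > 0" and y: "inj_on y {1..n}"
    and \<eta>: "\<And>i. i \<in> {1..n} \<Longrightarrow> \<eta> i ^ p = y i"
  obtains f where "f \<in> symmetric_polys n"
    "\<And>\<xi>. (\<And>i. i \<in> {1..n} \<Longrightarrow> \<xi> i ^ p = y i) \<Longrightarrow>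
      eval_poly \<xi> f = (if \<forall>i\<in>{1..n}. \<xi> i = \<eta> i then 1 else 0)"
proof -
  \<comment> \<open>\<open>R\<close> contains every value that a coordinate of a point of the fibre
    can take, so each term \<open>h \<sigma>\<close> is a Lagrange product that vanishes as soon as
    one coordinate misses its target. On the fibre only \<open>\<sigma> = id\<close> can contribute,
    because the \<open>y i\<close> are distinct.\<close>
  define R where "R = (\<Union>i\<in>{1..n}. {z::complex. z ^ p = y i})"
  have finR: "finite R" unfolding R_def using finite_nth_roots[OF p] by auto
  define h :: "(nat \<Rightarrow> nat) \<Rightarrow> cpoly" where "h \<sigma> = (\<Prod>i\<in>{1..n}. \<Prod>\<omega>\<in>R - {\<eta> i}.
    (single (single (\<sigma> i) 1) 1 - single 0 \<omega>) * single 0 (1 / (\<eta> i - \<omega>)))" for \<sigma>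
  define f where "f = (\<Sum>\<sigma>\<in>{\<sigma>. \<sigma> permutes {1..n}}. h \<sigma>)"
  have ev: "eval_poly x (h \<sigma>) = (\<Prod>i\<in>{1..n}. \<Prod>\<omega>\<in>R - {\<eta> i}. (x (\<sigma> i) - \<omega>) / (\<eta> i - \<omega>))" for x \<sigma>
    by (simp add: h_def eval_poly_prod eval_poly_mult eval_poly_minus eval_mon_def)
  have hin: "h \<sigma> \<in> polys_in n" if "\<sigma> permutes {1..n}" for \<sigma>
  proof -
    have "single (single (\<sigma> i) 1) 1 - single 0 \<omega> \<in> polys_in n" if "i \<in> {1..n}" for i \<omega>
    proof -
      have "\<sigma> i \<in> {1..n}" using that permutes_in_image[OF \<open>\<sigma> permutes {1..n}\<close>] by blast
      then have "single (single (\<sigma> i) 1) 1 + single 0 (- \<omega>) \<in> polys_in n"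
        by (intro polys_in_add polys_in_single) auto
      then show ?thesis by (simp add: single_uminus)
    qed
    then show ?thesis unfolding h_def
      by (intro polys_in_prod polys_in_mult polys_in_single) auto
  qed
  have "f \<in> symmetric_polys n"
  proof (rule symmetric_polysI_eval)
    show "f \<in> polys_in n" unfolding f_def using hin by (intro polys_in_sum) auto
    fix \<tau> x assume \<tau>: "\<tau> permutes {1..n}"
    have "eval_poly (\<lambda>i. x (\<tau> i)) f = (\<Sum>\<sigma>\<in>{\<sigma>. \<sigma> permutes {1..n}}. eval_poly x (h (\<tau> \<circ> \<sigma>)))"
      by (simp add: f_def eval_poly_sum ev)
    also have "\<dots> = eval_poly x f"
      using setum_permutations_compose_left[OF \<tau>, of "\<lambda>\<sigma>. eval_poly x (h \<sigma>)"] by (simp add: f_def eval_poly_sum)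
    finally show "eval_poly (\<lambda>i. x (\<tau> i)) f = eval_poly x f" .
  qed
  moreover have "eval_poly \<xi> f = (if \<forall>i\<in>{1..n}. \<xi> i = \<eta> i then 1 else 0)"
    if \<xi>: "\<And>i. i \<in> {1..n} \<Longrightarrow> \<xi> i ^ p = y i" for \<xi>
  proof -
    have "eval_poly \<xi> (h \<sigma>) = (if \<sigma> = id \<and> (\<forall>i\<in>{1..n}. \<xi> i = \<eta> i) then 1 else 0)"
      if \<sigma>: "\<sigma> permutes {1..n}" for \<sigma>
    proof (cases "\<forall>i\<in>{1..n}. \<xi> (\<sigma> i) = \<eta> i")
      case True
      have "\<sigma> i = i" if "i \<in> {1..n}" for i
      proof -
        have s: "\<sigma> i \<in> {1..n}" using that permutes_in_image[OF \<sigma>] by blast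
        have "y (\<sigma> i) = y i" using \<xi>[OF s] \<eta>[OF that] True that by simp
        then show ?thesis using inj_onD[OF y _ s that] by blast
      qed
      then have id: "\<sigma> = id" using permutes_not_in[OF \<sigma>] by (metis eq_id_iff)
      have "eval_poly \<xi> (h \<sigma>) = 1"
        unfolding ev using True by (intro prod.neutral ballI) auto
      then show ?thesis using id True by simp
    next
      case False
      then obtain i where i: "i \<in> {1..n}" "\<xi> (\<sigma> i) \<noteq> \<eta> i" by auto
      have s: "\<sigma> i \<in> {1..n}" using i permutes_in_image[OF \<sigma>] by blast
      have "\<xi> (\<sigma> i) \<in> R - {\<eta> i}" using \<xi>[OF s] s i by (auto simp: R_def)
      then have "(\<Prod>\<omega>\<in>R - {\<eta> i}. (\<xi> (\<sigma> i) - \<omega>) / (\<eta> i - \<omega>)) = 0"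
        using finR by (intro prod_zero bexI[of _ "\<xi> (\<sigma> i)"]) auto
      then have "eval_poly \<xi> (h \<sigma>) = 0" unfolding ev using i(1)
        by (intro prod_zero[OF _ bexI[of _ i]]) auto
      then show ?thesis using False by auto
    qed
    then have "eval_poly \<xi> f = (\<Sum>\<sigma>\<in>{\<sigma>. \<sigma> permutes {1..n}}.
        if \<sigma> = id then (if \<forall>i\<in>{1..n}. \<xi> i = \<eta> i then 1 else 0) else 0)"
      unfolding f_def eval_poly_sum by (intro sum.cong) auto
    also have "\<dots> = (if \<forall>i\<in>{1..n}. \<xi> i = \<eta> i then 1 else 0)"
      by (subst sum.delta) (auto simp: finite_permutations permutes_id)
    finally show ?thesis .
  qed
  ultimately show ?thesis using that by blast
qed

text \<open>The values \<open>eval_poly y (G a)\<close> form a vector in the kernel of the matrix of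
  values of the basis polynomials on the fibre. The matrix is square because every nonzero
  \<open>y i\<close> has \<open>p\<close> roots, and decomposing the interpolating polynomials gives
  a right inverse.\<close>

lemma vanish_on_fibre:
  assumes p: "p > 0" and y: "inj_on y {1..n}" "\<And>i. i \<in> {1..n} \<Longrightarrow> y i \<noteq> 0"
    and G: "\<And>a. a \<in> digits n p \<Longrightarrow> G a \<in> symmetric_polys n"
    and 0: "\<And>\<xi>. (\<And>i. i \<in> {1..n} \<Longrightarrow> \<xi> i ^ p = y i) \<Longrightarrow>
      eval_poly \<xi> (\<Sum>a\<in>digits n p. basis_poly n a * subst_pow p (G a)) = 0"
    and a: "a \<in> digits n p"
  shows "eval_poly y (G a) = 0"
proof -
  define J where "J = (\<Pi>\<^sub>E i\<in>{1..n}. {z::complex. z ^ p = y i})"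
  have J: "\<xi> i ^ p = y i" if "\<xi> \<in> J" "i \<in> {1..n}" for \<xi> i
    using that by (auto simp: J_def PiE_iff)
  have ev: "eval_poly \<xi> (subst_pow p g) = eval_poly y g" if "\<xi> \<in> J" "g \<in> symmetric_polys n" for \<xi> g
    unfolding eval_subst_pow using that J
    by (intro eval_poly_cong[of g n]) (auto simp: symmetric_polys_iff)
  show ?thesis
  proof (rule right_inverse_imp_injective[where M = "\<lambda>\<xi> a. eval_poly \<xi> (basis_poly n a)"
        and c = "\<lambda>a. eval_poly y (G a)" and b = a])
    show "finite (digits n p)" by (rule finite_digits)
    show "finite J" unfolding J_def using finite_nth_roots[OF p] by (intro finite_PiE) auto
    show "card (digits n p) = card J"
      unfolding J_def using y(2) p by (simp add: card_digits card_PiE card_nth_roots)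
    show "a \<in> digits n p" by (rule a)
    show "(\<Sum>a\<in>digits n p. eval_poly \<xi> (basis_poly n a) * eval_poly y (G a)) = 0" if "\<xi> \<in> J" for \<xi>
      using 0[of \<xi>] J[OF that] ev[OF that G] by (simp add: eval_poly_sum eval_poly_mult)
    fix \<eta> assume \<eta>: "\<eta> \<in> J"
    obtain f where f: "f \<in> symmetric_polys n"
      "\<And>\<xi>. (\<And>i. i \<in> {1..n} \<Longrightarrow> \<xi> i ^ p = y i) \<Longrightarrow>
        eval_poly \<xi> f = (if \<forall>i\<in>{1..n}. \<xi> i = \<eta> i then 1 else 0)"
      using fibre_interpolation[OF p y(1) J[OF \<eta>]] by blast
    obtain H where H: "\<And>a. a \<in> digits n p \<Longrightarrow> H a \<in> symmetric_polys n"
      "f = (\<Sum>a\<in>digits n p. basis_poly n a * subst_pow p (H a))"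
      using decomposition_symmetric[OF p f(1)] by blast
    have "(\<Sum>a\<in>digits n p. eval_poly \<xi> (basis_poly n a) * eval_poly y (H a)) = (if \<xi> = \<eta> then 1 else 0)"
      if "\<xi> \<in> J" for \<xi>
    proof -
      have "(\<Sum>a\<in>digits n p. eval_poly \<xi> (basis_poly n a) * eval_poly y (H a)) = eval_poly \<xi> f"
        using ev[OF that H(1)] by (simp add: H(2) eval_poly_sum eval_poly_mult)
      also have "\<dots> = (if \<forall>i\<in>{1..n}. \<xi> i = \<eta> i then 1 else 0)" using f(2) J[OF that] by blast
      also have "(\<forall>i\<in>{1..n}. \<xi> i = \<eta> i) \<longleftrightarrow> \<xi> = \<eta>"
        using that \<eta> unfolding J_def by (metis PiE_ext)
      finally show ?thesis .
    qed
    then show "\<exists>N. \<forall>\<xi>\<in>J. (\<Sum>a\<in>digits n p. eval_poly \<xi> (basis_poly n a) * N a) = (if \<xi> = \<eta> then 1 else 0)"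
      by (intro exI[of _ "\<lambda>a. eval_poly y (H a)"]) auto
  qed
qed

text \<open>The wheel coordinates are taken on the unit circle, distinct by the order of \<tau>; the
  remaining ones have pairwise different norms greater than 1.\<close>

lemma generic_wheel_point:
  assumes \<tau>: "primitive_root_of_unity (k + 1) \<tau>" and k: "k \<ge> 1"
  obtains y where "wheel k \<tau> y" "inj_on y {1..n}" "\<And>i. i \<in> {1..n} \<Longrightarrow> y i \<noteq> 0"
proof
  define y :: "nat \<Rightarrow> complex" where "y i = (if i \<le> k + 1 then \<tau> ^ (i - 1) else of_nat i)" for i
  have nm: "norm (y i) = (if i \<le> k + 1 then 1 else real i)" for i
    using norm_primitive_root[OF \<tau>] by (simp add: y_def norm_power)
  show "wheel k \<tau> y" by (simp add: wheel_def y_def)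
  show "y i \<noteq> 0" if "i \<in> {1..n}" for i
    using nm[of i] that by (auto split: if_splits)
  show "inj_on y {1..n}"
  proof (rule inj_onI)
    fix i j assume ij: "i \<in> {1..n}" "j \<in> {1..n}" "y i = y j"
    then have nn: "norm (y i) = norm (y j)" by simp
    show "i = j"
    proof (cases "i \<le> k + 1 \<and> j \<le> k + 1")
      case True
      then have "\<tau> ^ (i - 1) = \<tau> ^ (j - 1)" using ij by (simp add: y_def)
      then have "i - 1 = j - 1"
        using inj_onD[OF primitive_inj_on[OF \<tau>], of "i - 1" "j - 1"] True ij by auto
      then show ?thesis using ij by auto
    next
      case False
      then show ?thesis using nn nm[of i] nm[of j] k by (auto split: if_splits)
    qed
  qed
qed

lemma finite_affine_zero:
  fixes u v :: complex
  assumes "u + v \<noteq> 0"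
  shows "finite {s. u + s * v = 0}"
proof (cases "v = 0")
  case True
  then show ?thesis using assms by simp
next
  case False
  then have "{s. u + s * v = 0} \<subseteq> {- u / v}" by (auto simp: field_simps eq_neg_iff_add_eq_0)
  then show ?thesis by (rule finite_subset) simp
qed

text \<open>The wheel locus is a linear subspace, so every point of it is a limit, along a line, of points
  with nonzero and pairwise distinct coordinates.\<close>

lemma vanish_on_wheel:
  assumes \<tau>: "primitive_root_of_unity (k + 1) \<tau>" and k: "k \<ge> 1"
    and gen: "\<And>y. wheel k \<tau> y \<Longrightarrow> inj_on y {1..n} \<Longrightarrow> (\<And>i. i \<in> {1..n} \<Longrightarrow> y i \<noteq> 0) \<Longrightarrow> eval_poly y g = 0"
    and x: "wheel k \<tau> x"
  shows "eval_poly x g = 0"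
proof -
  obtain y where y: "wheel k \<tau> y" "inj_on y {1..n}" "\<And>i. i \<in> {1..n} \<Longrightarrow> y i \<noteq> 0"
    using generic_wheel_point[OF \<tau> k] by blast
  define \<gamma> where "\<gamma> s i = x i + s * (y i - x i)" for s i
  \<comment> \<open>Parameters at which the line from \<open>x\<close> to the generic point
    \<open>y\<close> has a zero or a repeated coordinate. Each such condition is affine in
    \<open>s\<close> and fails at \<open>s = 1\<close>.\<close>
  define B where "B = (\<Union>i\<in>{1..n}. {s. x i + s * (y i - x i) = 0}) \<union>
    (\<Union>(i,j)\<in>{(i,j). i \<in> {1..n} \<and> j \<in> {1..n} \<and> i \<noteq> j}. {s. (x i - x j) + s * ((y i - x i) - (y j - x j)) = 0})"
  have "finite B" unfolding B_def
  proof (intro finite_UnI finite_UN_I)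
    show "finite {(i,j). i \<in> {1..n} \<and> j \<in> {1..n} \<and> i \<noteq> j}"
      by (rule finite_subset[of _ "{1..n} \<times> {1..n}"]) auto
    fix i assume "i \<in> {1..n}"
    then show "finite {s. x i + s * (y i - x i) = 0}" using y(3) by (intro finite_affine_zero) auto
  next
    fix ij assume "ij \<in> {(i,j). i \<in> {1..n} \<and> j \<in> {1..n} \<and> i \<noteq> j}"
    moreover obtain i j where "ij = (i,j)" by (cases ij)
    ultimately have ij: "ij = (i,j)" "i \<in> {1..n}" "j \<in> {1..n}" "i \<noteq> j" by simp_all
    have "y i \<noteq> y j" using inj_onD[OF y(2), of i j] ij by blast
    then have "finite {s. (x i - x j) + s * ((y i - x i) - (y j - x j)) = 0}"
      by (intro finite_affine_zero) auto
    then show "finite (case ij of (i,j) \<Rightarrow> {s. (x i - x j) + s * ((y i - x i) - (y j - x j)) = 0})"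
      using ij by simp
  qed auto
  have z: "eval_poly (\<gamma> s) g = 0" if "s \<notin> B" for s
  proof (rule gen)
    show "wheel k \<tau> (\<gamma> s)" using x y(1) by (auto simp: wheel_def \<gamma>_def algebra_simps)
    show "\<gamma> s i \<noteq> 0" if "i \<in> {1..n}" for i using that \<open>s \<notin> B\<close> by (auto simp: B_def \<gamma>_def)
    show "inj_on (\<gamma> s) {1..n}"
    proof (rule inj_onI, rule ccontr)
      fix i j assume ij: "i \<in> {1..n}" "j \<in> {1..n}" "\<gamma> s i = \<gamma> s j" "i \<noteq> j"
      then have "(x i - x j) + s * ((y i - x i) - (y j - x j)) = 0" by (simp add: \<gamma>_def algebra_simps)
      then show False using ij \<open>s \<notin> B\<close> by (auto simp: B_def)
    qed
  qed
  have "isCont (\<lambda>s. eval_poly (\<gamma> s) g) 0"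
    unfolding eval_poly_def \<gamma>_def by (intro continuous_intros)
  then have lim: "((\<lambda>s. eval_poly (\<gamma> s) g) \<longlongrightarrow> eval_poly (\<gamma> 0) g) (at 0)" by (simp add: isCont_def)
  \<comment> \<open>The parameter 0 may itself be bad, so it is kept in the neighbourhood while the
    other bad ones are removed.\<close>
  have "open (- (B - {0}))" using \<open>finite B\<close> by (intro open_Compl finite_imp_closed) simp
  then have "\<forall>\<^sub>F s in at 0. s \<notin> B"
    unfolding eventually_at_topological by (intro exI[of _ "- (B - {0})"]) auto
  then have "\<forall>\<^sub>F s in at 0. eval_poly (\<gamma> s) g = 0" by (rule eventually_mono) (rule z)
  then have "((\<lambda>s. eval_poly (\<gamma> s) g) \<longlongrightarrow> 0) (at 0)" by (rule tendsto_eventually)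
  then have "eval_poly (\<gamma> 0) g = 0" using tendsto_unique[OF _ lim] by force
  moreover have "\<gamma> 0 = x" by (auto simp: \<gamma>_def)
  ultimately show ?thesis by simp
qed

text \<open>Over a generic wheel point the ratio of \<open>\<xi> i\<close> to
  \<open>t ^ (i - 1) * \<xi> 1\<close> is a \<open>p\<close>-th root of unity, hence a power of
  \<open>q\<close>, so the conditions for all \<open>s\<close> together cover the whole fibre.
  Conversely, raising to the power \<open>p\<close> removes the powers of \<open>q\<close>.\<close>

lemma F_space_iff_Wheel:
  assumes k: "k \<ge> 1" and r: "r \<ge> 2" and cop: "coprime (k + 1) (r - 1)"
    and t: "primitive_root_of_unity (k + 1) t" and q: "primitive_root_of_unity (r - 1) q"
    and f: "f \<in> symmetric_polys n"
    and G: "\<And>a. a \<in> digits n (r - 1) \<Longrightarrow> G a \<in> symmetric_polys n"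
    and fG: "f = (\<Sum>a\<in>digits n (r - 1). basis_poly n a * subst_pow (r - 1) (G a))"
  shows "f \<in> F_space k r t q n \<longleftrightarrow> (\<forall>a\<in>digits n (r - 1). G a \<in> Wheel k (t ^ (r - 1)) n)"
proof (cases "k + 1 \<le> n")
  case False
  then show ?thesis using f G by (auto simp: F_space_def Wheel_def)
next
  case True
  define p where "p = r - 1"
  have p: "p > 0" using r by (simp add: p_def)
  note defs = p_def[symmetric]
  have G': "G a \<in> symmetric_polys n" if "a \<in> digits n p" for a using G that unfolding defs by blast
  have fG': "f = (\<Sum>a\<in>digits n p. basis_poly n a * subst_pow p (G a))" using fG unfolding defs .
  have \<tau>: "primitive_root_of_unity (k + 1) (t ^ p)"
    unfolding p_def by (rule primitive_root_power_coprime[OF t cop])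
  have qp: "q ^ p = 1" using q unfolding primitive_root_of_unity_def defs by blast
  show ?thesis unfolding defs
  proof
    assume "f \<in> F_space k r t q n"
    then have f0: "eval_poly x f = 0" if "\<forall>i\<in>{2..k + 1}. s i \<in> {0..r - 2}"
      "\<forall>i\<in>{2..k + 1}. x i = t ^ (i - 1) * q ^ s i * x 1" for s x
      using that True by (auto simp: F_space_def)
    show "\<forall>a\<in>digits n p. G a \<in> Wheel k (t ^ p) n"
    proof
      fix a assume a: "a \<in> digits n p"
      have "eval_poly x (G a) = 0" if "wheel k (t ^ p) x" for x
      proof (rule vanish_on_wheel[OF \<tau> k _ that])
        fix y assume y: "wheel k (t ^ p) y" "inj_on y {1..n}" "\<And>i. i \<in> {1..n} \<Longrightarrow> y i \<noteq> 0"
        show "eval_poly y (G a) = 0"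
        proof (rule vanish_on_fibre[OF p y(2,3) _ _ a])
          show "G a \<in> symmetric_polys n" if "a \<in> digits n p" for a using G' that by blast
          fix \<xi> assume \<xi>: "\<And>i. i \<in> {1..n} \<Longrightarrow> \<xi> i ^ p = y i"
          have "\<exists>j<p. \<xi> i = t ^ (i - 1) * q ^ j * \<xi> 1" if i: "i \<in> {2..k + 1}" for i
          proof -
            have i1: "i \<in> {1..n}" "1 \<in> {1..n}" using i True by auto
            have nz: "\<xi> 1 \<noteq> 0" using \<xi>[OF i1(2)] y(3)[OF i1(2)] p by (metis zero_power)
            have tz: "t \<noteq> 0" using norm_primitive_root[OF t] by auto
            define z where "z = \<xi> i / (t ^ (i - 1) * \<xi> 1)"
            have "\<xi> i ^ p = (t ^ (i - 1) * \<xi> 1) ^ p"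
              using \<xi>[OF i1(1)] \<xi>[OF i1(2)] y(1) i
              by (simp add: wheel_def power_mult_distrib flip: power_mult) (simp add: mult.commute)
            then have "z ^ p = 1" using nz tz by (simp add: z_def power_divide)
            then obtain j where "j < p" "z = q ^ j"
              using primitive_root_generates[OF q[unfolded defs]] by blast
            moreover have "\<xi> i = t ^ (i - 1) * z * \<xi> 1" using nz tz by (simp add: z_def)
            ultimately show ?thesis by auto
          qed
          then obtain s where s: "\<And>i. i \<in> {2..k + 1} \<Longrightarrow> s i < p \<and> \<xi> i = t ^ (i - 1) * q ^ s i * \<xi> 1"
            by metis
          have "s i \<in> {0..r - 2}" if "i \<in> {2..k + 1}" for i using s[OF that] by (auto simp: p_def)
          then have "eval_poly \<xi> f = 0" using s by (intro f0[of s]) auto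
          then show "eval_poly \<xi> (\<Sum>a\<in>digits n p. basis_poly n a * subst_pow p (G a)) = 0"
            using fG' by simp
        qed
      qed
      then show "G a \<in> Wheel k (t ^ p) n" using G' a by (simp add: Wheel_def)
    qed
  next
    assume W: "\<forall>a\<in>digits n p. G a \<in> Wheel k (t ^ p) n"
    have "eval_poly x f = 0" if s: "\<forall>i\<in>{2..k + 1}. x i = t ^ (i - 1) * q ^ s i * x 1" for s x
    proof -
      have "wheel k (t ^ p) (\<lambda>i. x i ^ p)"
        unfolding wheel_def
      proof
        fix i assume "i \<in> {2..k + 1}"
        then have "x i ^ p = (t ^ (i - 1) * q ^ s i * x 1) ^ p" using s by simp
        also have "\<dots> = (t ^ p) ^ (i - 1) * (q ^ p) ^ s i * x 1 ^ p"
          by (simp add: power_mult_distrib flip: power_mult) (simp add: mult.commute)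
        finally show "x i ^ p = (t ^ p) ^ (i - 1) * x 1 ^ p" by (simp add: qp)
      qed
      then show ?thesis using W True
        by (simp add: fG' eval_poly_sum eval_poly_mult eval_subst_pow Wheel_def)
    qed
    then show "f \<in> F_space k r t q n" using f by (auto simp: F_space_def)
  qed
qed

section \<open>Dimension of the wheel space by duality\<close>

text \<open>On the dual side a monomial \<open>v\<close> stands for \<open>\<Prod>j. e\<^sub>j^(v j)\<close>. The monomial \<open>x^u\<close> in the variables
  indexed by \<open>A\<close> corresponds to \<open>\<Prod>i\<in>A. e\<^bsub>u i\<^esub>\<close>; in particular zero exponents count.\<close>

definition cont :: "nat set \<Rightarrow> monom \<Rightarrow> monom" where
  "cont A u = (\<Sum>i\<in>A. single (lookup u i) 1)"

definition mwt :: "monom \<Rightarrow> nat" where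
  "mwt v = (\<Sum>j\<in>keys v. j * lookup v j)"

lemma mwt_superset:
  assumes "finite A" "keys u \<subseteq> A"
  shows "mwt u = (\<Sum>i\<in>A. i * lookup u i)"
  unfolding mwt_def by (rule sum.mono_neutral_left) (use assms in \<open>auto simp: in_keys_iff\<close>)

lemma mwt_add [simp]: "mwt (u + w) = mwt u + mwt w"
  by (simp add: mwt_superset[of "keys u \<union> keys w"] keys_plus_monom lookup_add sum.distrib distrib_left)

lemma mwt_0 [simp]: "mwt 0 = 0"
  by (simp add: mwt_def)

lemma mwt_single [simp]: "mwt (single i c) = i * c"
  by (cases "c = 0") (simp_all add: mwt_def)

lemma mwt_sum: "mwt (\<Sum>a\<in>A. f a) = (\<Sum>a\<in>A. mwt (f a))"
  by (induction A rule: infinite_finite_induct) simp_all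

lemma lookup_cont: "finite A \<Longrightarrow> lookup (cont A u) j = card {i\<in>A. lookup u i = j}"
  unfolding card_eq_sum by (subst sum.inter_filter) (simp_all only: cont_def lookup_sum lookup_single when_def)

lemma deg_cont: "deg (cont A u) = card A"
  by (simp add: cont_def deg_sum)

lemma mwt_cont: "finite A \<Longrightarrow> keys u \<subseteq> A \<Longrightarrow> mwt (cont A u) = deg u"
  by (simp add: cont_def mwt_sum deg_superset[of A])

lemma cont_cong: "(\<And>i. i \<in> A \<Longrightarrow> lookup u i = lookup w i) \<Longrightarrow> cont A u = cont A w"
  by (simp add: cont_def)

lemma cont_perm_mon: "\<sigma> permutes A \<Longrightarrow> cont A (perm_mon \<sigma> u) = cont A u"
  using sum.permute[of \<sigma> A "\<lambda>i. single (lookup u i) (1::nat)"]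
  by (simp add: cont_def lookup_perm_mon comp_def)

text \<open>Equal contents mean equal multisets of exponents on \<open>A\<close>.\<close>

lemma cont_eq_imp_perm:
  assumes "finite A" "keys u \<subseteq> A" "keys w \<subseteq> A" "cont A u = cont A w"
  obtains \<sigma> where "\<sigma> permutes A" "u = perm_mon \<sigma> w"
proof -
  have *: "count (image_mset g (mset_set A)) j = card {i\<in>A. g i = j}" for g :: "nat \<Rightarrow> nat" and j
    using assms(1) by (induction A rule: finite_induct) (auto simp: Collect_conv_if conj_disj_distribR Collect_disj_eq)
  have "image_mset (lookup u) (mset_set A) = image_mset (lookup w) (mset_set A)"
    by (rule multiset_eqI) (use assms(4) in \<open>simp add: * flip: lookup_cont[OF assms(1)]\<close>)
  then obtain \<sigma> where \<sigma>: "\<sigma> permutes A" "\<forall>x\<in>A. lookup u x = lookup w (\<sigma> x)"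
    using image_mset_eq_implies_permutes[OF assms(1)] by metis
  have "u = perm_mon \<sigma> w"
  proof (rule poly_mapping_eqI)
    fix i
    show "lookup u i = lookup (perm_mon \<sigma> w) i"
    proof (cases "i \<in> A")
      case False
      then have "i \<notin> keys u" "i \<notin> keys w" using assms by auto
      then show ?thesis using permutes_not_in[OF \<sigma>(1) False]
        by (simp add: lookup_perm_mon[OF \<sigma>(1)] in_keys_iff)
    qed (use \<sigma> in \<open>simp add: lookup_perm_mon[OF \<sigma>(1)]\<close>)
  qed
  then show ?thesis using that \<sigma>(1) by blast
qed

lemma lookup_eq_cont:
  assumes "f \<in> symmetric_polys n" "keys u \<subseteq> {1..n}" "keys w \<subseteq> {1..n}"
    "cont {1..n} u = cont {1..n} w"
  shows "lookup f u = lookup f w"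
  using cont_eq_imp_perm[OF _ assms(2-4)] assms(1) by (metis finite_atLeastAtMost symmetric_polys_iff)

text \<open>The factors of \<open>v\<close>, counted with multiplicity, are distributed over the
  variables in \<open>A\<close>; a factor with index 0 becomes the exponent 0.\<close>

lemma ex_cont:
  assumes "finite A" "deg v = card A"
  shows "\<exists>u. keys u \<subseteq> A \<and> cont A u = v"
  using assms
proof (induction A arbitrary: v rule: finite_induct)
  case empty
  then have "lookup v i = 0" for i using lookup_le_deg[of v i] by simp
  then have "v = 0" by (intro poly_mapping_eqI) simp
  then show ?case by (intro exI[of _ 0]) (simp add: cont_def)
next
  case (insert a A)
  then have "v \<noteq> 0" by auto
  then obtain j where j: "lookup v j \<noteq> 0" by (metis lookup_zero poly_mapping_eqI)
  have v: "v = (v - single j 1) + single j 1"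
    by (rule poly_mapping_eqI) (use j in \<open>auto simp: lookup_add lookup_minus lookup_single when_def\<close>)
  have "deg v = deg (v - single j 1) + deg (single j 1)"
    unfolding deg_add[symmetric] using v by simp
  then have "deg (v - single j 1) = card A" using insert by simp
  then obtain u where u: "keys u \<subseteq> A" "cont A u = v - single j 1" using insert.IH by blast
  have la: "lookup u a = 0" using u(1) insert.hyps by (auto simp: in_keys_iff subset_iff)
  have "cont A (u + single a j) = cont A u"
    by (rule cont_cong) (use insert.hyps in \<open>auto simp: lookup_add lookup_single when_def\<close>)
  then have "cont (insert a A) (u + single a j) = v"
    using insert.hyps la u(2) v by (simp add: cont_def lookup_add add.commute)
  moreover have "keys (u + single a j) \<subseteq> insert a A" using u(1) by (auto simp: keys_plus_monom split: if_splits)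
  ultimately show ?case by blast
qed

section \<open>Symmetric polynomials as linear functionals\<close>

definition pair :: "(monom \<Rightarrow> complex) \<Rightarrow> cpoly \<Rightarrow> complex" where
  "pair c g = (\<Sum>v\<in>keys g. lookup g v * c v)"

lemma pair_superset:
  assumes "finite A" "keys g \<subseteq> A"
  shows "pair c g = (\<Sum>v\<in>A. lookup g v * c v)"
  unfolding pair_def by (rule sum.mono_neutral_left) (use assms in \<open>auto simp: in_keys_iff\<close>)

lemma pair_add: "pair c (f + g) = pair c f + pair c g"
  using Poly_Mapping.keys_add[of f g]
  by (simp add: pair_superset[of "keys f \<union> keys g"] lookup_add sum.distrib distrib_right)

lemma pair_0 [simp]: "pair c 0 = 0"
  by (simp add: pair_def)

lemma pair_scale: "pair c (scale_poly d f) = d * pair c f"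
proof -
  have "keys (scale_poly d f) \<subseteq> keys f" by (auto simp: in_keys_iff)
  then show ?thesis by (simp add: pair_superset[of "keys f"] sum_distrib_left mult.assoc)
qed

lemma pair_sum: "pair c (\<Sum>a\<in>A. f a) = (\<Sum>a\<in>A. pair c (f a))"
  by (induction A rule: infinite_finite_induct) (simp_all add: pair_add)

lemma pair_single [simp]: "pair c (single v d) = d * c v"
  by (cases "d = 0") (simp_all add: pair_def)

text \<open>The functional attached to a symmetric \<open>f\<close>. The choice is independent of \<open>u\<close> by symmetry, and it
  picks junk unless \<open>v\<close> has degree \<open>n\<close>.\<close>

definition cf :: "nat \<Rightarrow> cpoly \<Rightarrow> monom \<Rightarrow> complex" where
  "cf n f v = lookup f (SOME u. keys u \<subseteq> {1..n} \<and> cont {1..n} u = v)"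

lemma cf_cont:
  assumes "f \<in> symmetric_polys n" "keys u \<subseteq> {1..n}"
  shows "cf n f (cont {1..n} u) = lookup f u"
proof -
  have "\<exists>w. keys w \<subseteq> {1..n} \<and> cont {1..n} w = cont {1..n} u" using assms by blast
  from someI_ex[OF this] show ?thesis unfolding cf_def
    using lookup_eq_cont[OF assms(1) _ assms(2)] by blast
qed

lemma cf_add: "cf n (f + g) v = cf n f v + cf n g v"
  by (simp add: cf_def lookup_add)

lemma cf_scale: "cf n (scale_poly c f) v = c * cf n f v"
  by (simp add: cf_def)

lemma pair_cf_add: "pair (cf n (f + g)) h = pair (cf n f) h + pair (cf n g) h"
  by (simp add: pair_def cf_add sum.distrib distrib_left)

lemma pair_cf_scale: "pair (cf n (scale_poly c f)) h = c * pair (cf n f) h"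
  by (simp add: pair_def cf_scale sum_distrib_left mult_ac)

lemma pair_cf_0 [simp]: "pair (cf n 0) h = 0"
  by (simp add: pair_def cf_def)

lemma pair_cf_sum: "pair (cf n (\<Sum>a\<in>A. f a)) h = (\<Sum>a\<in>A. pair (cf n (f a)) h)"
  by (induction A rule: infinite_finite_induct) (simp_all add: pair_cf_add)

text \<open>The coefficient of \<open>z^d\<close> in \<open>e(z) e(\<tau>z) \<dots> e(\<tau>^(N - 1) z)\<close>.\<close>

definition Es :: "nat \<Rightarrow> complex \<Rightarrow> nat \<Rightarrow> cpoly" where
  "Es N \<tau> d = (\<Sum>u\<in>mons {1..N} d. single (cont {1..N} u) (eval_mon (\<lambda>i. \<tau> ^ (i - 1)) u))"

definition restr :: "nat set \<Rightarrow> monom \<Rightarrow> monom" where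
  "restr A u = (\<Sum>i\<in>A. single i (lookup u i))"

lemma lookup_restr: "finite A \<Longrightarrow> lookup (restr A u) i = (if i \<in> A then lookup u i else 0)"
  by (simp add: restr_def lookup_sum lookup_single when_def)

lemma sum_split_monoms:
  assumes A: "finite A" "finite B" "A \<inter> B = {}"
  shows "(\<Sum>u\<in>mons (A \<union> B) m. g u) =
    (\<Sum>b\<in>{u. keys u \<subseteq> B \<and> deg u \<le> m}. \<Sum>a\<in>mons A (m - deg b). g (a + b))"
proof -
  define T where "T = {u. keys u \<subseteq> B \<and> deg u \<le> m}"
  have fT: "finite T"
    by (rule finite_subset[OF _ finite_bounded_monoms[OF A(2), of m]])
      (auto simp: T_def intro: order_trans[OF lookup_le_deg])
  have z: "lookup u i = 0" if "keys u \<subseteq> C" "i \<notin> C" for u :: monom and i C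
    using that by (auto simp: in_keys_iff subset_iff)
  have "(\<Sum>u\<in>mons (A \<union> B) m. g u) = (\<Sum>(b,a)\<in>(SIGMA b:T. mons A (m - deg b)). g (a + b))"
  proof (rule sum.reindex_bij_witness[where j = "\<lambda>u. (restr B u, restr A u)" and i = "\<lambda>(b,a). a + b"])
    fix u assume "u \<in> mons (A \<union> B) m"
    then have u: "keys u \<subseteq> A \<union> B" "deg u = m" by (auto simp: mons_def)
    have eq: "u = restr A u + restr B u"
      using A(3) z[OF u(1)] by (intro poly_mapping_eqI) (auto simp: lookup_add lookup_restr A(1,2) disjoint_iff)
    have kr: "keys (restr C u) \<subseteq> C" if "finite C" for C
      using that by (auto simp: in_keys_iff lookup_restr split: if_splits)
    have "deg (restr A u) + deg (restr B u) = m" using eq u(2) by (metis deg_add)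
    then show "(restr B u, restr A u) \<in> (SIGMA b:T. mons A (m - deg b))"
      using kr A by (auto simp: T_def mons_def)
    show "(case (restr B u, restr A u) of (b, a) \<Rightarrow> a + b) = u" using eq by simp
    then show "(case (restr B u, restr A u) of (b, a) \<Rightarrow> g (a + b)) = g u" by simp
  next
    fix ba assume ba: "ba \<in> (SIGMA b:T. mons A (m - deg b))"
    obtain b a where e: "ba = (b,a)" by (cases ba)
    have k: "keys b \<subseteq> B" "deg b \<le> m" "keys a \<subseteq> A" "deg a = m - deg b"
      using ba e by (auto simp: T_def mons_def)
    have dj: "lookup b i = 0" if "i \<in> A" for i using z[OF k(1), of i] A(3) that by blast
    have dj': "lookup a i = 0" if "i \<in> B" for i using z[OF k(3), of i] A(3) that by blast
    have "restr B (a + b) = b"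
      by (rule poly_mapping_eqI) (simp add: lookup_restr A(2) lookup_add dj' z[OF k(1)])
    moreover have "restr A (a + b) = a"
      by (rule poly_mapping_eqI) (simp add: lookup_restr A(1) lookup_add dj z[OF k(3)])
    ultimately show "(restr B (case ba of (b,a) \<Rightarrow> a + b), restr A (case ba of (b,a) \<Rightarrow> a + b)) = ba" by (simp add: e)
    show "(case ba of (b,a) \<Rightarrow> a + b) \<in> mons (A \<union> B) m" using k by (auto simp: e mons_def keys_plus_monom)
  qed
  also have "\<dots> = (\<Sum>b\<in>T. \<Sum>a\<in>mons A (m - deg b). g (a + b))"
    using fT A by (intro sum.Sigma[symmetric]) (auto simp: finite_mons)
  finally show ?thesis by (simp add: T_def)
qed

text \<open>On the locus the first \<open>N\<close> variables are fixed multiples of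
  \<open>x 1\<close> and the others are free. Homogeneity fixes the power of \<open>x 1\<close> that
  accompanies a monomial \<open>b\<close> in the free variables, and the remaining coefficient
  \<open>P b\<close> is exactly the pairing in the statement.\<close>

lemma Wheel_iff_pair:
  assumes N: "N = k + 1" "N \<le> n" and f: "f \<in> Symg n m"
  shows "f \<in> Wheel k \<tau> n \<longleftrightarrow> (\<forall>b. keys b \<subseteq> {N + 1..n} \<and> deg b \<le> m \<longrightarrow>
    pair (cf n f) (Es N \<tau> (m - deg b) * single (cont {N + 1..n} b) 1) = 0)" (is "?L \<longleftrightarrow> ?R")
proof -
  define w where "w i = \<tau> ^ (i - 1)" for i :: nat
  define T where "T = {b. keys b \<subseteq> {N + 1..n} \<and> deg b \<le> m}"
  define P where "P b = (\<Sum>a\<in>mons {1..N} (m - deg b). lookup f (a + b) * eval_mon w a)" for b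
  have fT: "finite T"
    by (rule finite_subset[OF _ finite_bounded_monoms[of "{N + 1..n}" m]])
      (auto simp: T_def intro: order_trans[OF lookup_le_deg])
  have fs: "f \<in> symmetric_polys n" using f by (simp add: Symg_def)
  have un: "{1..n} = {1..N} \<union> {N + 1..n}" "{1..N} \<inter> {N + 1..n} = {}" using N by auto
  have z: "lookup u i = 0" if "keys u \<subseteq> C" "i \<notin> C" for u :: monom and i C
    using that by (auto simp: in_keys_iff subset_iff)
  have PP: "pair (cf n f) (Es N \<tau> (m - deg b) * single (cont {N + 1..n} b) 1) = P b" if "b \<in> T" for b
  proof -
    have kb: "keys b \<subseteq> {N + 1..n}" using that by (simp add: T_def)
    have "cf n f (cont {1..N} a + cont {N + 1..n} b) = lookup f (a + b)" if "a \<in> mons {1..N} d" for a d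
    proof -
      have ka: "keys a \<subseteq> {1..N}" using that by (simp add: mons_def)
      have "cont {1..n} (a + b) = cont {1..N} (a + b) + cont {N + 1..n} (a + b)"
        unfolding cont_def un(1) using un(2) by (intro sum.union_disjoint) auto
      also have "cont {1..N} (a + b) = cont {1..N} a"
        by (rule cont_cong) (use z[OF kb] in \<open>simp add: lookup_add\<close>)
      also have "cont {N + 1..n} (a + b) = cont {N + 1..n} b"
        by (rule cont_cong) (use z[OF ka] in \<open>simp add: lookup_add\<close>)
      finally have "cont {1..n} (a + b) = cont {1..N} a + cont {N + 1..n} b" .
      moreover have "keys (a + b) \<subseteq> {1..n}" using ka kb unfolding un(1) by (auto simp: keys_plus_monom)
      ultimately show ?thesis using cf_cont[OF fs] by metis
    qed
    then show ?thesis
      unfolding P_def Es_def w_def sum_distrib_right mult_single pair_sum pair_single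
      by (intro sum.cong) (simp_all add: mult.commute)
  qed
  have ev: "eval_poly x f = (\<Sum>b\<in>T. x 1 ^ (m - deg b) * P b * eval_mon x b)" if x: "wheel k \<tau> x" for x
  proof -
    have xw: "x i = w i * x 1" if "i \<in> {1..N}" for i
    proof (cases "i = 1")
      case False
      then have "i \<in> {2..k + 1}" using that N(1) by auto
      then show ?thesis using x unfolding wheel_def w_def by blast
    qed (simp add: w_def)
    have em: "eval_mon x a = x 1 ^ deg a * eval_mon w a" if "keys a \<subseteq> {1..N}" for a
    proof -
      have "eval_mon x a = (\<Prod>i\<in>{1..N}. (w i * x 1) ^ lookup a i)"
        unfolding eval_mon_superset[OF finite_atLeastAtMost that] by (intro prod.cong refl arg_cong2[of _ _ _ _ "(^)"] xw)
      also have "\<dots> = eval_mon w a * x 1 ^ deg a"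
        by (simp add: power_mult_distrib prod.distrib eval_mon_superset[OF finite_atLeastAtMost that]
            deg_superset[OF finite_atLeastAtMost that] power_sum)
      finally show ?thesis by simp
    qed
    have "eval_poly x f = (\<Sum>u\<in>mons {1..n} m. lookup f u * eval_mon x u)"
      by (rule eval_poly_sup[OF finite_mons keys_Symg[OF f]]) simp
    also have "\<dots> = (\<Sum>b\<in>T. \<Sum>a\<in>mons {1..N} (m - deg b). lookup f (a + b) * eval_mon x (a + b))"
      unfolding un(1) T_def using un(2) by (intro sum_split_monoms) auto
    also have "\<dots> = (\<Sum>b\<in>T. x 1 ^ (m - deg b) * P b * eval_mon x b)"
      unfolding P_def sum_distrib_left sum_distrib_right
      by (intro sum.cong refl) (auto simp: eval_mon_add em mons_def)
    finally show ?thesis .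
  qed
  have "?L \<longleftrightarrow> (\<forall>x. wheel k \<tau> x \<longrightarrow> eval_poly x f = 0)"
    using fs N by (simp add: Wheel_def)
  also have "\<dots> \<longleftrightarrow> (\<forall>b\<in>T. P b = 0)"
  proof
    assume 0: "\<forall>x. wheel k \<tau> x \<longrightarrow> eval_poly x f = 0"
    define h where "h = (\<Sum>b\<in>T. single b (P b))"
    have "h = 0"
    proof (rule eval_poly_zero_imp)
      fix X
      \<comment> \<open>This point has \<open>x 1 = 1\<close>, which removes the powers of
        \<open>x 1\<close>; what is left is \<open>h\<close> at arbitrary values of the free
        variables.\<close>
      define x where "x i = (if i \<le> N then w i else X i)" for i
      have wx: "wheel k \<tau> x" using N by (auto simp: wheel_def x_def w_def)
      have "eval_mon x b = eval_mon X b" if "b \<in> T" for b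
        by (rule eval_mon_cong) (use that in \<open>auto simp: T_def x_def\<close>)
      moreover have "x 1 = 1" using N by (simp add: x_def w_def)
      ultimately have "eval_poly X h = eval_poly x f"
        unfolding ev[OF wx] h_def eval_poly_sum by (intro sum.cong) auto
      then show "eval_poly X h = 0" using 0 wx by simp
    qed
    moreover have "lookup h b = P b" if "b \<in> T" for b
      using fT that by (simp add: h_def lookup_sum lookup_single when_def)
    ultimately show "\<forall>b\<in>T. P b = 0" by simp
  next
    assume "\<forall>b\<in>T. P b = 0"
    then show "\<forall>x. wheel k \<tau> x \<longrightarrow> eval_poly x f = 0" by (simp add: ev)
  qed
  also have "\<dots> \<longleftrightarrow> ?R" using PP by (auto simp: T_def)
  finally show ?thesis .
qed

text \<open>Replacing \<open>z\<close> by \<open>\<tau>z\<close> permutes the factors of the product cyclically.\<close>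

lemma Es_eq_0:
  assumes \<tau>: "primitive_root_of_unity N \<tau>" and d: "\<not> N dvd d"
  shows "Es N \<tau> d = 0"
proof -
  define w where "w i = \<tau> ^ (i - 1)" for i :: nat
  have w_eq: "(\<lambda>i. \<tau> ^ (i - 1)) = w" by (simp add: w_def fun_eq_iff)
  define \<sigma> where "\<sigma> i = (if i \<in> {1..N} then (if i = N then 1 else Suc i) else i)" for i
  have \<sigma>: "\<sigma> permutes {1..N}"
  proof (rule bij_imp_permutes)
    show "bij_betw \<sigma> {1..N} {1..N}"
      by (rule bij_betw_byWitness[where f' = "\<lambda>i. if i = 1 then N else i - 1"]) (auto simp: \<sigma>_def)
    show "\<sigma> x = x" if "x \<notin> {1..N}" for x using that by (auto simp: \<sigma>_def)
  qed
  have \<sigma>': "inv \<sigma> permutes {1..N}" by (rule permutes_inv[OF \<sigma>])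
  have tN: "\<tau> ^ N = 1" using \<tau> by (simp add: primitive_root_of_unity_def)
  have ws: "w (\<sigma> i) = \<tau> * w i" if "i \<in> {1..N}" for i
    using that tN by (auto simp: w_def \<sigma>_def simp flip: power_Suc)
  have em: "eval_mon w u = \<tau> ^ d * eval_mon w (perm_mon \<sigma> u)" if "u \<in> mons {1..N} d" for u
  proof -
    have u: "keys u \<subseteq> {1..N}" "deg u = d" using that by (auto simp: mons_def)
    have ku: "keys (perm_mon \<sigma> u) \<subseteq> {1..N}" "deg (perm_mon \<sigma> u) = d"
      using keys_perm_mon[OF \<sigma> u(1)] deg_perm_mon[OF \<sigma> u(1)] u(2) by auto
    have "eval_mon w u = (\<Prod>i\<in>{1..N}. w (\<sigma> i) ^ lookup u (\<sigma> i))"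
      unfolding eval_mon_superset[OF finite_atLeastAtMost u(1)]
      using prod.permute[OF \<sigma>, of "\<lambda>i. w i ^ lookup u i"] by (simp add: comp_def)
    also have "\<dots> = (\<Prod>i\<in>{1..N}. (\<tau> * w i) ^ lookup (perm_mon \<sigma> u) i)"
      by (intro prod.cong) (simp_all add: ws lookup_perm_mon[OF \<sigma>])
    also have "\<dots> = \<tau> ^ d * eval_mon w (perm_mon \<sigma> u)"
      unfolding eval_mon_superset[OF finite_atLeastAtMost ku(1)] power_mult_distrib prod.distrib
      using deg_superset[OF finite_atLeastAtMost ku(1)] ku(2) by (simp add: power_sum)
    finally show ?thesis .
  qed
  have pp: "perm_mon (inv \<sigma>) (perm_mon \<sigma> u) = u" "perm_mon \<sigma> (perm_mon (inv \<sigma>) u) = u" for u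
    using perm_mon_comp[OF \<sigma>' \<sigma>, of u] perm_mon_comp[OF \<sigma> \<sigma>', of u] permutes_inv_o[OF \<sigma>] by simp_all
  have mm: "perm_mon \<pi> u \<in> mons {1..N} d" if "\<pi> permutes {1..N}" "u \<in> mons {1..N} d" for \<pi> u
    using that keys_perm_mon[OF that(1)] deg_perm_mon[OF that(1)] by (auto simp: mons_def)
  have "scale_poly (\<tau> ^ d) (Es N \<tau> d) =
    (\<Sum>u\<in>mons {1..N} d. single (cont {1..N} u) (\<tau> ^ d * eval_mon w u))"
    unfolding Es_def w_eq by (simp add: scale_poly_eq_mult sum_distrib_left mult_single)
  also have "\<dots> = (\<Sum>u\<in>mons {1..N} d. single (cont {1..N} (perm_mon \<sigma> u)) (\<tau> ^ d * eval_mon w (perm_mon \<sigma> u)))"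
    by (rule sum.reindex_bij_witness[where i = "perm_mon \<sigma>" and j = "perm_mon (inv \<sigma>)"])
      (use pp mm \<sigma> \<sigma>' in auto)
  also have "\<dots> = Es N \<tau> d"
    unfolding Es_def w_eq cont_perm_mon[OF \<sigma>] by (intro sum.cong) (simp_all add: em)
  finally have "scale_poly (\<tau> ^ d - 1) (Es N \<tau> d) = 0" by (simp add: cpoly.scale_left_diff_distrib)
  moreover have "\<tau> ^ d \<noteq> 1" using primitive_power_eq_1_iff[OF \<tau>] d by simp
  ultimately show ?thesis by simp
qed

text \<open>A monomial \<open>e\<^bsub>i\<^sub>1\<^esub> \<dots> e\<^bsub>i\<^sub>N\<^esub>\<close> with index sum \<open>N * i\<close> other than \<open>e\<^sub>i^N\<close> contains some \<open>e\<^sub>j\<close> with \<open>j < i\<close>,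
  so it is larger in the order.\<close>

lemma low_Es:
  assumes \<tau>: "primitive_root_of_unity N \<tau>"
  shows "Es N \<tau> (N * i) \<noteq> 0" "low (Es N \<tau> (N * i)) = single i N"
proof -
  define w where "w j = \<tau> ^ (j - 1)" for j :: nat
  have N: "N > 0" using \<tau> by (simp add: primitive_root_of_unity_def)
  define u0 where "u0 = (\<Sum>j\<in>{1..N}. single j i)"
  have lu0: "lookup u0 j = (if j \<in> {1..N} then i else 0)" for j
    by (simp add: u0_def lookup_sum lookup_single when_def)
  have u0: "u0 \<in> mons {1..N} (N * i)"
    using lu0 by (auto simp: mons_def u0_def deg_sum in_keys_iff split: if_splits)
  have "cont {1..N} u0 = (\<Sum>j\<in>{1..N}. single i 1)"
    unfolding cont_def by (rule sum.cong) (simp_all add: lu0)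
  then have c0: "cont {1..N} u0 = single i N"
    by (intro poly_mapping_eqI, simp only: lookup_sum) (simp add: lookup_single when_def)
  have lt: "single i N < cont {1..N} u" if u: "u \<in> mons {1..N} (N * i)" "u \<noteq> u0" for u
  proof -
    have ku: "keys u \<subseteq> {1..N}" "deg u = N * i" using u by (auto simp: mons_def)
    have "\<exists>j\<in>{1..N}. lookup u j < i"
    proof (rule ccontr)
      assume "\<not> ?thesis"
      then have ge: "\<And>j. j \<in> {1..N} \<Longrightarrow> i \<le> lookup u j" by force
      have sm: "(\<Sum>j\<in>{1..N}. i) = (\<Sum>j\<in>{1..N}. lookup u j)"
        using ku deg_superset[OF finite_atLeastAtMost ku(1)] by simp
      have eq: "lookup u j = i" if "j \<in> {1..N}" for j
        by (rule sum_mono_inv[OF sm ge that finite_atLeastAtMost, symmetric])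
      have "u = u0"
      proof (rule poly_mapping_eqI)
        fix j show "lookup u j = lookup u0 j"
        proof (cases "j \<in> {1..N}")
          case False
          then have "j \<notin> keys u" using ku(1) by blast
          then show ?thesis using False by (auto simp: lu0 in_keys_iff)
        qed (simp add: lu0 eq)
      qed
      then show False using u(2) by simp
    qed
    then obtain j where j: "j \<in> {1..N}" "lookup u j < i" by blast
    let ?v = "cont {1..N} u"
    have "lookup ?v (lookup u j) > 0" using j by (auto simp: lookup_cont card_gt_0_iff)
    \<comment> \<open>The first index occurring in the content is below \<open>i\<close>, and there
      \<open>single i N\<close> has exponent 0.\<close>
    define l where "l = (LEAST l. lookup ?v l > 0)"
    have l1: "lookup ?v l > 0" unfolding l_def by (rule LeastI) fact
    have l2: "l \<le> lookup u j" unfolding l_def by (rule Least_le) fact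
    have l3: "lookup ?v l' = 0" if "l' < l" for l' using not_less_Least[of l' "\<lambda>l. lookup ?v l > 0"] that by (auto simp: l_def)
    show ?thesis unfolding less_poly_mapping.rep_eq less_fun_def
      by (rule exI[of _ l]) (use l1 l2 l3 j(2) in \<open>auto simp: lookup_single when_def\<close>)
  qed
  \<comment> \<open>Different \<open>u\<close> can share a content, so coefficients might cancel; at
    \<open>single i N\<close> only \<open>u0\<close> contributes.\<close>
  have cu: "cont {1..N} u = single i N \<longleftrightarrow> u = u0" if "u \<in> mons {1..N} (N * i)" for u
    using lt[OF that] c0 by (metis less_irrefl)
  have "lookup (Es N \<tau> (N * i)) (single i N) =
      (\<Sum>u\<in>mons {1..N} (N * i). if u = u0 then eval_mon w u else 0)"
    unfolding Es_def lookup_sum lookup_single when_def w_def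
    using cu by (intro sum.cong) auto
  also have "\<dots> = eval_mon w u0" using u0 by (simp add: finite_mons)
  finally have lk: "lookup (Es N \<tau> (N * i)) (single i N) = eval_mon w u0" .
  have "\<tau> \<noteq> 0" using norm_primitive_root[OF \<tau>] by auto
  then have nz: "lookup (Es N \<tau> (N * i)) (single i N) \<noteq> 0" unfolding lk by (simp add: eval_mon_def w_def)
  then show "Es N \<tau> (N * i) \<noteq> 0" by auto
  show "low (Es N \<tau> (N * i)) = single i N"
  proof (rule low_eqI[OF nz])
    fix v assume "v \<in> keys (Es N \<tau> (N * i))"
    then obtain u where "u \<in> mons {1..N} (N * i)" "v = cont {1..N} u"
      using Poly_Mapping.keys_sum[of "\<lambda>u. single (cont {1..N} u) (eval_mon (\<lambda>j. \<tau> ^ (j - 1)) u)" "mons {1..N} (N * i)"]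
      by (auto simp: Es_def split: if_splits)
    then show "single i N \<le> v" using lt[of u] c0 by (cases "u = u0") auto
  qed
qed

section \<open>Bihomogeneous polynomials and a basis adapted to the ideal\<close>

definition bimons :: "nat \<Rightarrow> nat \<Rightarrow> monom set" where
  "bimons n m = {v. deg v = n \<and> mwt v = m}"

definition bihom :: "nat \<Rightarrow> nat \<Rightarrow> cpoly set" where
  "bihom n m = {g. keys g \<subseteq> bimons n m}"

text \<open>The weight bounds the indices and the degree bounds the exponents, including that of
  \<open>e\<^sub>0\<close>, which has weight 0.\<close>

lemma finite_bimons: "finite (bimons n m)"
proof (rule finite_subset[OF _ finite_bounded_monoms[of "{..m}" n]])
  show "bimons n m \<subseteq> {u. keys u \<subseteq> {..m} \<and> (\<forall>i. lookup u i \<le> n)}"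
  proof
    fix u assume u: "u \<in> bimons n m"
    have "i \<le> m" if "i \<in> keys u" for i
    proof -
      have "i \<le> i * lookup u i" using that by (simp add: in_keys_iff)
      also have "\<dots> \<le> mwt u" unfolding mwt_def using that by (intro member_le_sum) auto
      finally show ?thesis using u by (simp add: bimons_def)
    qed
    then show "u \<in> {u. keys u \<subseteq> {..m} \<and> (\<forall>i. lookup u i \<le> n)}"
      using u lookup_le_deg[of u] by (auto simp: bimons_def)
  qed
qed simp

lemma subspace_bihom: "cpoly.subspace (bihom n m)"
  unfolding cpoly.subspace_def
proof (intro conjI ballI allI)
  show "0 \<in> bihom n m" by (simp add: bihom_def)
  show "x + y \<in> bihom n m" if "x \<in> bihom n m" "y \<in> bihom n m" for x y
    using that Poly_Mapping.keys_add[of x y] by (auto simp: bihom_def)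
  show "scale_poly c x \<in> bihom n m" if "x \<in> bihom n m" for c x
  proof -
    have "keys (scale_poly c x) \<subseteq> keys x" by (auto simp: in_keys_iff)
    then show ?thesis using that by (auto simp: bihom_def)
  qed
qed

lemma bihom_mult:
  assumes "f \<in> bihom a b" "g \<in> bihom c d"
  shows "f * g \<in> bihom (a + c) (b + d)"
  unfolding bihom_def
proof clarify
  fix u assume "u \<in> keys (f * g)"
  then obtain v w where "v \<in> keys f" "w \<in> keys g" "u = v + w"
    using Poly_Mapping.keys_mult[of f g] by blast
  then show "u \<in> bimons (a + c) (b + d)" using assms by (auto simp: bihom_def bimons_def)
qed

lemma bihom_1: "1 \<in> bihom 0 0"
  by (simp add: bihom_def bimons_def)

lemma bihom_single: "single v c \<in> bihom (deg v) (mwt v)"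
  by (simp add: bihom_def bimons_def)

lemma bihom_power: "f \<in> bihom a b \<Longrightarrow> f ^ j \<in> bihom (j * a) (j * b)"
  by (induction j) (auto simp: bihom_1 bihom_mult)

lemma bihom_prod:
  "finite A \<Longrightarrow> (\<And>i. i \<in> A \<Longrightarrow> f i \<in> bihom (a i) (b i)) \<Longrightarrow> (\<Prod>i\<in>A. f i) \<in> bihom (\<Sum>i\<in>A. a i) (\<Sum>i\<in>A. b i)"
  by (induction A rule: finite_induct) (auto simp: bihom_1 bihom_mult)

lemma Es_bihom: "Es N \<tau> d \<in> bihom N d"
  unfolding bihom_def
proof clarify
  fix v assume "v \<in> keys (Es N \<tau> d)"
  then obtain u where "u \<in> mons {1..N} d" "v = cont {1..N} u"
    using Poly_Mapping.keys_sum[of "\<lambda>u. single (cont {1..N} u) (eval_mon (\<lambda>j. \<tau> ^ (j - 1)) u)" "mons {1..N} d"]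
    by (auto simp: Es_def split: if_splits)
  then show "v \<in> bimons N d"
    by (simp add: bimons_def deg_cont mwt_cont mons_def)
qed

text \<open>The basis \<open>Z v = \<Prod>i. E\<^sub>i^(v i div N) * e\<^sub>i^(v i mod N)\<close>, where \<open>E\<^sub>i\<close> is the coefficient of \<open>z^(N i)\<close>,
  is adapted to the ideal generated by the \<open>E\<^sub>i\<close>: the ideal is spanned by those \<open>Z v\<close> in which some \<open>E\<^sub>i\<close> occurs.\<close>

definition Zfac :: "nat \<Rightarrow> complex \<Rightarrow> monom \<Rightarrow> nat \<Rightarrow> cpoly" where
  "Zfac N \<tau> v i = Es N \<tau> (N * i) ^ (lookup v i div N) * single (single i (lookup v i mod N)) 1"

definition Z :: "nat \<Rightarrow> complex \<Rightarrow> monom \<Rightarrow> cpoly" where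
  "Z N \<tau> v = (\<Prod>i\<in>keys v. Zfac N \<tau> v i)"

lemma Z_superset: "finite A \<Longrightarrow> keys v \<subseteq> A \<Longrightarrow> Z N \<tau> v = (\<Prod>i\<in>A. Zfac N \<tau> v i)"
  unfolding Z_def by (rule prod.mono_neutral_left) (auto simp: Zfac_def in_keys_iff)

lemma monom_eq_sum_single: "v = (\<Sum>i\<in>keys v. single i (lookup v i))" for v :: monom
  by (rule cpoly_eq_sum_single)

lemma Zfac_bihom: "Zfac N \<tau> v i \<in> bihom (lookup v i) (i * lookup v i)"
proof -
  let ?q = "lookup v i div N" and ?r = "lookup v i mod N"
  have "Zfac N \<tau> v i \<in> bihom (?q * N + ?r) (?q * (N * i) + i * ?r)"
    unfolding Zfac_def using bihom_single[of "single i ?r" 1] unfolding deg_single mwt_single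
    by (intro bihom_mult bihom_power Es_bihom)
  moreover have "?q * N + ?r = lookup v i" by simp
  moreover have "?q * (N * i) + i * ?r = i * (?q * N + ?r)" by (simp only: distrib_left mult_ac)
  ultimately show ?thesis by simp
qed

lemma Z_bihom: "Z N \<tau> v \<in> bihom (deg v) (mwt v)"
  unfolding Z_def deg_def mwt_def using Zfac_bihom by (intro bihom_prod) auto

lemma low_Zfac:
  assumes \<tau>: "primitive_root_of_unity N \<tau>"
  shows "Zfac N \<tau> v i \<noteq> 0" "low (Zfac N \<tau> v i) = single i (lookup v i)"
proof -
  let ?q = "lookup v i div N" and ?r = "lookup v i mod N"
  show "Zfac N \<tau> v i \<noteq> 0" by (simp add: Zfac_def low_Es[OF \<tau>])
  have "low (Zfac N \<tau> v i) = (\<Sum>_<?q. single i N) + single i ?r"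
    unfolding Zfac_def
    by (simp add: low_mult low_Es[OF \<tau>] low_power del: sum_constant)
  also have "(\<Sum>_<j. single i N) = single i (j * N)" for j :: nat
    by (induction j) (simp_all add: single_add[symmetric] add.commute del: sum_constant)
  also have "single i (?q * N) + single i ?r = single i (?q * N + ?r)" by (simp only: single_add)
  also have "\<dots> = single i (lookup v i)" by simp
  finally show "low (Zfac N \<tau> v i) = single i (lookup v i)" .
qed

text \<open>Quotient and remainder recombine to the full exponent in each factor, so the polynomials
  \<open>Z N \<tau> v\<close> are a triangular modification of the monomials.\<close>

lemma low_Z:
  assumes \<tau>: "primitive_root_of_unity N \<tau>"
  shows "Z N \<tau> v \<noteq> 0" "low (Z N \<tau> v) = v"
proof -
  show "Z N \<tau> v \<noteq> 0" by (simp add: Z_def low_Zfac[OF \<tau>])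
  have "low (Z N \<tau> v) = (\<Sum>i\<in>keys v. single i (lookup v i))"
    unfolding Z_def by (subst low_prod) (simp_all add: low_Zfac[OF \<tau>])
  then show "low (Z N \<tau> v) = v" using monom_eq_sum_single[of v] by simp
qed

text \<open>Adding \<open>N\<close> to an exponent raises its quotient by one and keeps its
  remainder. Multiplication by a generator of the ideal thus sends basis elements to basis
  elements.\<close>

lemma Z_add_single:
  assumes "N > 0"
  shows "Z N \<tau> (v + single i N) = Es N \<tau> (N * i) * Z N \<tau> v"
proof -
  let ?v = "v + single i N"
  define A where "A = insert i (keys v)"
  have A: "finite A" "i \<in> A" "keys v \<subseteq> A" "keys ?v \<subseteq> A"
    by (auto simp: A_def keys_plus_monom split: if_splits)
  have "Zfac N \<tau> ?v j = Zfac N \<tau> v j" if "j \<noteq> i" for j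
    using that by (simp add: Zfac_def lookup_add lookup_single)
  then have "(\<Prod>j\<in>A - {i}. Zfac N \<tau> ?v j) = (\<Prod>j\<in>A - {i}. Zfac N \<tau> v j)"
    by (intro prod.cong) auto
  moreover have "Zfac N \<tau> ?v i = Es N \<tau> (N * i) * Zfac N \<tau> v i"
    using assms by (simp add: Zfac_def lookup_add mult.assoc)
  ultimately show ?thesis
    using A by (simp add: Z_superset[of A] prod.remove[of A i] mult.assoc)
qed

lemma bihom_span_Z:
  assumes \<tau>: "primitive_root_of_unity N \<tau>"
  shows "bihom n m \<subseteq> cpoly.span (Z N \<tau> ` bimons n m)"
proof (rule span_by_low)
  show "finite (bimons n m)" by (rule finite_bimons)
  show "cpoly.subspace (bihom n m)" by (rule subspace_bihom)
  show "keys f \<subseteq> bimons n m" if "f \<in> bihom n m" for f using that by (simp add: bihom_def)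
  show "Z N \<tau> ` bimons n m \<subseteq> bihom n m" using Z_bihom by (auto simp: bimons_def)
  fix f assume f: "f \<in> bihom n m" "f \<noteq> 0"
  then have "low f \<in> bimons n m" using low_in_keys[OF f(2)] by (auto simp: bihom_def)
  then show "\<exists>b\<in>Z N \<tau> ` bimons n m. b \<noteq> 0 \<and> low b = low f" using low_Z[OF \<tau>] by blast
qed

section \<open>Monomials with bounded exponents and the dual basis\<close>

definition good :: "nat \<Rightarrow> nat \<Rightarrow> nat \<Rightarrow> monom set" where
  "good k n m = {v \<in> bimons n m. \<forall>i. lookup v i \<le> k}"

lemma finite_good: "finite (good k n m)"
  by (simp add: good_def finite_bimons)

lemma bad_split:
  assumes "v \<in> bimons n m - good k n m"
  obtains v' i where "v = v' + single i (k + 1)" "k + 1 \<le> n" "(k + 1) * i \<le> m"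
    "v' \<in> bimons (n - (k + 1)) (m - (k + 1) * i)"
proof -
  obtain i where i: "k + 1 \<le> lookup v i" using assms by (auto simp: good_def not_le Suc_le_eq)
  define v' where "v' = v - single i (k + 1)"
  have v: "v = v' + single i (k + 1)"
    by (rule poly_mapping_eqI) (use i in \<open>auto simp: v'_def lookup_add lookup_minus lookup_single when_def\<close>)
  have "deg v = deg v' + (k + 1)" "mwt v = mwt v' + i * (k + 1)"
    unfolding v deg_add mwt_add deg_single mwt_single by simp_all
  moreover have "deg v = n" "mwt v = m" using assms by (auto simp: bimons_def)
  ultimately have "k + 1 \<le> n" "(k + 1) * i \<le> m" "v' \<in> bimons (n - (k + 1)) (m - (k + 1) * i)"
    by (auto simp: bimons_def mult.commute)
  then show ?thesis using that v by blast
qed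

lemma pair_mult_eq_0_by_span:
  assumes "g \<in> cpoly.span B" "\<And>b. b \<in> B \<Longrightarrow> pair c (e * b) = 0"
  shows "pair c (e * g) = 0"
  using assms(1)
proof (induction rule: cpoly.span_induct_alt)
  case base
  then show ?case by simp
next
  case (step d x y)
  then show ?case using assms(2) by (simp add: distrib_left pair_add mult_scale_poly pair_scale)
qed

text \<open>Two spanning sets of the ideal in one bidegree are compared: generators times monomials,
  and the \<open>Z\<close> with some exponent above \<open>k\<close>. Each is expanded in the other,
  with \<open>Z_add_single\<close> as the link.\<close>

lemma Wheel_iff_pair_Z:
  assumes \<tau>: "primitive_root_of_unity (k + 1) \<tau>" and f: "f \<in> Symg n m"
  shows "f \<in> Wheel k \<tau> n \<longleftrightarrow> (\<forall>v\<in>bimons n m - good k n m. pair (cf n f) (Z (k + 1) \<tau> v) = 0)"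
proof (cases "k + 1 \<le> n")
  case False
  have "v \<notin> bimons n m - good k n m" for v using False bad_split[of v n m k] by blast
  then show ?thesis using f False by (auto simp: Wheel_def Symg_def)
next
  case True
  define N where "N = k + 1"
  have N: "N > 0" "N \<le> n" "N = k + 1" using True by (auto simp: N_def)
  have \<tau>N: "primitive_root_of_unity N \<tau>" using \<tau> by (simp add: N_def)
  note W = Wheel_iff_pair[OF N(3,2) f, of \<tau>]
  show ?thesis unfolding N_def[symmetric]
  proof
    assume L: "f \<in> Wheel k \<tau> n"
    show "\<forall>v\<in>bimons n m - good k n m. pair (cf n f) (Z N \<tau> v) = 0"
    proof
      fix v assume "v \<in> bimons n m - good k n m"
      then obtain v' i where v: "v = v' + single i N" "N * i \<le> m" "v' \<in> bimons (n - N) (m - N * i)"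
        unfolding N_def by (elim bad_split) blast
      have "pair (cf n f) (Es N \<tau> (N * i) * Z N \<tau> v') = 0"
      proof (rule pair_mult_eq_0_by_span)
        show "Z N \<tau> v' \<in> cpoly.span ((\<lambda>w. single w 1) ` bimons (n - N) (m - N * i))"
        proof -
          have eq: "(\<Sum>w\<in>keys (Z N \<tau> v'). scale_poly (lookup (Z N \<tau> v') w) (single w 1)) = Z N \<tau> v'"
            using cpoly_eq_sum_single[of "Z N \<tau> v'"] by (simp add: scale_poly_eq_mult mult_single)
          have sub: "keys (Z N \<tau> v') \<subseteq> bimons (n - N) (m - N * i)"
            using Z_bihom[of N \<tau> v'] v(3) by (auto simp: bihom_def bimons_def)
          have "(\<Sum>w\<in>keys (Z N \<tau> v'). scale_poly (lookup (Z N \<tau> v') w) (single w 1))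
              \<in> cpoly.span ((\<lambda>w. single w 1) ` bimons (n - N) (m - N * i))"
            using sub by (intro cpoly.span_sum cpoly.span_scale cpoly.span_base) blast
          then show ?thesis unfolding eq .
        qed
        fix b assume "b \<in> (\<lambda>w. single w (1::complex)) ` bimons (n - N) (m - N * i)"
        then obtain w where w: "b = single w 1" "deg w = n - N" "mwt w = m - N * i" by (auto simp: bimons_def)
        \<comment> \<open>The cofactor has degree \<open>n - N\<close>, the number of free
          variables, so it is the content of a monomial in them.\<close>
        obtain u where u: "keys u \<subseteq> {N + 1..n}" "cont {N + 1..n} u = w"
          using ex_cont[of "{N + 1..n}" w] w(2) by auto
        have "deg u = m - N * i" using mwt_cont[OF _ u(1)] u(2) w(3) by simp
        then have "m - deg u = N * i" "deg u \<le> m" using v(2) by auto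
        then show "pair (cf n f) (Es N \<tau> (N * i) * b) = 0"
          using L W u w(1) by auto
      qed
      then show "pair (cf n f) (Z N \<tau> v) = 0" using v(1) Z_add_single[OF N(1)] by simp
    qed
  next
    assume R: "\<forall>v\<in>bimons n m - good k n m. pair (cf n f) (Z N \<tau> v) = 0"
    show "f \<in> Wheel k \<tau> n" unfolding W
    proof (intro allI impI, elim conjE)
      fix b assume b: "keys b \<subseteq> {N + 1..n}" "deg b \<le> m"
      show "pair (cf n f) (Es N \<tau> (m - deg b) * single (cont {N + 1..n} b) 1) = 0"
      proof (cases "N dvd m - deg b")
        case False
        then show ?thesis using Es_eq_0[OF \<tau>N] by simp
      next
        case True
        then obtain i where i: "m - deg b = N * i" by blast
        have "single (cont {N + 1..n} b) (1::complex) \<in> bihom (n - N) (deg b)"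
          using bihom_single[of "cont {N + 1..n} b" 1] mwt_cont[OF _ b(1)] by (simp add: deg_cont)
        then have "single (cont {N + 1..n} b) 1 \<in> cpoly.span (Z N \<tau> ` bimons (n - N) (deg b))"
          using bihom_span_Z[OF \<tau>N] by blast
        then show ?thesis unfolding i
        proof (rule pair_mult_eq_0_by_span)
          fix g assume "g \<in> Z N \<tau> ` bimons (n - N) (deg b)"
          then obtain v where v: "g = Z N \<tau> v" "deg v = n - N" "mwt v = deg b" by (auto simp: bimons_def)
          have "v + single i N \<in> bimons n m"
            using v b(2) i N by (auto simp: bimons_def mult.commute)
          moreover have "\<not> lookup (v + single i N) i \<le> k" by (simp add: lookup_add N_def)
          ultimately have "v + single i N \<in> bimons n m - good k n m" unfolding good_def by blast
          then show "pair (cf n f) (Es N \<tau> (N * i) * g) = 0"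
            using R Z_add_single[OF N(1)] v(1) by metis
        qed
      qed
    qed
  qed
qed

text \<open>Distinct lowest monomials make the \<open>b v\<close> independent, so a linear map with
  the prescribed values exists, and a linear map to the scalars is determined by its values on
  monomials.\<close>

lemma dual_functionals:
  assumes "finite U" and low: "\<And>v. v \<in> U \<Longrightarrow> b v \<noteq> 0 \<and> low (b v) = v"
  shows "\<exists>c. \<forall>v\<in>U. pair c (b v) = (if v = \<beta> then 1 else 0)"
proof -
  interpret cc: vector_space_pair scale_poly "(*) :: complex \<Rightarrow> complex \<Rightarrow> complex"
    by unfold_locales (auto simp: algebra_simps)
  have inj: "inj_on (\<lambda>v. low (b v)) U" using low by (auto simp: inj_on_def)
  have *: "\<forall>v\<in>U. d v = 0" if "(\<Sum>v\<in>U. scale_poly (d v) (b v)) = 0" for d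
    using distinct_low_coeffs_0[OF assms(1) _ inj that] low by blast
  have "cpoly.independent (b ` U)" using independent_family[OF assms(1), of b] * by blast
  then obtain g where g: "Vector_Spaces.linear scale_poly (*) g" "\<forall>x\<in>b ` U. g x = (if low x = \<beta> then 1 else 0)"
    using cc.linear_independent_extend[of "b ` U" "\<lambda>x. if low x = \<beta> then 1 else 0"] by blast
  interpret g: Vector_Spaces.linear scale_poly "(*)" g by (rule g(1))
  have "pair (\<lambda>v. g (single v 1)) h = g h" for h
  proof -
    have "h = (\<Sum>w\<in>keys h. scale_poly (lookup h w) (single w 1))"
      using cpoly_eq_sum_single[of h] by (simp add: scale_poly_eq_mult mult_single)
    then have "g h = g (\<Sum>w\<in>keys h. scale_poly (lookup h w) (single w 1))" by simp
    then show ?thesis by (simp add: g.sum g.scale pair_def)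
  qed
  then show ?thesis using g(2) low by (intro exI[of _ "\<lambda>v. g (single v 1)"]) auto
qed

text \<open>The basis consists of the polynomials whose functionals are dual to the
  \<open>Z\<close>. For a good index the functional kills the ideal, and pairing a member of the
  wheel space with the \<open>Z\<close> reads off its coordinates.\<close>

lemma Wheel_basis:
  assumes \<tau>: "primitive_root_of_unity (k + 1) \<tau>"
  obtains F where
    "\<And>\<beta>. \<beta> \<in> good k n m \<Longrightarrow> F \<beta> \<in> Wheel k \<tau> n \<inter> Symg n m"
    "\<And>f. f \<in> Wheel k \<tau> n \<inter> Symg n m \<Longrightarrow> \<exists>d. f = (\<Sum>\<beta>\<in>good k n m. scale_poly (d \<beta>) (F \<beta>))"
    "\<And>d \<beta>. (\<Sum>\<beta>\<in>good k n m. scale_poly (d \<beta>) (F \<beta>)) = 0 \<Longrightarrow> \<beta> \<in> good k n m \<Longrightarrow> d \<beta> = 0"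
proof -
  define N where "N = k + 1"
  have \<tau>N: "primitive_root_of_unity N \<tau>" using \<tau> by (simp add: N_def)
  define U where "U = bimons n m"
  have gU: "good k n m \<subseteq> U" by (auto simp: good_def U_def)
  have "\<exists>c. \<forall>v\<in>U. pair c (Z N \<tau> v) = (if v = \<beta> then 1 else 0)" for \<beta>
    using low_Z[OF \<tau>N] finite_bimons by (intro dual_functionals) (auto simp: U_def)
  then obtain c where c: "\<And>\<beta> v. v \<in> U \<Longrightarrow> pair (c \<beta>) (Z N \<tau> v) = (if v = \<beta> then 1 else 0)" by metis
  \<comment> \<open>The coefficient at \<open>u\<close> depends only on the content of
    \<open>u\<close>, which makes the polynomial symmetric.\<close>
  define F where "F \<beta> = (\<Sum>u\<in>mons {1..n} m. single u (c \<beta> (cont {1..n} u)))" for \<beta>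
  have lF: "lookup (F \<beta>) u = (if u \<in> mons {1..n} m then c \<beta> (cont {1..n} u) else 0)" for \<beta> u
    by (simp add: F_def lookup_sum lookup_single when_def finite_mons)
  have FS: "F \<beta> \<in> Symg n m" for \<beta>
    unfolding Symg_def symmetric_polys_iff Int_iff
  proof (intro conjI allI impI)
    have "keys (F \<beta>) \<subseteq> mons {1..n} m" by (auto simp: in_keys_iff lF split: if_splits)
    then show "F \<beta> \<in> polys_in n" "F \<beta> \<in> homogeneous_polys m"
      unfolding polys_in_def homogeneous_polys_iff mons_def by blast+
    fix \<sigma> u assume \<sigma>: "\<sigma> permutes {1..n}"
    have pp: "perm_mon (inv \<sigma>) (perm_mon \<sigma> u) = u"
      using perm_mon_comp[OF permutes_inv[OF \<sigma>] \<sigma>, of u] permutes_inv_o(1)[OF \<sigma>] by simp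
    have "perm_mon \<pi> w \<in> mons {1..n} m" if "\<pi> permutes {1..n}" "w \<in> mons {1..n} m" for \<pi> w
      using that keys_perm_mon[OF that(1)] deg_perm_mon[OF that(1)] by (auto simp: mons_def)
    then have "perm_mon \<sigma> u \<in> mons {1..n} m \<longleftrightarrow> u \<in> mons {1..n} m"
      using \<sigma> permutes_inv[OF \<sigma>] pp by metis
    then show "lookup (F \<beta>) (perm_mon \<sigma> u) = lookup (F \<beta>) u"
      unfolding lF cont_perm_mon[OF \<sigma>] by simp
  qed
  have rep: "\<exists>u. keys u \<subseteq> {1..n} \<and> deg u = m \<and> cont {1..n} u = v" if "v \<in> U" for v
    using ex_cont[of "{1..n}" v] that mwt_cont[of "{1..n}"] by (fastforce simp: U_def bimons_def)
  have cfF: "cf n (F \<beta>) v = c \<beta> v" if "v \<in> U" for \<beta> v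
  proof -
    obtain u where u: "keys u \<subseteq> {1..n}" "deg u = m" "cont {1..n} u = v" using rep[OF \<open>v \<in> U\<close>] by blast
    then show ?thesis using cf_cont[OF _ u(1), of "F \<beta>"] FS[of \<beta>] lF[of \<beta> u]
      by (simp add: Symg_def mons_def)
  qed
  have pF: "pair (cf n (F \<beta>)) (Z N \<tau> v) = (if v = \<beta> then 1 else 0)" if "v \<in> U" for \<beta> v
  proof -
    have "keys (Z N \<tau> v) \<subseteq> U" using Z_bihom[of N \<tau> v] that by (auto simp: U_def bihom_def bimons_def)
    then have "pair (cf n (F \<beta>)) (Z N \<tau> v) = pair (c \<beta>) (Z N \<tau> v)"
      unfolding pair_def using cfF by (intro sum.cong) auto
    then show ?thesis using c[OF that] by simp
  qed
  have FW: "F \<beta> \<in> Wheel k \<tau> n" if "\<beta> \<in> good k n m" for \<beta>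
    unfolding Wheel_iff_pair_Z[OF \<tau> FS] using pF that by (auto simp: U_def N_def)
  have psum: "pair (cf n (\<Sum>\<beta>\<in>good k n m. scale_poly (d \<beta>) (F \<beta>))) (Z N \<tau> v) =
      (if v \<in> good k n m then d v else 0)" if "v \<in> U" for d v
    using that by (simp add: pair_cf_sum pair_cf_scale pF finite_good if_distrib[of "(*) _"] cong: if_cong)
  show ?thesis
  proof
    show "F \<beta> \<in> Wheel k \<tau> n \<inter> Symg n m" if "\<beta> \<in> good k n m" for \<beta>
      using FW[OF that] FS by blast
    show "d \<beta> = 0" if "(\<Sum>\<beta>\<in>good k n m. scale_poly (d \<beta>) (F \<beta>)) = 0" "\<beta> \<in> good k n m" for d \<beta>
    proof -
      have "\<beta> \<in> U" using that(2) gU by blast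
      from psum[OF this, of d] show ?thesis using that by simp
    qed
    fix f assume f: "f \<in> Wheel k \<tau> n \<inter> Symg n m"
    define d where "d v = pair (cf n f) (Z N \<tau> v)" for v
    define g where "g = f - (\<Sum>\<beta>\<in>good k n m. scale_poly (d \<beta>) (F \<beta>))"
    have gS: "g \<in> Symg n m" unfolding g_def using f FS
      by (intro cpoly.subspace_diff[OF subspace_Symg] cpoly.subspace_sum[OF subspace_Symg]
          cpoly.subspace_scale[OF subspace_Symg]) auto
    have gZ: "pair (cf n g) (Z N \<tau> v) = 0" if "v \<in> U" for v
    proof -
      have "pair (cf n g) h + pair (cf n (\<Sum>\<beta>\<in>good k n m. scale_poly (d \<beta>) (F \<beta>))) h = pair (cf n f) h" for h
        unfolding pair_cf_add[symmetric] g_def by simp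
      from this[of "Z N \<tau> v"] have "pair (cf n g) (Z N \<tau> v) = d v - (if v \<in> good k n m then d v else 0)"
        using psum[OF that, of d] by (simp add: d_def algebra_simps)
      moreover have "d v = 0" if "v \<notin> good k n m"
        using f Wheel_iff_pair_Z[OF \<tau>, of f n m] \<open>v \<in> U\<close> that by (auto simp: d_def U_def N_def)
      ultimately show ?thesis by simp
    qed
    \<comment> \<open>The functional of \<open>g\<close> kills all \<open>Z\<close>, hence every
      single monomial of this bidegree, and those values are the coefficients of
      \<open>g\<close>.\<close>
    have "lookup g u = 0" for u
    proof (cases "u \<in> mons {1..n} m")
      case True
      then have u: "keys u \<subseteq> {1..n}" "deg u = m" by (auto simp: mons_def)
      define v where "v = cont {1..n} u"
      have "single v (1::complex) \<in> bihom n m"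
        using bihom_single[of v 1] u mwt_cont[OF _ u(1)] by (simp add: v_def deg_cont)
      then have "single v 1 \<in> cpoly.span (Z N \<tau> ` U)" using bihom_span_Z[OF \<tau>N] by (auto simp: U_def)
      then have "pair (cf n g) (1 * single v 1) = 0"
        by (rule pair_mult_eq_0_by_span) (use gZ in auto)
      then show ?thesis using cf_cont[OF _ u(1), of g] gS by (simp add: v_def Symg_def)
    next
      case False
      then show ?thesis using keys_Symg[OF gS] by (auto simp: in_keys_iff subset_iff)
    qed
    then have "g = 0" by (intro poly_mapping_eqI) simp
    then show "\<exists>d. f = (\<Sum>\<beta>\<in>good k n m. scale_poly (d \<beta>) (F \<beta>))" by (auto simp: g_def)
  qed
qed

section \<open>The dimension of the graded pieces\<close>

lemma subspace_Wheel_Symg: "cpoly.subspace (Wheel k \<tau> n \<inter> Symg n m)"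
  unfolding cpoly.subspace_def
proof (intro conjI ballI allI)
  show "0 \<in> Wheel k \<tau> n \<inter> Symg n m"
    using cpoly.subspace_0[OF subspace_Symg, of n m] by (auto simp: Wheel_def Symg_def)
  show "x + y \<in> Wheel k \<tau> n \<inter> Symg n m" if "x \<in> Wheel k \<tau> n \<inter> Symg n m" "y \<in> Wheel k \<tau> n \<inter> Symg n m" for x y
    using that cpoly.subspace_add[OF subspace_Symg, of x n m y] by (auto simp: Wheel_def Symg_def eval_poly_add)
  show "scale_poly c x \<in> Wheel k \<tau> n \<inter> Symg n m" if "x \<in> Wheel k \<tau> n \<inter> Symg n m" for c x
    using that cpoly.subspace_scale[OF subspace_Symg, of x n m c] by (auto simp: Wheel_def Symg_def eval_poly_scale)
qed

text \<open>Products of a \<open>basis_poly n a\<close> with a substituted dual basis element of the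
  complementary degree form a basis. Grouping a combination by \<open>a\<close> yields coefficients
  \<open>G c a\<close>, so membership reduces to the wheel criterion and independence to
  \<open>freeness\<close>.\<close>

lemma dim_F_graded:
  assumes k: "k \<ge> 1" and r: "r \<ge> 2" and cop: "coprime (k + 1) (r - 1)"
    and t: "primitive_root_of_unity (k + 1) t" and q: "primitive_root_of_unity (r - 1) q"
  shows "cpoly.dim (F_graded k r t q n m) =
    (\<Sum>a\<in>digits n (r - 1). if wt n a \<le> m \<and> (r - 1) dvd m - wt n a
       then card (good k n ((m - wt n a) div (r - 1))) else 0)"
proof -
  define p where "p = r - 1"
  have p: "p > 0" using r by (simp add: p_def)
  note crit = F_space_iff_Wheel[OF k r cop t q, folded p_def]
  define \<tau> where "\<tau> = t ^ p"
  have \<tau>: "primitive_root_of_unity (k + 1) \<tau>"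
    unfolding \<tau>_def p_def by (rule primitive_root_power_coprime[OF t cop])
  define W where "W m' = Wheel k \<tau> n \<inter> Symg n m'" for m'
  have subW: "cpoly.subspace (W m')" for m' unfolding W_def by (rule subspace_Wheel_Symg)
  define fam where "fam m' F \<longleftrightarrow> (\<forall>\<beta>\<in>good k n m'. F \<beta> \<in> W m') \<and>
    (\<forall>f\<in>W m'. \<exists>d. f = (\<Sum>\<beta>\<in>good k n m'. scale_poly (d \<beta>) (F \<beta>))) \<and>
    (\<forall>d. (\<Sum>\<beta>\<in>good k n m'. scale_poly (d \<beta>) (F \<beta>)) = 0 \<longrightarrow> (\<forall>\<beta>\<in>good k n m'. d \<beta> = 0))" for m' F
  have "\<exists>F. fam m' F" for m'
  proof (rule Wheel_basis[OF \<tau>, of n m', folded W_def])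
    fix F
    assume F: "\<And>\<beta>. \<beta> \<in> good k n m' \<Longrightarrow> F \<beta> \<in> W m'"
      "\<And>f. f \<in> W m' \<Longrightarrow> \<exists>d. f = (\<Sum>\<beta>\<in>good k n m'. scale_poly (d \<beta>) (F \<beta>))"
      "\<And>d \<beta>. (\<Sum>\<beta>\<in>good k n m'. scale_poly (d \<beta>) (F \<beta>)) = 0 \<Longrightarrow> \<beta> \<in> good k n m' \<Longrightarrow> d \<beta> = 0"
    show ?thesis unfolding fam_def by (intro exI[of _ F] conjI ballI allI impI F)
  qed
  then obtain F where fam: "\<And>m'. fam m' (F m')" by metis
  have F: "\<And>m' \<beta>. \<beta> \<in> good k n m' \<Longrightarrow> F m' \<beta> \<in> W m'"
    "\<And>m' f. f \<in> W m' \<Longrightarrow> \<exists>d. f = (\<Sum>\<beta>\<in>good k n m'. scale_poly (d \<beta>) (F m' \<beta>))"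
    "\<And>m' d \<beta>. (\<Sum>\<beta>\<in>good k n m'. scale_poly (d \<beta>) (F m' \<beta>)) = 0 \<Longrightarrow> \<beta> \<in> good k n m' \<Longrightarrow> d \<beta> = 0"
    using fam unfolding fam_def by blast+
  define ok where "ok a \<longleftrightarrow> wt n a \<le> m \<and> p dvd m - wt n a" for a
  define mm where "mm a = (m - wt n a) div p" for a
  define D where "D = {a\<in>digits n p. ok a}"
  have fD: "finite D" by (simp add: D_def finite_digits)
  define J where "J = (SIGMA a:D. good k n (mm a))"
  have fJ: "finite J" unfolding J_def using fD finite_good by (rule finite_SigmaI)
  define b where "b j = basis_poly n (fst j) * subst_pow p (F (mm (fst j)) (snd j))" for j
  define G where "G c a = (if ok a then \<Sum>\<beta>\<in>good k n (mm a). scale_poly (c (a, \<beta>)) (F (mm a) \<beta>) else 0)"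
    for c :: "(nat \<Rightarrow> nat) \<times> monom \<Rightarrow> complex" and a
  have GW: "G c a \<in> W (mm a)" for c a
  proof (cases "ok a")
    case True
    then show ?thesis unfolding G_def
      using F(1) by (simp add: cpoly.subspace_sum[OF subW] cpoly.subspace_scale[OF subW])
  next
    case False
    then show ?thesis using cpoly.subspace_0[OF subW] by (simp add: G_def)
  qed
  have Gs: "G c a \<in> symmetric_polys n" for c a using GW[of c a] by (simp add: W_def Symg_def)
  have comb: "(\<Sum>j\<in>J. scale_poly (c j) (b j)) = (\<Sum>a\<in>digits n p. basis_poly n a * subst_pow p (G c a))" for c
  proof -
    have "(\<Sum>j\<in>J. scale_poly (c j) (b j)) =
        (\<Sum>a\<in>D. \<Sum>\<beta>\<in>good k n (mm a). scale_poly (c (a,\<beta>)) (b (a,\<beta>)))"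
      unfolding J_def using fD finite_good by (subst sum.Sigma) auto
    also have "\<dots> = (\<Sum>a\<in>D. basis_poly n a * subst_pow p (G c a))"
      by (intro sum.cong refl)
        (simp add: D_def G_def b_def subst_pow_sum subst_pow_scale sum_distrib_left mult_scale_poly)
    also have "\<dots> = (\<Sum>a\<in>digits n p. basis_poly n a * subst_pow p (G c a))"
      by (rule sum.mono_neutral_left) (auto simp: D_def G_def finite_digits)
    finally show ?thesis .
  qed
  have inF: "(\<Sum>a\<in>digits n p. basis_poly n a * subst_pow p (G c a)) \<in> F_graded k r t q n m" (is "?s \<in> _") for c
  proof -
    have "?s \<in> Symg n m"
    proof (rule cpoly.subspace_sum[OF subspace_Symg])
      fix a assume a: "a \<in> digits n p"
      show "basis_poly n a * subst_pow p (G c a) \<in> Symg n m"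
      proof (cases "ok a")
        case True
        have "basis_poly n a \<in> homogeneous_polys (wt n a)" using basis_poly_in_Symg by (simp add: Symg_def)
        moreover have "subst_pow p (G c a) \<in> homogeneous_polys (p * mm a)"
          using GW[of c a] by (intro homogeneous_subst_pow) (simp add: W_def Symg_def)
        ultimately have "basis_poly n a * subst_pow p (G c a) \<in> homogeneous_polys (wt n a + p * mm a)"
          by (rule homogeneous_mult)
        also have "wt n a + p * mm a = m" using True by (simp add: ok_def mm_def)
        finally show ?thesis
          by (simp add: Symg_def symmetric_mult basis_poly_symmetric symmetric_subst_pow Gs)
      next
        case False
        then show ?thesis using cpoly.subspace_0[OF subspace_Symg] by (simp add: G_def)
      qed
    qed
    moreover have "?s \<in> F_space k r t q n"
      using crit[OF _ Gs refl] calculation GW by (auto simp: Symg_def W_def \<tau>_def)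
    ultimately show ?thesis by (simp add: F_graded_def Symg_def)
  qed
  have z: "c j = 0" if c: "(\<Sum>j\<in>J. scale_poly (c j) (b j)) = 0" and jJ: "j \<in> J" for c j
  proof -
    obtain a \<beta> where j: "j = (a,\<beta>)" "a \<in> D" "\<beta> \<in> good k n (mm a)" using jJ by (auto simp: J_def)
    have "G c a = 0"
      using freeness[OF p, where G = "G c" and n = n and a = a] Gs c j(2) unfolding comb by (simp add: D_def)
    then have "(\<Sum>\<beta>\<in>good k n (mm a). scale_poly (c (a, \<beta>)) (F (mm a) \<beta>)) = 0"
      using j(2) by (simp add: G_def D_def)
    then show ?thesis using F(3)[where m' = "mm a" and d = "\<lambda>\<beta>. c (a,\<beta>)"] j by blast
  qed
  have ind: "cpoly.independent (b ` J)" "inj_on b J"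
    using independent_family[OF fJ, of b] z by blast+
  have "cpoly.dim (F_graded k r t q n m) = card (b ` J)"
  proof (rule cpoly.dim_unique[OF _ _ ind(1) refl])
    show "b ` J \<subseteq> F_graded k r t q n m"
    proof clarify
      fix a \<beta> assume j: "(a,\<beta>) \<in> J"
      have "b (a,\<beta>) = (\<Sum>j\<in>J. scale_poly (if j = (a,\<beta>) then 1 else 0) (b j))"
        using j fJ by (simp add: if_distrib[of "\<lambda>c. scale_poly c _"] cong: if_cong)
      then show "b (a,\<beta>) \<in> F_graded k r t q n m" using inF by (simp add: comb)
    qed
    show "F_graded k r t q n m \<subseteq> cpoly.span (b ` J)"
    proof
      fix f assume f: "f \<in> F_graded k r t q n m"
      then have fS: "f \<in> Symg n m" "f \<in> symmetric_polys n" "f \<in> F_space k r t q n"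
        by (auto simp: F_graded_def F_space_def Symg_def)
      obtain H where H:
        "\<And>a. a \<in> digits n p \<Longrightarrow> wt n a \<le> m \<Longrightarrow> p dvd m - wt n a \<Longrightarrow> H a \<in> Symg n ((m - wt n a) div p)"
        "\<And>a. a \<in> digits n p \<Longrightarrow> \<not> (wt n a \<le> m \<and> p dvd m - wt n a) \<Longrightarrow> H a = 0"
        "f = (\<Sum>a\<in>digits n p. basis_poly n a * subst_pow p (H a))"
        using decomposition[OF p fS(1)] by blast
      have H1: "H a \<in> Symg n (mm a)" if "a \<in> digits n p" for a
      proof (cases "ok a")
        case True
        then show ?thesis using H(1)[OF that] by (simp add: ok_def mm_def)
      next
        case False
        then show ?thesis using H(2)[OF that] cpoly.subspace_0[OF subspace_Symg] by (simp add: ok_def)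
      qed
      have HW: "H a \<in> W (mm a)" if "a \<in> digits n p" for a
        using crit[OF fS(2) _ H(3)] H1 fS(3) that by (auto simp: W_def \<tau>_def Symg_def)
      have "\<exists>d. H a = (\<Sum>\<beta>\<in>good k n (mm a). scale_poly (d \<beta>) (F (mm a) \<beta>))" if "a \<in> digits n p" for a
        using F(2)[OF HW[OF that]] .
      then obtain d where d: "\<And>a. a \<in> digits n p \<Longrightarrow>
          H a = (\<Sum>\<beta>\<in>good k n (mm a). scale_poly (d a \<beta>) (F (mm a) \<beta>))" by metis
      define c where "c j = d (fst j) (snd j)" for j
      have "H a = G c a" if "a \<in> digits n p" for a
        using d[OF that] H(2)[OF that] by (auto simp: G_def c_def ok_def)
      then have "f = (\<Sum>j\<in>J. scale_poly (c j) (b j))" unfolding comb H(3) by (intro sum.cong) auto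
      also have "\<dots> \<in> cpoly.span (b ` J)"
        by (intro cpoly.span_sum cpoly.span_scale cpoly.span_base) auto
      finally show "f \<in> cpoly.span (b ` J)" .
    qed
  qed
  also have "\<dots> = card J" by (rule card_image[OF ind(2)])
  also have "\<dots> = (\<Sum>a\<in>D. card (good k n (mm a)))"
    unfolding J_def using fD finite_good by (subst card_SigmaI) auto
  also have "\<dots> = (\<Sum>a\<in>digits n p. if ok a then card (good k n (mm a)) else 0)"
    unfolding D_def by (rule sum.inter_filter[OF finite_digits])
  finally show ?thesis unfolding ok_def mm_def p_def .
qed

section \<open>Generating functions\<close>

definition good_series :: "nat \<Rightarrow> nat \<Rightarrow> rat fps" where
  "good_series k n = Abs_fps (\<lambda>m. of_nat (card (good k n m)))"

section \<open>Recursions for the two sequences of power series\<close>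

definition shift_up :: "monom \<Rightarrow> monom" where
  "shift_up v = (\<Sum>i\<in>keys v. single (Suc i) (lookup v i))"

definition shift_down :: "monom \<Rightarrow> monom" where
  "shift_down v = Poly_Mapping.map_key Suc v"

lemma lookup_shift_down [simp]: "lookup (shift_down v) i = lookup v (Suc i)"
  by (simp add: shift_down_def map_key.rep_eq)

lemma lookup_shift_up_Suc [simp]: "lookup (shift_up v) (Suc i) = lookup v i"
  by (simp add: shift_up_def lookup_sum lookup_single when_def in_keys_iff)

lemma lookup_shift_up_0 [simp]: "lookup (shift_up v) 0 = 0"
  by (simp add: shift_up_def lookup_sum lookup_single when_def)

lemma deg_shift_up: "deg (shift_up v) = deg v"
  by (simp add: shift_up_def deg_sum deg_def[of v])

lemma mwt_shift_up: "mwt (shift_up v) = deg v + mwt v"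
  by (simp add: shift_up_def mwt_sum deg_def[of v] mwt_def[of v] sum.distrib)

lemma shift_decomp: "v = single 0 (lookup v 0) + shift_up (shift_down v)"
proof (rule poly_mapping_eqI)
  fix i show "lookup v i = lookup (single 0 (lookup v 0) + shift_up (shift_down v)) i"
    by (cases i) (simp_all add: lookup_add lookup_single)
qed

text \<open>The power \<open>e\<^sub>0^j\<close> is split off and every other index is lowered by
  one. There are \<open>n - j\<close> remaining factors, so the weight drops by
  \<open>n - j\<close>.\<close>

lemma card_good_rec:
  "card (good k n m) = (\<Sum>j\<in>{..min k n}. if n - j \<le> m then card (good k (n - j) (m - (n - j))) else 0)"
proof -
  define A where "A j = (if n - j \<le> m then good k (n - j) (m - (n - j)) else {})" for j
  have fA: "finite (A j)" for j by (simp add: A_def finite_good)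
  have "bij_betw (\<lambda>v. (lookup v 0, shift_down v)) (good k n m) (SIGMA j:{..min k n}. A j)"
  proof (rule bij_betw_byWitness[where f' = "\<lambda>(j,v). single 0 j + shift_up v"])
    show "\<forall>v\<in>good k n m. (case (lookup v 0, shift_down v) of (j, v) \<Rightarrow> single 0 j + shift_up v) = v"
      using shift_decomp by simp
    show "\<forall>jv\<in>SIGMA j:{..min k n}. A j.
        (lookup (case jv of (j, v) \<Rightarrow> single 0 j + shift_up v) 0,
         shift_down (case jv of (j, v) \<Rightarrow> single 0 j + shift_up v)) = jv"
      by (auto intro!: poly_mapping_eqI simp: lookup_add lookup_single)
    show "(\<lambda>v. (lookup v 0, shift_down v)) ` good k n m \<subseteq> (SIGMA j:{..min k n}. A j)"
    proof clarify
      fix v assume v: "v \<in> good k n m"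
      have "deg v = lookup v 0 + deg (shift_down v)" "mwt v = deg (shift_down v) + mwt (shift_down v)"
        using arg_cong[OF shift_decomp[of v], of deg] arg_cong[OF shift_decomp[of v], of mwt]
        by (simp_all add: deg_shift_up mwt_shift_up)
      then show "lookup v 0 \<in> {..min k n} \<and> shift_down v \<in> A (lookup v 0)"
        using v by (auto simp: A_def good_def bimons_def)
    qed
    show "(\<lambda>(j, v). single 0 j + shift_up v) ` (SIGMA j:{..min k n}. A j) \<subseteq> good k n m"
    proof (rule image_subsetI)
      fix jv assume "jv \<in> (SIGMA j:{..min k n}. A j)"
      then obtain j v where jv: "jv = (j, v)" and j: "j \<in> {..min k n}" "v \<in> A j" by (cases jv) auto
      have "lookup (single 0 j + shift_up v) i \<le> k" for i
        using j by (cases i) (auto simp: lookup_add lookup_single A_def good_def split: if_splits)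
      then show "(case jv of (j, v) \<Rightarrow> single 0 j + shift_up v) \<in> good k n m"
        using j by (auto simp: jv A_def good_def bimons_def deg_shift_up mwt_shift_up split: if_splits)
    qed
  qed
  then have "card (good k n m) = card (SIGMA j:{..min k n}. A j)" by (rule bij_betw_same_card)
  also have "\<dots> = (\<Sum>j\<in>{..min k n}. card (A j))" using fA by (subst card_SigmaI) auto
  finally show ?thesis by (simp add: A_def if_distrib[of card] cong: if_cong)
qed

lemma good_series_sum: "good_series k n = (\<Sum>i\<in>{n - k..n}. fps_X ^ i * good_series k i)"
proof -
  have "good_series k n = (\<Sum>j\<in>{..min k n}. fps_X ^ (n - j) * good_series k (n - j))"
  proof (rule fps_ext)
    fix m
    show "good_series k n $ m = (\<Sum>j\<in>{..min k n}. fps_X ^ (n - j) * good_series k (n - j)) $ m"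
      by (auto simp: good_series_def card_good_rec[of k n m] fps_sum_nth fps_X_power_mult_nth
          not_le intro!: sum.cong)
  qed
  also have "\<dots> = (\<Sum>i\<in>{n - k..n}. fps_X ^ i * good_series k i)"
    by (rule sum.reindex_bij_witness[where i = "\<lambda>i. n - i" and j = "\<lambda>j. n - j"]) auto
  finally show ?thesis .
qed

text \<open>The coefficient form of (1 - z) f(z) = (1 - z^(k + 1)) f(vz), normalised by f(0) =
  1.\<close>

definition series_rec :: "nat \<Rightarrow> (nat \<Rightarrow> rat fps) \<Rightarrow> bool" where
  "series_rec k f \<longleftrightarrow> f 0 = 1 \<and> (\<forall>n>0. (1 - fps_X ^ n) * f n =
     f (n - 1) - (if k + 1 \<le> n then fps_X ^ (n - (k + 1)) * f (n - (k + 1)) else 0))"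

lemma one_minus_fps_X_power_ne_0:
  assumes "n > 0"
  shows "(1 - fps_X ^ n :: rat fps) \<noteq> 0"
proof -
  have "(1 - fps_X ^ n :: rat fps) $ 0 = 1" using assms by simp
  then show ?thesis by (metis fps_zero_nth zero_neq_one)
qed

lemma series_rec_unique:
  assumes "series_rec k f" "series_rec k g"
  shows "f n = g n"
proof (induction n rule: less_induct)
  case (less n)
  show ?case
  proof (cases "n = 0")
    case False
    then have "f (n - 1) = g (n - 1)" "k + 1 \<le> n \<Longrightarrow> f (n - (k + 1)) = g (n - (k + 1))"
      using less by auto
    then have "(1 - fps_X ^ n) * f n = (1 - fps_X ^ n) * g n"
      using assms False by (auto simp: series_rec_def)
    then show ?thesis using one_minus_fps_X_power_ne_0[of n] False by simp
  qed (use assms in \<open>simp add: series_rec_def\<close>)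
qed

text \<open>The sums for \<open>n\<close> and \<open>n - 1\<close> in \<open>good_series_sum\<close>
  run over windows shifted by one, so their difference has one term at each end. For
  \<open>n \<le> k\<close> both windows start at 0 and the lower term is absent.\<close>

lemma series_rec_good: "series_rec k (good_series k)"
  unfolding series_rec_def
proof (intro conjI allI impI)
  have "good k 0 m = (if m = 0 then {0} else {})" for m
  proof -
    have "v = 0" if "deg v = 0" for v
      using lookup_le_deg[of v] that by (intro poly_mapping_eqI) simp
    then have "deg v = 0 \<longleftrightarrow> v = 0" for v by auto
    then show ?thesis by (auto simp: good_def bimons_def)
  qed
  then show "good_series k 0 = 1" by (intro fps_ext) (auto simp: good_series_def)
  fix n :: nat assume n: "n > 0"
  let ?h = "\<lambda>i. fps_X ^ i * good_series k i"
  have 1: "good_series k n = (\<Sum>i\<in>{n - k..n - 1}. ?h i) + ?h n"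
  proof -
    have "{n - k..n} = insert n {n - k..n - 1}" using n by auto
    moreover have "n \<notin> {n - k..n - 1}" using n by auto
    ultimately have "(\<Sum>i\<in>{n - k..n}. ?h i) = ?h n + (\<Sum>i\<in>{n - k..n - 1}. ?h i)"
      by (simp only: sum.insert finite_atLeastAtMost not_False_eq_True)
    then show ?thesis using good_series_sum[of k n] by (metis add.commute)
  qed
  show "(1 - fps_X ^ n) * good_series k n = good_series k (n - 1) -
      (if k + 1 \<le> n then fps_X ^ (n - (k + 1)) * good_series k (n - (k + 1)) else 0)"
  proof (cases "k + 1 \<le> n")
    case True
    have "good_series k (n - 1) = (\<Sum>i\<in>{n - 1 - k..n - 1}. ?h i)" by (rule good_series_sum)
    also have "\<dots> = ?h (n - 1 - k) + (\<Sum>i\<in>{Suc (n - 1 - k)..n - 1}. ?h i)"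
      by (rule sum.atLeast_Suc_atMost) simp
    also have "Suc (n - 1 - k) = n - k" using True by simp
    finally have "good_series k (n - 1) = ?h (n - (k + 1)) + (\<Sum>i\<in>{n - k..n - 1}. ?h i)" by simp
    then show ?thesis using True 1 by (simp add: algebra_simps)
  next
    case False
    then have "n - k = 0" "n - 1 - k = 0" by auto
    then have "good_series k (n - 1) = (\<Sum>i\<in>{n - k..n - 1}. ?h i)"
      using good_series_sum[of k "n - 1"] by simp
    then show ?thesis using False 1 by (simp add: algebra_simps)
  qed
qed

lemma triangular_Suc: "N * Suc a * (Suc a - 1) div 2 = N * a * (a - 1) div 2 + N * (a :: nat)"
proof (cases a)
  case (Suc b)
  have "N * Suc a * (Suc a - 1) = N * a * (a - 1) + 2 * (N * a)"
    by (simp add: Suc algebra_simps)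
  then show ?thesis by simp
qed simp

text \<open>For n = N a + b, the factor 1 - v^n is split as (1 - v^b) + v^b (1 - v^(N a)). The first
  part cancels the last factor of the denominator for b and leaves a term for n - 1; the second
  cancels the last factor of the denominator for a and leaves a term for n - N with the opposite
  sign.\<close>

lemma series_rec_b: "series_rec k (b_series k)"
proof -
  define N where "N = k + 1"
  have N: "N > 0" by (simp add: N_def)
  define P where "P a = (\<Prod>i=1..a. 1 - fps_X ^ (N * i) :: rat fps)" for a
  define Q where "Q b = (\<Prod>j=1..b. 1 - fps_X ^ j :: rat fps)" for b
  define A where "A a = (-1) ^ a * fps_X ^ (N * a * (a - 1) div 2) * inverse (P a)" for a
  define B where "B b = inverse (Q b)" for b
  have P0: "P a $ 0 = 1" for a using N by (induction a) (simp_all add: P_def)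
  have Q0: "Q b $ 0 = 1" for b by (induction b) (simp_all add: Q_def)
  have iP: "P a * inverse (P a) = 1" for a using P0[of a] by (simp add: inverse_mult_eq_1')
  have iQ: "Q b * inverse (Q b) = 1" for b using Q0[of b] by (simp add: inverse_mult_eq_1')
  have inv_step: "(1 - x) * inverse (y * (1 - x)) = inverse y" if "(1 - x) $ 0 = 1" for x y :: "rat fps"
  proof -
    have "(1 - x) * inverse (y * (1 - x)) = inverse y * ((1 - x) * inverse (1 - x))"
      by (simp add: fps_inverse_mult mult_ac)
    also have "(1 - x) * inverse (1 - x) = 1" by (rule inverse_mult_eq_1') (use that in simp)
    finally show ?thesis by simp
  qed
  have BS: "(1 - fps_X ^ Suc b) * B (Suc b) = B b" for b
    unfolding B_def using inv_step[of "fps_X ^ Suc b" "Q b"] by (simp add: Q_def)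
  have AS: "(1 - fps_X ^ (N * Suc a)) * A (Suc a) = - (fps_X ^ (N * a) * A a)" for a
  proof -
    have "(1 - fps_X ^ (N * Suc a)) * inverse (P (Suc a)) = inverse (P a)"
      using inv_step[of "fps_X ^ (N * Suc a)" "P a"] N by (simp add: P_def)
    moreover have "(1 - fps_X ^ (N * Suc a)) * A (Suc a) =
        (-1) ^ Suc a * fps_X ^ (N * Suc a * (Suc a - 1) div 2) * ((1 - fps_X ^ (N * Suc a)) * inverse (P (Suc a)))"
      unfolding A_def by (rule mult.left_commute)
    ultimately have "(1 - fps_X ^ (N * Suc a)) * A (Suc a) =
        (-1) ^ Suc a * fps_X ^ (N * Suc a * (Suc a - 1) div 2) * inverse (P a)" by metis
    then show ?thesis unfolding triangular_Suc by (simp add: A_def power_add mult_ac)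
  qed
  define T where "T n a = (if N * a \<le> n then A a * B (n - N * a) else 0)" for n a
  have b: "b_series k n = (\<Sum>a\<le>n. T n a)" for n
  proof -
    have "b_series k n = (\<Sum>(a, b)\<in>{(a, b). N * a + b = n}. A a * B b)"
      unfolding b_series_def N_def[symmetric] P_def[symmetric] Q_def[symmetric]
    proof (intro sum.cong refl, clarify)
      fix a b
      have "(P a * Q b) $ 0 \<noteq> 0" using P0 Q0 by simp
      then show "(- 1) ^ a * fps_X ^ (N * a * (a - 1) div 2) / (P a * Q b) = A a * B b"
        by (simp add: fps_divide_unit A_def B_def fps_inverse_mult mult_ac)
    qed
    also have "\<dots> = (\<Sum>a\<in>{a\<in>{..n}. N * a \<le> n}. A a * B (n - N * a))"
    proof (rule sum.reindex_bij_witness[where i = "\<lambda>a. (a, n - N * a)" and j = fst])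
      fix ab assume "ab \<in> {(a, b). N * a + b = n}"
      then obtain a b' where ab: "ab = (a, b')" "N * a + b' = n" by auto
      moreover have "a \<le> N * a" using N by simp
      then have "a \<le> N * a + b'" by (rule trans_le_add1)
      ultimately show "fst ab \<in> {a\<in>{..n}. N * a \<le> n}" using ab by simp
    qed auto
    also have "\<dots> = (\<Sum>a\<le>n. T n a)" unfolding T_def by (rule sum.inter_filter) simp
    finally show ?thesis .
  qed
  show ?thesis unfolding series_rec_def N_def[symmetric]
  proof (intro conjI allI impI)
    show "b_series k 0 = 1" by (simp add: b T_def A_def B_def P_def Q_def)
    fix n :: nat assume n: "n > 0"
    define T1 where "T1 a = (if N * a \<le> n - 1 then A a * B (n - 1 - N * a) else 0)" for a
    define T2 where "T2 a = (if N * a \<le> n then fps_X ^ (n - N * a) * ((1 - fps_X ^ (N * a)) * A a) * B (n - N * a) else 0)" for a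
    have split: "(1 - fps_X ^ n) * T n a = T1 a + T2 a" for a
    proof (cases "N * a \<le> n")
      case False
      then show ?thesis by (simp add: T_def T1_def T2_def)
    next
      case le: True
      define b' where "b' = n - N * a"
      have nb: "n = b' + N * a" using le by (simp add: b'_def)
      \<comment> \<open>For \<open>b' = 0\<close> the factor \<open>1 - fps_X ^ b'\<close> is zero,
        in agreement with the cutoff in \<open>T1\<close>.\<close>
      have t1: "T1 a = A a * ((1 - fps_X ^ b') * B b')"
      proof (cases b')
        case 0
        then have "\<not> N * a \<le> n - 1" using n nb by linarith
        then show ?thesis using 0 by (simp add: T1_def)
      next
        case (Suc c)
        then have "N * a \<le> n - 1" "n - 1 - N * a = c" using nb by auto
        then show ?thesis using BS[of c] Suc by (simp add: T1_def)
      qed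
      have "(1 - fps_X ^ n) * T n a = (1 - fps_X ^ b' * fps_X ^ (N * a)) * (A a * B b')"
        using le by (simp add: T_def b'_def[symmetric] nb power_add)
      also have "\<dots> = A a * ((1 - fps_X ^ b') * B b') + fps_X ^ b' * ((1 - fps_X ^ (N * a)) * A a) * B b'"
        by (simp add: algebra_simps)
      finally show ?thesis using le unfolding t1 T2_def b'_def by simp
    qed
    have "(1 - fps_X ^ n) * b_series k n = (\<Sum>a\<le>n. T1 a) + (\<Sum>a\<le>n. T2 a)"
      by (simp add: b sum_distrib_left split sum.distrib)
    also have "(\<Sum>a\<le>n. T1 a) = b_series k (n - 1)"
    proof -
      have "\<not> N * n \<le> n - 1"
      proof -
        have "n \<le> N * n" using N by simp
        then show ?thesis using n by linarith
      qed
      then have "T1 n = 0" by (simp add: T1_def)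
      moreover have "{..n} = insert n {..n - 1}" using n by auto
      moreover have "T1 = T (n - 1)" by (simp add: T1_def T_def fun_eq_iff)
      ultimately show ?thesis using n by (simp add: b)
    qed
    also have "(\<Sum>a\<le>n. T2 a) = - (if N \<le> n then fps_X ^ (n - N) * b_series k (n - N) else 0)"
    proof -
      have s: "T2 (Suc a) = (if N \<le> n then - (fps_X ^ (n - N) * T (n - N) a) else 0)" for a
      proof (cases "N * Suc a \<le> n")
        case True
        then have le: "N \<le> n" "N * a \<le> n - N" "n - N * Suc a = n - N - N * a" "n - N = (n - N - N * a) + N * a"
          by auto
        have "T2 (Suc a) = - (fps_X ^ (n - N - N * a) * fps_X ^ (N * a) * (A a * B (n - N - N * a)))"
          using True unfolding T2_def AS le(3) by (simp add: mult_ac)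
        also have "fps_X ^ (n - N - N * a) * fps_X ^ (N * a) = (fps_X ^ (n - N) :: rat fps)"
          unfolding power_add[symmetric] using le(4) by simp
        finally show ?thesis using le(1,2) by (simp add: T_def)
      next
        case False
        then show ?thesis by (auto simp: T2_def T_def)
      qed
      obtain n' where n': "n = Suc n'" using n by (cases n) auto
      have "(\<Sum>a\<le>n. T2 a) = T2 0 + (\<Sum>a\<le>n'. T2 (Suc a))"
        unfolding n' by (rule sum.atMost_Suc_shift)
      also have "T2 0 = 0" by (simp add: T2_def)
      also have "(\<Sum>a\<le>n'. T2 (Suc a)) = - (if N \<le> n then fps_X ^ (n - N) * (\<Sum>a\<le>n'. T (n - N) a) else 0)"
        by (simp add: s sum_distrib_left sum_negf)
      also have "(\<Sum>a\<le>n'. T (n - N) a) = b_series k (n - N)"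
      proof -
        have "T (n - N) a = 0" if "a > n - N" for a
        proof -
          have "a \<le> N * a" using N by simp
          then have "\<not> N * a \<le> n - N" using that by linarith
          then show ?thesis by (simp add: T_def)
        qed
        then show ?thesis unfolding b using N n' by (intro sum.mono_neutral_right) auto
      qed
      finally show ?thesis by simp
    qed
    finally show "(1 - fps_X ^ n) * b_series k n =
        b_series k (n - 1) - (if N \<le> n then fps_X ^ (n - N) * b_series k (n - N) else 0)" by simp
  qed
qed

lemma b_series_eq_good_series: "b_series k n = good_series k n"
  by (rule series_rec_unique[OF series_rec_b series_rec_good])

text \<open>Each quotient is a geometric sum of \<open>p\<close> terms; multiplying out chooses one
  digit \<open>a s\<close> for every \<open>s\<close>.\<close>

lemma prod_eq_digits:
  assumes "p > 0"
  shows "(\<Prod>s=1..n. (1 - fps_X ^ (s * p)) / (1 - fps_X ^ s)) = (\<Sum>a\<in>digits n p. fps_X ^ wt n a :: rat fps)"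
proof -
  have "(1 - fps_X ^ (s * p)) / (1 - fps_X ^ s) = (\<Sum>j\<in>{0..<p}. (fps_X ^ (s * j) :: rat fps))" if "s \<in> {1..n}" for s
  proof -
    have "(1 - fps_X ^ (s * p) :: rat fps) = (1 - fps_X ^ s) * (\<Sum>j<p. (fps_X ^ s) ^ j)"
      unfolding power_mult by (rule one_diff_power_eq)
    then show ?thesis using one_minus_fps_X_power_ne_0[of s] that
      by (simp add: power_mult atLeast0LessThan)
  qed
  then have "(\<Prod>s=1..n. (1 - fps_X ^ (s * p)) / (1 - fps_X ^ s)) =
      (\<Prod>s\<in>{1..n}. \<Sum>j\<in>{0..<p}. (fps_X ^ (s * j) :: rat fps))"
    by (intro prod.cong) auto
  also have "\<dots> = (\<Sum>a\<in>digits n p. \<Prod>s\<in>{1..n}. fps_X ^ (s * a s))"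
    unfolding digits_def by (rule prod_sum_PiE) auto
  also have "\<dots> = (\<Sum>a\<in>digits n p. fps_X ^ wt n a)"
    by (simp add: wt_def power_sum)
  finally show ?thesis .
qed

theorem theorem4p7:
  fixes k r :: nat and t q :: complex
  assumes "k \<ge> 1" and "r \<ge> 2"
    and "coprime (k + 1) (r - 1)"
    and "primitive_root_of_unity (k + 1) t"
    and "primitive_root_of_unity (r - 1) q"
  shows "character k r t q =
    Abs_fps (\<lambda>n. (b_series k n oo fps_X ^ (r - 1)) *
      (\<Prod>s=1..n. (1 - fps_X ^ (s * (r - 1))) / (1 - fps_X ^ s)))"
proof (rule fps_ext, rule fps_ext)
  fix n m
  define p where "p = r - 1"
  have p: "p > 0" using assms(2) by (simp add: p_def)
  have "((b_series k n oo fps_X ^ p) * (\<Prod>s=1..n. (1 - fps_X ^ (s * p)) / (1 - fps_X ^ s))) $ m =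
      (\<Sum>a\<in>digits n p. fps_X ^ wt n a * (good_series k n oo fps_X ^ p)) $ m"
    unfolding prod_eq_digits[OF p] b_series_eq_good_series by (simp add: sum_distrib_left mult.commute)
  \<comment> \<open>Composition with \<open>fps_X ^ p\<close> leaves only coefficients at multiples
    of \<open>p\<close>, whence the divisibility condition.\<close>
  also have "\<dots> = (\<Sum>a\<in>digits n p. if wt n a \<le> m \<and> p dvd m - wt n a
      then of_nat (card (good k n ((m - wt n a) div p))) else 0)"
    unfolding fps_sum_nth fps_X_power_mult_nth using p
    by (intro sum.cong refl) (auto simp: fps_nth_compose_X_power good_series_def)
  also have "\<dots> = of_nat (cpoly.dim (F_graded k r t q n m))"
    unfolding dim_F_graded[OF assms] p_def[symmetric] of_nat_sum by (intro sum.cong) auto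
  finally show "character k r t q $ n $ m = Abs_fps (\<lambda>n. (b_series k n oo fps_X ^ (r - 1)) *
      (\<Prod>s=1..n. (1 - fps_X ^ (s * (r - 1))) / (1 - fps_X ^ s))) $ n $ m"
    by (simp add: character_def p_def)
qed

end
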